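(* Let $(H,R,\alpha,\beta,m,\Delta,\epsilon)$ be a Hopf algebroid with anchor $\mu$. Then the category $\mathrm{Rep}\,H$ of left $H$-modules, equipped with the tensor product $M_1\otimes_R M_2$ on which $H$ acts by $h\cdot(m_1\otimes_R m_2)=\Delta(h)(m_1\otimes m_2)$, the unit object $(R,\mu)$ (that is, $R$ regarded as a left $H$-module via $\mu$), and the trivial associativity isomorphisms $(M_1\otimes_R M_2)\otimes_R M_3\to M_1\otimes_R(M_2\otimes_R M_3)$, is a monoidal category.
   Context: Throughout, $k$ is a field of characteristic $0$ and algebras are associative unital $k$-algebras. A Hopf algebroid $(H,R,\alpha,\beta,m,\Delta,\epsilon)$ (no antipode is required) consists of: (1) an algebra $H$ (total algebra, product $m$), an algebra $R$ (base algebra), an algebra homomorphism $\alpha:R\to H$ (source map) and an algebra anti-homomorphism $\beta:R\to H$ (target map) with $\alpha(a)\beta(b)=\beta(b)\alpha(a)$ for all $a,b\in R$; $H$ is an $(R,R)$-bimodule via $a\cdot h=\alpha(a)h$, $h\cdot a=\beta(a)h$, and $H\otimes_R H$, $H\otimes_R H\otimes_R H$, etc. are formed with respect to this structure and are again $(R,R)$-bimodules; (2) an $(R,R)$-bimodule map $\Delta:H\to H\otimes_R H$ with $\Delta(1)=1\otimes 1$ and $(\Delta\otimes_R \mathrm{id})\Delta=(\mathrm{id}\otimes_R\Delta)\Delta$; (3) compatibility: $\Delta(h)(\beta(a)\otimes 1-1\otimes\alpha(a))=0$ in $H\otimes_R H$ for all $a\in R$, $h\in H$, and $\Delta(h_1h_2)=\Delta(h_1)\Delta(h_2)$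 for all $h_1,h_2\in H$ (the right side makes sense by the first condition); (4) an $(R,R)$-bimodule map $\epsilon:H\to R$ with $\epsilon(1_H)=1_R$ and $(\epsilon\otimes_R\mathrm{id})\Delta=(\mathrm{id}\otimes_R\epsilon)\Delta=\mathrm{id}_H$, using $R\otimes_R H\cong H\otimes_R R\cong H$. Every left $H$-module $M$ is an $(R,R)$-bimodule via $a\cdot m=\alpha(a)m$, $m\cdot a=\beta(a)m$, and $M_1\otimes_R M_2$ is formed accordingly. $\mathrm{End}_kR$ is an $(R,R)$-bimodule via $(a\cdot\phi)(b)=a\phi(b)$, $(\phi\cdot a)(b)=\phi(b)a$. An anchor is a representation (algebra homomorphism) $\mu:H\to \mathrm{End}_kR$ which is an $(R,R)$-bimodule map such that, writing $x(a)=\mu(x)(a)$ and defining $\phi_\alpha,\phi_\beta:(H\otimes_R H)\otimes R\to H$ by $\phi_\alpha(x\otimes_R y\otimes a)=x(a)\cdot y=\alpha(x(a))y$ and $\phi_\beta(x\otimes_R y\otimes a)=x\cdot y(a)=\beta(y(a))x$, one has for all $x\in H$, $a\in R$: (i) $\phi_\alpha(\Delta x\otimes a)=x\alpha(a)$ and $\phi_\beta(\Delta x\otimes a)=x\beta(a)$; (ii) $x(1_R)=\epsilon(x)$. *)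

theory Defs
  imports "HOL-Algebra.Module" "HOL-Algebra.Generated_Groups" "HOL-Algebra.Free_Abelian_Groups"
begin

section \<open>Associative unital algebras and left modules\<close>

text \<open>
  The library locale \<^locale>\<open>algebra\<close> is restricted to commutative algebras. The zero algebra
  is allowed, as in \<^locale>\<open>ring\<close>.
\<close>

locale assoc_algebra = module K A + ring A
  for K :: "('k, 'c) ring_scheme" and A :: "('k, 'a, 'd) module_scheme" +
  assumes smult_mult_left: "\<lbrakk>c \<in> carrier K; x \<in> carrier A; y \<in> carrier A\<rbrakk> \<Longrightarrow>
      (c \<odot>\<^bsub>A\<^esub> x) \<otimes>\<^bsub>A\<^esub> y = c \<odot>\<^bsub>A\<^esub> (x \<otimes>\<^bsub>A\<^esub> y)"
    and smult_mult_right: "\<lbrakk>c \<in> carrier K; x \<in> carrier A; y \<in> carrier A\<rbrakk> \<Longrightarrow>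
      x \<otimes>\<^bsub>A\<^esub> (c \<odot>\<^bsub>A\<^esub> y) = c \<odot>\<^bsub>A\<^esub> (x \<otimes>\<^bsub>A\<^esub> y)"

definition algebra_hom ::
  "('k, 'c) ring_scheme \<Rightarrow> ('k, 'a, 'd) module_scheme \<Rightarrow> ('k, 'b, 'e) module_scheme \<Rightarrow> ('a \<Rightarrow> 'b) set"
  where "algebra_hom K A B =
    {f \<in> ring_hom A B. \<forall>c\<in>carrier K. \<forall>x\<in>carrier A. f (c \<odot>\<^bsub>A\<^esub> x) = c \<odot>\<^bsub>B\<^esub> f x}"

definition opposite :: "('k, 'a, 'd) module_scheme \<Rightarrow> ('k, 'a, 'd) module_scheme"
  where "opposite A = A\<lparr>monoid.mult := \<lambda>x y. y \<otimes>\<^bsub>A\<^esub> x\<rparr>"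

definition End_algebra ::
  "('k, 'c) ring_scheme \<Rightarrow> ('k, 'r, 'd) module_scheme \<Rightarrow> ('k, 'r \<Rightarrow> 'r) module"
  where "End_algebra K R = \<lparr>
    carrier = {f \<in> carrier R \<rightarrow>\<^sub>E carrier R.
      (\<forall>a\<in>carrier R. \<forall>b\<in>carrier R. f (a \<oplus>\<^bsub>R\<^esub> b) = f a \<oplus>\<^bsub>R\<^esub> f b) \<and>
      (\<forall>c\<in>carrier K. \<forall>a\<in>carrier R. f (c \<odot>\<^bsub>R\<^esub> a) = c \<odot>\<^bsub>R\<^esub> f a)},
    monoid.mult = compose (carrier R), one = (\<lambda>a\<in>carrier R. a),
    ring.zero = (\<lambda>a\<in>carrier R. \<zero>\<^bsub>R\<^esub>), add = (\<lambda>f g. \<lambda>a\<in>carrier R. f a \<oplus>\<^bsub>R\<^esub> g a),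
    smult = (\<lambda>c f. \<lambda>a\<in>carrier R. c \<odot>\<^bsub>R\<^esub> f a)\<rparr>"

text \<open>
  Left modules over a not necessarily commutative ring. As for the library locale
  \<^locale>\<open>module\<close>, the fields \<open>mult\<close> and \<open>one\<close> of the record carry no information.
\<close>

locale left_module = ring H + M?: abelian_group M
  for H :: "('h, 'c) ring_scheme" and M :: "('h, 'm, 'd) module_scheme" +
  assumes act_closed: "\<lbrakk>x \<in> carrier H; m \<in> carrier M\<rbrakk> \<Longrightarrow> x \<odot>\<^bsub>M\<^esub> m \<in> carrier M"
    and act_add_left: "\<lbrakk>x \<in> carrier H; y \<in> carrier H; m \<in> carrier M\<rbrakk> \<Longrightarrow>
      (x \<oplus>\<^bsub>H\<^esub> y) \<odot>\<^bsub>M\<^esub> m = x \<odot>\<^bsub>M\<^esub> m \<oplus>\<^bsub>M\<^esub> y \<odot>\<^bsub>M\<^esub> m"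
    and act_add_right: "\<lbrakk>x \<in> carrier H; m \<in> carrier M; n \<in> carrier M\<rbrakk> \<Longrightarrow>
      x \<odot>\<^bsub>M\<^esub> (m \<oplus>\<^bsub>M\<^esub> n) = x \<odot>\<^bsub>M\<^esub> m \<oplus>\<^bsub>M\<^esub> x \<odot>\<^bsub>M\<^esub> n"
    and act_mult: "\<lbrakk>x \<in> carrier H; y \<in> carrier H; m \<in> carrier M\<rbrakk> \<Longrightarrow>
      (x \<otimes>\<^bsub>H\<^esub> y) \<odot>\<^bsub>M\<^esub> m = x \<odot>\<^bsub>M\<^esub> (y \<odot>\<^bsub>M\<^esub> m)"
    and act_one: "m \<in> carrier M \<Longrightarrow> \<one>\<^bsub>H\<^esub> \<odot>\<^bsub>M\<^esub> m = m"

definition regular_module :: "('a, 'c) ring_scheme \<Rightarrow> ('a, 'a) module"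
  where "regular_module A = \<lparr>carrier = carrier A, monoid.mult = monoid.mult A, one = one A,
    ring.zero = ring.zero A, add = add A, smult = monoid.mult A\<rparr>"


section \<open>Bimodules and their tensor product\<close>

record ('r, 'b) bimodule = "'b ring" +
  lact :: "'r \<Rightarrow> 'b \<Rightarrow> 'b"
  ract :: "'b \<Rightarrow> 'r \<Rightarrow> 'b"

definition bimodule_hom ::
  "('r, 'c) ring_scheme \<Rightarrow> ('r, 'b, 'd) bimodule_scheme \<Rightarrow> ('r, 'e, 'f) bimodule_scheme \<Rightarrow> ('b \<Rightarrow> 'e) set"
  where "bimodule_hom R B C = {f \<in> carrier B \<rightarrow> carrier C.
    (\<forall>x\<in>carrier B. \<forall>y\<in>carrier B. f (x \<oplus>\<^bsub>B\<^esub> y) = f x \<oplus>\<^bsub>C\<^esub> f y) \<and>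
    (\<forall>a\<in>carrier R. \<forall>x\<in>carrier B. f (lact B a x) = lact C a (f x)) \<and>
    (\<forall>a\<in>carrier R. \<forall>x\<in>carrier B. f (ract B x a) = ract C (f x) a)}"

definition regular_bimodule :: "('r, 'c) ring_scheme \<Rightarrow> ('r, 'r) bimodule"
  where "regular_bimodule R = \<lparr>carrier = carrier R, monoid.mult = monoid.mult R, one = one R,
    ring.zero = ring.zero R, add = add R, lact = monoid.mult R, ract = monoid.mult R\<rparr>"

definition End_bimodule ::
  "('k, 'c) ring_scheme \<Rightarrow> ('k, 'r, 'd) module_scheme \<Rightarrow> ('r, 'r \<Rightarrow> 'r) bimodule"
  where "End_bimodule K R = (let E = End_algebra K R in
    \<lparr>carrier = carrier E, monoid.mult = monoid.mult E, one = one E,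
     ring.zero = ring.zero E, add = add E,
     lact = (\<lambda>a f. \<lambda>b\<in>carrier R. a \<otimes>\<^bsub>R\<^esub> f b),
     ract = (\<lambda>f a. \<lambda>b\<in>carrier R. f b \<otimes>\<^bsub>R\<^esub> a)\<rparr>)"

text \<open>
  The \<open>(R, R)\<close>-bimodule underlying a left \<open>H\<close>-module. For \<open>\<beta>\<close> an anti-homomorphism,
  \<open>\<beta>(a)\<cdot>m\<close> is a right action.
\<close>

definition module_bimodule ::
  "('r \<Rightarrow> 'h) \<Rightarrow> ('r \<Rightarrow> 'h) \<Rightarrow> ('h, 'm, 'c) module_scheme \<Rightarrow> ('r, 'm) bimodule"
  where "module_bimodule \<alpha> \<beta> M = \<lparr>carrier = carrier M, monoid.mult = monoid.mult M, one = one M,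
    ring.zero = ring.zero M, add = add M, lact = (\<lambda>a m. \<alpha> a \<odot>\<^bsub>M\<^esub> m), ract = (\<lambda>m a. \<beta> a \<odot>\<^bsub>M\<^esub> m)\<rparr>"

text \<open>
  \<open>B \<otimes>\<^sub>R C\<close> is the free abelian group on \<open>B \<times> C\<close> modulo biadditivity and \<open>R\<close>-balancedness;
  its elements are cosets.
\<close>

definition tensor_relations ::
  "('r, 'c) ring_scheme \<Rightarrow> ('r, 'm, 'd) bimodule_scheme \<Rightarrow> ('r, 'n, 'e) bimodule_scheme
    \<Rightarrow> ('m \<times> 'n \<Rightarrow>\<^sub>0 int) set"
  where "tensor_relations R B C =
    {frag_of (b \<oplus>\<^bsub>B\<^esub> b', c) - frag_of (b, c) - frag_of (b', c) | b b' c.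
      b \<in> carrier B \<and> b' \<in> carrier B \<and> c \<in> carrier C} \<union>
    {frag_of (b, c \<oplus>\<^bsub>C\<^esub> c') - frag_of (b, c) - frag_of (b, c') | b c c'.
      b \<in> carrier B \<and> c \<in> carrier C \<and> c' \<in> carrier C} \<union>
    {frag_of (ract B b a, c) - frag_of (b, lact C a c) | b a c.
      b \<in> carrier B \<and> a \<in> carrier R \<and> c \<in> carrier C}"

definition tensor_kernel ::
  "('r, 'c) ring_scheme \<Rightarrow> ('r, 'm, 'd) bimodule_scheme \<Rightarrow> ('r, 'n, 'e) bimodule_scheme
    \<Rightarrow> ('m \<times> 'n \<Rightarrow>\<^sub>0 int) set"
  where "tensor_kernel R B C =
    generate (free_Abelian_group (carrier B \<times> carrier C)) (tensor_relations R B C)"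

definition tensor_group ::
  "('r, 'c) ring_scheme \<Rightarrow> ('r, 'm, 'd) bimodule_scheme \<Rightarrow> ('r, 'n, 'e) bimodule_scheme
    \<Rightarrow> ('m \<times> 'n \<Rightarrow>\<^sub>0 int) set ring"
  where "tensor_group R B C =
    (let T = free_Abelian_group (carrier B \<times> carrier C) Mod tensor_kernel R B C in
     \<lparr>carrier = carrier T, monoid.mult = undefined, one = undefined,
      ring.zero = one T, add = monoid.mult T\<rparr>)"

definition tensor ::
  "('r, 'c) ring_scheme \<Rightarrow> ('r, 'm, 'd) bimodule_scheme \<Rightarrow> ('r, 'n, 'e) bimodule_scheme
    \<Rightarrow> 'm \<Rightarrow> 'n \<Rightarrow> ('m \<times> 'n \<Rightarrow>\<^sub>0 int) set"
  where "tensor R B C b c =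
    tensor_kernel R B C #>\<^bsub>free_Abelian_group (carrier B \<times> carrier C)\<^esub> frag_of (b, c)"

text \<open>
  The additive map \<open>B \<otimes>\<^sub>R C \<rightarrow> G\<close>, \<open>b \<otimes> c \<mapsto> f b c\<close>, induced by a biadditive balanced map \<open>f\<close>:
  the linear extension of \<open>f\<close> is constant on the cosets of the relations, and
  \<^const>\<open>the_elem\<close> picks its value.
\<close>

definition tensor_lift ::
  "('g, 'c) ring_scheme \<Rightarrow> ('m \<Rightarrow> 'n \<Rightarrow> 'g) \<Rightarrow> ('m \<times> 'n \<Rightarrow>\<^sub>0 int) set \<Rightarrow> 'g"
  where "tensor_lift G f X =
    the_elem ((\<lambda>p. \<Oplus>\<^bsub>G\<^esub>z\<in>Poly_Mapping.keys p.
      [Poly_Mapping.lookup p z] \<cdot>\<^bsub>G\<^esub> f (fst z) (snd z)) ` X)"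

definition tensor_bimodule ::
  "('r, 'c) ring_scheme \<Rightarrow> ('r, 'm, 'd) bimodule_scheme \<Rightarrow> ('r, 'n, 'e) bimodule_scheme
    \<Rightarrow> ('r, ('m \<times> 'n \<Rightarrow>\<^sub>0 int) set) bimodule"
  where "tensor_bimodule R B C = (let T = tensor_group R B C in
    \<lparr>carrier = carrier T, monoid.mult = monoid.mult T, one = one T,
     ring.zero = ring.zero T, add = add T,
     lact = (\<lambda>a. tensor_lift T (\<lambda>b c. tensor R B C (lact B a b) c)),
     ract = (\<lambda>t a. tensor_lift T (\<lambda>b c. tensor R B C b (ract C c a)) t)\<rparr>)"

text \<open>\<open>tensor_map R B' C' f g\<close> is \<open>f \<otimes>\<^sub>R g\<close> with codomain \<open>B' \<otimes>\<^sub>R C'\<close>.\<close>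

definition tensor_map ::
  "('r, 'c) ring_scheme \<Rightarrow> ('r, 'm2, 'd) bimodule_scheme \<Rightarrow> ('r, 'n2, 'e) bimodule_scheme
    \<Rightarrow> ('m \<Rightarrow> 'm2) \<Rightarrow> ('n \<Rightarrow> 'n2) \<Rightarrow> ('m \<times> 'n \<Rightarrow>\<^sub>0 int) set \<Rightarrow> ('m2 \<times> 'n2 \<Rightarrow>\<^sub>0 int) set"
  where "tensor_map R B' C' f g =
    tensor_lift (tensor_group R B' C') (\<lambda>b c. tensor R B' C' (f b) (g c))"

text \<open>The canonical map \<open>(B \<otimes>\<^sub>R C) \<otimes>\<^sub>R D \<rightarrow> B \<otimes>\<^sub>R (C \<otimes>\<^sub>R D)\<close>.\<close>

definition tensor_assoc ::
  "('r, 'c) ring_scheme \<Rightarrow> ('r, 'l) bimodule \<Rightarrow> ('r, 'm) bimodule \<Rightarrow> ('r, 'n) bimodule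
    \<Rightarrow> (('l \<times> 'm \<Rightarrow>\<^sub>0 int) set \<times> 'n \<Rightarrow>\<^sub>0 int) set \<Rightarrow> ('l \<times> ('m \<times> 'n \<Rightarrow>\<^sub>0 int) set \<Rightarrow>\<^sub>0 int) set"
  where "tensor_assoc R B C D =
    (let CD = tensor_bimodule R C D; T = tensor_group R B CD in
     tensor_lift T (\<lambda>u d. tensor_lift T (\<lambda>b c. tensor R B CD b (tensor R C D c d)) u))"


section \<open>Hopf algebroids and anchors\<close>

definition total_bimodule ::
  "('h, 'c) ring_scheme \<Rightarrow> ('r \<Rightarrow> 'h) \<Rightarrow> ('r \<Rightarrow> 'h) \<Rightarrow> ('r, 'h) bimodule"
  where "total_bimodule H \<alpha> \<beta> = module_bimodule \<alpha> \<beta> (regular_module H)"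

text \<open>
  \<open>H \<otimes>\<^sub>R H\<close> is in general not a ring, but right multiplication by \<open>x \<otimes> y\<close> with
  \<open>x, y \<in> H\<close> is well defined on it: \<open>(u \<otimes> v)(x \<otimes> y) = ux \<otimes> vy\<close>.
\<close>

definition tensor_rmult ::
  "('r, 'c) ring_scheme \<Rightarrow> ('h, 'd) ring_scheme \<Rightarrow> ('r \<Rightarrow> 'h) \<Rightarrow> ('r \<Rightarrow> 'h)
    \<Rightarrow> ('h \<times> 'h \<Rightarrow>\<^sub>0 int) set \<Rightarrow> 'h \<Rightarrow> 'h \<Rightarrow> ('h \<times> 'h \<Rightarrow>\<^sub>0 int) set"
  where "tensor_rmult R H \<alpha> \<beta> X x y = (let B = total_bimodule H \<alpha> \<beta> in
    tensor_lift (tensor_group R B B) (\<lambda>u v. tensor R B B (u \<otimes>\<^bsub>H\<^esub> x) (v \<otimes>\<^bsub>H\<^esub> y)) X)"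

text \<open>
  The product \<open>X Y\<close> in \<open>H \<otimes>\<^sub>R H\<close>, additive in \<open>Y\<close>. It is meaningful for those \<open>X\<close> with
  \<open>X (\<beta>(a) \<otimes> 1 - 1 \<otimes> \<alpha>(a)) = 0\<close> for all \<open>a\<close>; it is only used for \<open>X\<close> in the image of \<open>\<Delta>\<close>.
\<close>

definition tensor_mult ::
  "('r, 'c) ring_scheme \<Rightarrow> ('h, 'd) ring_scheme \<Rightarrow> ('r \<Rightarrow> 'h) \<Rightarrow> ('r \<Rightarrow> 'h)
    \<Rightarrow> ('h \<times> 'h \<Rightarrow>\<^sub>0 int) set \<Rightarrow> ('h \<times> 'h \<Rightarrow>\<^sub>0 int) set \<Rightarrow> ('h \<times> 'h \<Rightarrow>\<^sub>0 int) set"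
  where "tensor_mult R H \<alpha> \<beta> X = (let B = total_bimodule H \<alpha> \<beta> in
    tensor_lift (tensor_group R B B) (tensor_rmult R H \<alpha> \<beta> X))"

locale hopf_algebroid =
  H: assoc_algebra K H + R: assoc_algebra K R
  for K :: "('k, 'c) ring_scheme" and H :: "('k, 'h) module" and R :: "('k, 'r) module" +
  fixes \<alpha> \<beta> :: "'r \<Rightarrow> 'h"
    and \<Delta> :: "'h \<Rightarrow> ('h \<times> 'h \<Rightarrow>\<^sub>0 int) set"
    and \<epsilon> :: "'h \<Rightarrow> 'r"
  assumes source_hom: "\<alpha> \<in> algebra_hom K R H"
    and target_antihom: "\<beta> \<in> algebra_hom K R (opposite H)"
    and source_target_commute: "\<lbrakk>a \<in> carrier R; b \<in> carrier R\<rbrakk> \<Longrightarrow>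
      \<alpha> a \<otimes>\<^bsub>H\<^esub> \<beta> b = \<beta> b \<otimes>\<^bsub>H\<^esub> \<alpha> a"
    and comult_hom: "\<Delta> \<in> bimodule_hom R (total_bimodule H \<alpha> \<beta>)
      (tensor_bimodule R (total_bimodule H \<alpha> \<beta>) (total_bimodule H \<alpha> \<beta>))"
    and comult_one:
      "\<Delta> \<one>\<^bsub>H\<^esub> = tensor R (total_bimodule H \<alpha> \<beta>) (total_bimodule H \<alpha> \<beta>) \<one>\<^bsub>H\<^esub> \<one>\<^bsub>H\<^esub>"
    and coassoc: "h \<in> carrier H \<Longrightarrow>
      tensor_assoc R (total_bimodule H \<alpha> \<beta>) (total_bimodule H \<alpha> \<beta>) (total_bimodule H \<alpha> \<beta>)
        (tensor_map R (tensor_bimodule R (total_bimodule H \<alpha> \<beta>) (total_bimodule H \<alpha> \<beta>))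
          (total_bimodule H \<alpha> \<beta>) \<Delta> (\<lambda>x. x) (\<Delta> h))
      = tensor_map R (total_bimodule H \<alpha> \<beta>)
          (tensor_bimodule R (total_bimodule H \<alpha> \<beta>) (total_bimodule H \<alpha> \<beta>)) (\<lambda>x. x) \<Delta> (\<Delta> h)"
    and comult_balanced: "\<lbrakk>h \<in> carrier H; a \<in> carrier R\<rbrakk> \<Longrightarrow>
      tensor_rmult R H \<alpha> \<beta> (\<Delta> h) (\<beta> a) \<one>\<^bsub>H\<^esub>
        \<ominus>\<^bsub>tensor_group R (total_bimodule H \<alpha> \<beta>) (total_bimodule H \<alpha> \<beta>)\<^esub>
        tensor_rmult R H \<alpha> \<beta> (\<Delta> h) \<one>\<^bsub>H\<^esub> (\<alpha> a)
      = \<zero>\<^bsub>tensor_group R (total_bimodule H \<alpha> \<beta>) (total_bimodule H \<alpha> \<beta>)\<^esub>"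
    and comult_mult: "\<lbrakk>g \<in> carrier H; h \<in> carrier H\<rbrakk> \<Longrightarrow>
      \<Delta> (g \<otimes>\<^bsub>H\<^esub> h) = tensor_mult R H \<alpha> \<beta> (\<Delta> g) (\<Delta> h)"
    and counit_hom: "\<epsilon> \<in> bimodule_hom R (total_bimodule H \<alpha> \<beta>) (regular_bimodule R)"
    and counit_one: "\<epsilon> \<one>\<^bsub>H\<^esub> = \<one>\<^bsub>R\<^esub>"
    \<comment> \<open>The outer lifts are the canonical isomorphisms from \<open>R \<otimes>\<^sub>R H\<close> and \<open>H \<otimes>\<^sub>R R\<close> to \<open>H\<close>.\<close>
    and counit_left: "h \<in> carrier H \<Longrightarrow>
      tensor_lift H (lact (total_bimodule H \<alpha> \<beta>))
        (tensor_map R (regular_bimodule R) (total_bimodule H \<alpha> \<beta>) \<epsilon> (\<lambda>x. x) (\<Delta> h)) = h"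
    and counit_right: "h \<in> carrier H \<Longrightarrow>
      tensor_lift H (ract (total_bimodule H \<alpha> \<beta>))
        (tensor_map R (total_bimodule H \<alpha> \<beta>) (regular_bimodule R) (\<lambda>x. x) \<epsilon> (\<Delta> h)) = h"

text \<open>The maps \<open>\<phi>\<^sub>\<alpha>(x \<otimes> y \<otimes> a) = \<alpha>(x(a)) y\<close> and \<open>\<phi>\<^sub>\<beta>(x \<otimes> y \<otimes> a) = \<beta>(y(a)) x\<close>, curried.\<close>

definition anchor_phi_source ::
  "('h, 'c) ring_scheme \<Rightarrow> ('r \<Rightarrow> 'h) \<Rightarrow> ('h \<Rightarrow> 'r \<Rightarrow> 'r) \<Rightarrow> ('h \<times> 'h \<Rightarrow>\<^sub>0 int) set \<Rightarrow> 'r \<Rightarrow> 'h"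
  where "anchor_phi_source H \<alpha> \<mu> X a = tensor_lift H (\<lambda>x y. \<alpha> (\<mu> x a) \<otimes>\<^bsub>H\<^esub> y) X"

definition anchor_phi_target ::
  "('h, 'c) ring_scheme \<Rightarrow> ('r \<Rightarrow> 'h) \<Rightarrow> ('h \<Rightarrow> 'r \<Rightarrow> 'r) \<Rightarrow> ('h \<times> 'h \<Rightarrow>\<^sub>0 int) set \<Rightarrow> 'r \<Rightarrow> 'h"
  where "anchor_phi_target H \<beta> \<mu> X a = tensor_lift H (\<lambda>x y. \<beta> (\<mu> y a) \<otimes>\<^bsub>H\<^esub> x) X"

locale anchored_hopf_algebroid = hopf_algebroid K H R \<alpha> \<beta> \<Delta> \<epsilon>
  for K :: "('k, 'c) ring_scheme" and H :: "('k, 'h) module" and R :: "('k, 'r) module"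
    and \<alpha> \<beta> \<Delta> \<epsilon> +
  fixes \<mu> :: "'h \<Rightarrow> 'r \<Rightarrow> 'r"
  assumes anchor_algebra_hom: "\<mu> \<in> algebra_hom K H (End_algebra K R)"
    and anchor_bimodule_hom: "\<mu> \<in> bimodule_hom R (total_bimodule H \<alpha> \<beta>) (End_bimodule K R)"
    and anchor_source: "\<lbrakk>x \<in> carrier H; a \<in> carrier R\<rbrakk> \<Longrightarrow>
      anchor_phi_source H \<alpha> \<mu> (\<Delta> x) a = x \<otimes>\<^bsub>H\<^esub> \<alpha> a"
    and anchor_target: "\<lbrakk>x \<in> carrier H; a \<in> carrier R\<rbrakk> \<Longrightarrow>
      anchor_phi_target H \<beta> \<mu> (\<Delta> x) a = x \<otimes>\<^bsub>H\<^esub> \<beta> a"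
    and anchor_counit: "x \<in> carrier H \<Longrightarrow> \<mu> x \<one>\<^bsub>R\<^esub> = \<epsilon> x"


section \<open>Monoidal categories\<close>

text \<open>
  Categories are given by hom-sets, which need not be disjoint; composition, and the tensor
  product of morphisms, therefore take the objects as arguments.
\<close>

locale category =
  fixes Obj :: "'o set"
    and Hom :: "'o \<Rightarrow> 'o \<Rightarrow> 'a set"
    and Id :: "'o \<Rightarrow> 'a"
    and Comp :: "'o \<Rightarrow> 'o \<Rightarrow> 'o \<Rightarrow> 'a \<Rightarrow> 'a \<Rightarrow> 'a"
  assumes Id_in_Hom: "A \<in> Obj \<Longrightarrow> Id A \<in> Hom A A"
    and Comp_in_Hom: "\<lbrakk>A \<in> Obj; B \<in> Obj; C \<in> Obj; f \<in> Hom A B; g \<in> Hom B C\<rbrakk> \<Longrightarrow>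
      Comp A B C g f \<in> Hom A C"
    and Comp_Id: "\<lbrakk>A \<in> Obj; B \<in> Obj; f \<in> Hom A B\<rbrakk> \<Longrightarrow> Comp A A B f (Id A) = f"
    and Id_Comp: "\<lbrakk>A \<in> Obj; B \<in> Obj; f \<in> Hom A B\<rbrakk> \<Longrightarrow> Comp A B B (Id B) f = f"
    and Comp_assoc: "\<lbrakk>A \<in> Obj; B \<in> Obj; C \<in> Obj; D \<in> Obj;
        f \<in> Hom A B; g \<in> Hom B C; h \<in> Hom C D\<rbrakk> \<Longrightarrow>
      Comp A C D h (Comp A B C g f) = Comp A B D (Comp B C D h g) f"
begin

definition Iso :: "'o \<Rightarrow> 'o \<Rightarrow> 'a set"
  where "Iso A B = {f \<in> Hom A B. \<exists>g\<in>Hom B A. Comp A B A g f = Id A \<and> Comp B A B f g = Id B}"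

end

text \<open>
  \<open>TA A A' B B' f g : A \<otimes> B \<rightarrow> A' \<otimes> B'\<close> is the tensor product of \<open>f : A \<rightarrow> A'\<close>, \<open>g : B \<rightarrow> B'\<close>;
  \<open>a\<close>, \<open>l\<close>, \<open>r\<close> are the associator \<open>(A \<otimes> B) \<otimes> C \<rightarrow> A \<otimes> (B \<otimes> C)\<close> and the unitors
  \<open>I \<otimes> A \<rightarrow> A\<close>, \<open>A \<otimes> I \<rightarrow> A\<close>.
\<close>

locale monoidal_category = category Obj Hom Id Comp
  for Obj :: "'o set"
    and Hom :: "'o \<Rightarrow> 'o \<Rightarrow> 'a set"
    and Id :: "'o \<Rightarrow> 'a"
    and Comp :: "'o \<Rightarrow> 'o \<Rightarrow> 'o \<Rightarrow> 'a \<Rightarrow> 'a \<Rightarrow> 'a" +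
  fixes T :: "'o \<Rightarrow> 'o \<Rightarrow> 'o"
    and TA :: "'o \<Rightarrow> 'o \<Rightarrow> 'o \<Rightarrow> 'o \<Rightarrow> 'a \<Rightarrow> 'a \<Rightarrow> 'a"
    and I :: 'o
    and a :: "'o \<Rightarrow> 'o \<Rightarrow> 'o \<Rightarrow> 'a"
    and l r :: "'o \<Rightarrow> 'a"
  assumes T_obj: "\<lbrakk>A \<in> Obj; B \<in> Obj\<rbrakk> \<Longrightarrow> T A B \<in> Obj"
    and TA_in_Hom: "\<lbrakk>A \<in> Obj; A' \<in> Obj; B \<in> Obj; B' \<in> Obj; f \<in> Hom A A'; g \<in> Hom B B'\<rbrakk> \<Longrightarrow>
      TA A A' B B' f g \<in> Hom (T A B) (T A' B')"
    and TA_Id: "\<lbrakk>A \<in> Obj; B \<in> Obj\<rbrakk> \<Longrightarrow> TA A A B B (Id A) (Id B) = Id (T A B)"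
    and TA_Comp: "\<lbrakk>A \<in> Obj; A' \<in> Obj; A'' \<in> Obj; B \<in> Obj; B' \<in> Obj; B'' \<in> Obj;
        f \<in> Hom A A'; f' \<in> Hom A' A''; g \<in> Hom B B'; g' \<in> Hom B' B''\<rbrakk> \<Longrightarrow>
      TA A A'' B B'' (Comp A A' A'' f' f) (Comp B B' B'' g' g) =
      Comp (T A B) (T A' B') (T A'' B'') (TA A' A'' B' B'' f' g') (TA A A' B B' f g)"
    and unit_obj: "I \<in> Obj"
    and assoc_iso: "\<lbrakk>A \<in> Obj; B \<in> Obj; C \<in> Obj\<rbrakk> \<Longrightarrow>
      a A B C \<in> Iso (T (T A B) C) (T A (T B C))"
    and assoc_natural: "\<lbrakk>A \<in> Obj; A' \<in> Obj; B \<in> Obj; B' \<in> Obj; C \<in> Obj; C' \<in> Obj;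
        f \<in> Hom A A'; g \<in> Hom B B'; h \<in> Hom C C'\<rbrakk> \<Longrightarrow>
      Comp (T (T A B) C) (T (T A' B') C') (T A' (T B' C'))
        (a A' B' C') (TA (T A B) (T A' B') C C' (TA A A' B B' f g) h) =
      Comp (T (T A B) C) (T A (T B C)) (T A' (T B' C'))
        (TA A A' (T B C) (T B' C') f (TA B B' C C' g h)) (a A B C)"
    and left_unitor_iso: "A \<in> Obj \<Longrightarrow> l A \<in> Iso (T I A) A"
    and left_unitor_natural: "\<lbrakk>A \<in> Obj; B \<in> Obj; f \<in> Hom A B\<rbrakk> \<Longrightarrow>
      Comp (T I A) (T I B) B (l B) (TA I I A B (Id I) f) = Comp (T I A) A B f (l A)"
    and right_unitor_iso: "A \<in> Obj \<Longrightarrow> r A \<in> Iso (T A I) A"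
    and right_unitor_natural: "\<lbrakk>A \<in> Obj; B \<in> Obj; f \<in> Hom A B\<rbrakk> \<Longrightarrow>
      Comp (T A I) (T B I) B (r B) (TA A B I I f (Id I)) = Comp (T A I) A B f (r A)"
    and pentagon: "\<lbrakk>A \<in> Obj; B \<in> Obj; C \<in> Obj; D \<in> Obj\<rbrakk> \<Longrightarrow>
      Comp (T (T (T A B) C) D) (T (T A B) (T C D)) (T A (T B (T C D)))
        (a A B (T C D)) (a (T A B) C D) =
      Comp (T (T (T A B) C) D) (T A (T (T B C) D)) (T A (T B (T C D)))
        (TA A A (T (T B C) D) (T B (T C D)) (Id A) (a B C D))
        (Comp (T (T (T A B) C) D) (T (T A (T B C)) D) (T A (T (T B C) D))
          (a A (T B C) D)
          (TA (T (T A B) C) (T A (T B C)) D D (a A B C) (Id D)))"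
    and triangle: "\<lbrakk>A \<in> Obj; B \<in> Obj\<rbrakk> \<Longrightarrow>
      Comp (T (T A I) B) (T A (T I B)) (T A B)
        (TA A A (T I B) B (Id A) (l B)) (a A I B) =
      TA (T A I) A B B (r A) (Id B)"


section \<open>The category of left modules over an anchored Hopf algebroid\<close>

text \<open>
  The \<open>H\<close>-module structure \<open>h \<cdot> (m \<otimes> n) = \<Delta>(h)(m \<otimes> n)\<close> on \<open>M \<otimes>\<^sub>R N\<close>, where \<open>H \<otimes>\<^sub>R H\<close> acts by
  \<open>(x \<otimes> y)(m \<otimes> n) = xm \<otimes> yn\<close>.
\<close>

definition tensor_module ::
  "('r, 'c) ring_scheme \<Rightarrow> ('r \<Rightarrow> 'h) \<Rightarrow> ('r \<Rightarrow> 'h) \<Rightarrow> ('h \<Rightarrow> ('h \<times> 'h \<Rightarrow>\<^sub>0 int) set)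
    \<Rightarrow> ('h, 'm) module \<Rightarrow> ('h, 'n) module \<Rightarrow> ('h, ('m \<times> 'n \<Rightarrow>\<^sub>0 int) set) module"
  where "tensor_module R \<alpha> \<beta> \<Delta> M N =
    (let B = module_bimodule \<alpha> \<beta> M; C = module_bimodule \<alpha> \<beta> N; T = tensor_group R B C in
     \<lparr>carrier = carrier T, monoid.mult = monoid.mult T, one = one T,
     ring.zero = ring.zero T, add = add T,
      smult = (\<lambda>h. tensor_lift T (\<lambda>m n.
        tensor_lift T (\<lambda>x y. tensor R B C (x \<odot>\<^bsub>M\<^esub> m) (y \<odot>\<^bsub>N\<^esub> n)) (\<Delta> h)))\<rparr>)"

definition unit_module ::
  "('r, 'c) ring_scheme \<Rightarrow> ('h \<Rightarrow> 'r \<Rightarrow> 'r) \<Rightarrow> ('h, 'r) module"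
  where "unit_module R \<mu> = \<lparr>carrier = carrier R, monoid.mult = monoid.mult R, one = one R,
    ring.zero = ring.zero R, add = add R, smult = \<mu>\<rparr>"

text \<open>
  All objects of the category must live in one type, which has to be closed under
  \<open>\<otimes>\<^sub>R\<close> and contain \<open>R\<close>. The universe of possible module elements is therefore the following
  datatype over an arbitrary type \<open>'u\<close> of atoms; a coset in a tensor product is encoded by
  a chosen representative, written as a list of pairs with integer coefficients. Modules are
  otherwise arbitrary: any \<open>H\<close>-module on a subset of \<open>'u\<close> is an object via \<open>Atom\<close>.
\<close>

datatype ('r, 'u) elt =
    Atom 'u
  | Scalar (unscalar: 'r)
  | Tensor "(('r, 'u) elt \<times> ('r, 'u) elt \<times> int) list"

definition encode ::
  "(('r, 'u) elt \<times> ('r, 'u) elt \<Rightarrow>\<^sub>0 int) set \<Rightarrow> ('r, 'u) elt"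
  where "encode X = Tensor (SOME xs. (\<Sum>(m, n, c)\<leftarrow>xs. Poly_Mapping.single (m, n) c) \<in> X)"

text \<open>Transport of structure along \<open>f\<close>, used for \<open>f\<close> injective on \<^term>\<open>carrier M\<close>.\<close>

definition transport_module :: "('m \<Rightarrow> 'n) \<Rightarrow> ('h, 'm) module \<Rightarrow> ('h, 'n) module"
  where "transport_module f M = (let g = inv_into (carrier M) f in
    \<lparr>carrier = f ` carrier M, monoid.mult = undefined, one = undefined,
     ring.zero = f \<zero>\<^bsub>M\<^esub>, add = (\<lambda>x y. f (g x \<oplus>\<^bsub>M\<^esub> g y)), smult = (\<lambda>h x. f (h \<odot>\<^bsub>M\<^esub> g x))\<rparr>)"

definition rep_obj :: "('h, 'c) ring_scheme \<Rightarrow> ('h, ('r, 'u) elt) module set"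
  where "rep_obj H = {M. left_module H M}"

definition rep_hom ::
  "('h, 'c) ring_scheme \<Rightarrow> ('h, 'm) module \<Rightarrow> ('h, 'n) module \<Rightarrow> ('m \<Rightarrow> 'n) set"
  where "rep_hom H M N = {f \<in> carrier M \<rightarrow>\<^sub>E carrier N.
    (\<forall>x\<in>carrier M. \<forall>y\<in>carrier M. f (x \<oplus>\<^bsub>M\<^esub> y) = f x \<oplus>\<^bsub>N\<^esub> f y) \<and>
    (\<forall>h\<in>carrier H. \<forall>x\<in>carrier M. f (h \<odot>\<^bsub>M\<^esub> x) = h \<odot>\<^bsub>N\<^esub> f x)}"

definition rep_id :: "('h, 'm) module \<Rightarrow> 'm \<Rightarrow> 'm"
  where "rep_id M = (\<lambda>x\<in>carrier M. x)"

definition rep_comp ::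
  "('h, 'l) module \<Rightarrow> ('h, 'm) module \<Rightarrow> ('h, 'n) module
    \<Rightarrow> ('m \<Rightarrow> 'n) \<Rightarrow> ('l \<Rightarrow> 'm) \<Rightarrow> 'l \<Rightarrow> 'n"
  where "rep_comp L M N g f = compose (carrier L) g f"

definition rep_tensor ::
  "('r, 'c) ring_scheme \<Rightarrow> ('r \<Rightarrow> 'h) \<Rightarrow> ('r \<Rightarrow> 'h) \<Rightarrow> ('h \<Rightarrow> ('h \<times> 'h \<Rightarrow>\<^sub>0 int) set)
    \<Rightarrow> ('h, ('r, 'u) elt) module \<Rightarrow> ('h, ('r, 'u) elt) module \<Rightarrow> ('h, ('r, 'u) elt) module"
  where "rep_tensor R \<alpha> \<beta> \<Delta> M N = transport_module encode (tensor_module R \<alpha> \<beta> \<Delta> M N)"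

definition rep_unit ::
  "('r, 'c) ring_scheme \<Rightarrow> ('h \<Rightarrow> 'r \<Rightarrow> 'r) \<Rightarrow> ('h, ('r, 'u) elt) module"
  where "rep_unit R \<mu> = transport_module Scalar (unit_module R \<mu>)"

definition rep_pure ::
  "('r, 'c) ring_scheme \<Rightarrow> ('r \<Rightarrow> 'h) \<Rightarrow> ('r \<Rightarrow> 'h)
    \<Rightarrow> ('h, ('r, 'u) elt) module \<Rightarrow> ('h, ('r, 'u) elt) module
    \<Rightarrow> ('r, 'u) elt \<Rightarrow> ('r, 'u) elt \<Rightarrow> ('r, 'u) elt"
  where "rep_pure R \<alpha> \<beta> M N m n =
    encode (tensor R (module_bimodule \<alpha> \<beta> M) (module_bimodule \<alpha> \<beta> N) m n)"

definition rep_decode ::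
  "('r, 'c) ring_scheme \<Rightarrow> ('r \<Rightarrow> 'h) \<Rightarrow> ('r \<Rightarrow> 'h)
    \<Rightarrow> ('h, ('r, 'u) elt) module \<Rightarrow> ('h, ('r, 'u) elt) module
    \<Rightarrow> ('r, 'u) elt \<Rightarrow> (('r, 'u) elt \<times> ('r, 'u) elt \<Rightarrow>\<^sub>0 int) set"
  where "rep_decode R \<alpha> \<beta> M N =
    inv_into (carrier (tensor_group R (module_bimodule \<alpha> \<beta> M) (module_bimodule \<alpha> \<beta> N))) encode"

definition rep_tensor_map ::
  "('r, 'c) ring_scheme \<Rightarrow> ('r \<Rightarrow> 'h) \<Rightarrow> ('r \<Rightarrow> 'h) \<Rightarrow> ('h \<Rightarrow> ('h \<times> 'h \<Rightarrow>\<^sub>0 int) set)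
    \<Rightarrow> ('h, ('r, 'u) elt) module \<Rightarrow> ('h, ('r, 'u) elt) module
    \<Rightarrow> ('h, ('r, 'u) elt) module \<Rightarrow> ('h, ('r, 'u) elt) module
    \<Rightarrow> (('r, 'u) elt \<Rightarrow> ('r, 'u) elt) \<Rightarrow> (('r, 'u) elt \<Rightarrow> ('r, 'u) elt)
    \<Rightarrow> ('r, 'u) elt \<Rightarrow> ('r, 'u) elt"
  where "rep_tensor_map R \<alpha> \<beta> \<Delta> M M' N N' f g =
    (\<lambda>t\<in>carrier (rep_tensor R \<alpha> \<beta> \<Delta> M N). encode
      (tensor_map R (module_bimodule \<alpha> \<beta> M') (module_bimodule \<alpha> \<beta> N') f g
        (rep_decode R \<alpha> \<beta> M N t)))"

text \<open>The map \<open>(l \<otimes> m) \<otimes> n \<mapsto> l \<otimes> (m \<otimes> n)\<close>.\<close>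

definition rep_assoc ::
  "('r, 'c) ring_scheme \<Rightarrow> ('r \<Rightarrow> 'h) \<Rightarrow> ('r \<Rightarrow> 'h) \<Rightarrow> ('h \<Rightarrow> ('h \<times> 'h \<Rightarrow>\<^sub>0 int) set)
    \<Rightarrow> ('h, ('r, 'u) elt) module \<Rightarrow> ('h, ('r, 'u) elt) module \<Rightarrow> ('h, ('r, 'u) elt) module
    \<Rightarrow> ('r, 'u) elt \<Rightarrow> ('r, 'u) elt"
  where "rep_assoc R \<alpha> \<beta> \<Delta> L M N =
    (let LM = rep_tensor R \<alpha> \<beta> \<Delta> L M; MN = rep_tensor R \<alpha> \<beta> \<Delta> M N;
         T = rep_tensor R \<alpha> \<beta> \<Delta> L MN in
     (\<lambda>t\<in>carrier (rep_tensor R \<alpha> \<beta> \<Delta> LM N).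
       tensor_lift T (\<lambda>u n. tensor_lift T
           (\<lambda>l m. rep_pure R \<alpha> \<beta> L MN l (rep_pure R \<alpha> \<beta> M N m n)) (rep_decode R \<alpha> \<beta> L M u))
         (rep_decode R \<alpha> \<beta> LM N t)))"

text \<open>The canonical maps \<open>a \<otimes> m \<mapsto> \<alpha>(a) m\<close> and \<open>m \<otimes> a \<mapsto> \<beta>(a) m\<close>.\<close>

definition rep_left_unitor ::
  "('r, 'c) ring_scheme \<Rightarrow> ('r \<Rightarrow> 'h) \<Rightarrow> ('r \<Rightarrow> 'h) \<Rightarrow> ('h \<Rightarrow> ('h \<times> 'h \<Rightarrow>\<^sub>0 int) set)
    \<Rightarrow> ('h \<Rightarrow> 'r \<Rightarrow> 'r) \<Rightarrow> ('h, ('r, 'u) elt) module \<Rightarrow> ('r, 'u) elt \<Rightarrow> ('r, 'u) elt"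
  where "rep_left_unitor R \<alpha> \<beta> \<Delta> \<mu> M =
    (\<lambda>t\<in>carrier (rep_tensor R \<alpha> \<beta> \<Delta> (rep_unit R \<mu>) M).
      tensor_lift M (\<lambda>a m. \<alpha> (unscalar a) \<odot>\<^bsub>M\<^esub> m) (rep_decode R \<alpha> \<beta> (rep_unit R \<mu>) M t))"

definition rep_right_unitor ::
  "('r, 'c) ring_scheme \<Rightarrow> ('r \<Rightarrow> 'h) \<Rightarrow> ('r \<Rightarrow> 'h) \<Rightarrow> ('h \<Rightarrow> ('h \<times> 'h \<Rightarrow>\<^sub>0 int) set)
    \<Rightarrow> ('h \<Rightarrow> 'r \<Rightarrow> 'r) \<Rightarrow> ('h, ('r, 'u) elt) module \<Rightarrow> ('r, 'u) elt \<Rightarrow> ('r, 'u) elt"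
  where "rep_right_unitor R \<alpha> \<beta> \<Delta> \<mu> M =
    (\<lambda>t\<in>carrier (rep_tensor R \<alpha> \<beta> \<Delta> M (rep_unit R \<mu>)).
      tensor_lift M (\<lambda>m a. \<beta> (unscalar a) \<odot>\<^bsub>M\<^esub> m) (rep_decode R \<alpha> \<beta> M (rep_unit R \<mu>) t))"

end

theory Submission
  imports Defs
begin

text \<open>
  A map out of a tensor product is determined by its values on pure tensors, and a biadditive
  balanced map extends to it. Hence every axiom is an identity between additive maps that need
  only be compared on pure tensors. There, \<open>\<Delta>(h)(\<beta>(a) \<otimes> 1 - 1 \<otimes> \<alpha>(a)) = 0\<close> and the
  multiplicativity of \<open>\<Delta>\<close> make \<open>M \<otimes>\<^sub>R N\<close> an \<open>H\<close>-module, coassociativity makes the associator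
  \<open>H\<close>-linear, and the anchor conditions \<open>\<phi>\<^sub>\<alpha>(\<Delta>x \<otimes> a) = x\<alpha>(a)\<close>, \<open>\<phi>\<^sub>\<beta>(\<Delta>x \<otimes> a) = x\<beta>(a)\<close> make the
  unitors \<open>H\<close>-linear. The pentagon and the triangle are immediate on pure tensors; the triangle
  uses the balancing relation \<open>\<beta>(a)m \<otimes> n = m \<otimes> \<alpha>(a)n\<close>.
\<close>

section \<open>Additive maps and balanced maps\<close>

text \<open>The obstacle is that H \<otimes> H over R is only a group: two arbitrary elements have
  no product, and an arbitrary element does not act on M \<otimes> N. It does send a pair (m, n) to
  M \<otimes> N, by \<open>pair_act\<close>. Statements are therefore proved for all X in H
  \<otimes> H with m and n kept apart, and only for X = \<Delta>(h) does the result depend on m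
  \<otimes> n alone. Right multiplication on H \<otimes> H is the case M = N = H, so the axioms on
  \<Delta> pass to modules through one associativity law, \<open>pair_act_pair_act\<close>. Sweedler
  sums take the form \<open>tensor_lift G f (\<Delta> h)\<close>: \<open>tensor_lift_comp\<close>
  moves an additive map inside the sum, \<open>tensor_lift_cong\<close> rewrites the summand, and
  \<open>coassoc_trilinear\<close> changes the bracketing. Iterated products stay manageable because
  \<Delta>(\<alpha>(a)) = \<alpha>(a) \<otimes> 1 and \<Delta>(\<beta>(a)) = 1 \<otimes> \<beta>(a):
  the R-actions that M \<otimes> N receives from H are those of its outer factors. All this happens
  on cosets. Cosets are nonempty and pairwise disjoint, so a chosen representative determines its
  coset, and the module structure can be transported into the datatype \<open>elt\<close>.\<close>

definition additive_maps :: "('a, 'c) ring_scheme \<Rightarrow> ('b, 'd) ring_scheme \<Rightarrow> ('a \<Rightarrow> 'b) set"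
  where "additive_maps G G' = {f \<in> carrier G \<rightarrow> carrier G'.
    \<forall>x\<in>carrier G. \<forall>y\<in>carrier G. f (x \<oplus>\<^bsub>G\<^esub> y) = f x \<oplus>\<^bsub>G'\<^esub> f y}"

lemma additive_mapsI:
  assumes "\<And>x. x \<in> carrier G \<Longrightarrow> f x \<in> carrier G'"
    and "\<And>x y. \<lbrakk>x \<in> carrier G; y \<in> carrier G\<rbrakk> \<Longrightarrow> f (x \<oplus>\<^bsub>G\<^esub> y) = f x \<oplus>\<^bsub>G'\<^esub> f y"
  shows "f \<in> additive_maps G G'"
  using assms by (auto simp: additive_maps_def)

lemma additive_maps_closed: "\<lbrakk>f \<in> additive_maps G G'; x \<in> carrier G\<rbrakk> \<Longrightarrow> f x \<in> carrier G'"
  by (auto simp: additive_maps_def)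

lemma additive_maps_add:
  "\<lbrakk>f \<in> additive_maps G G'; x \<in> carrier G; y \<in> carrier G\<rbrakk> \<Longrightarrow> f (x \<oplus>\<^bsub>G\<^esub> y) = f x \<oplus>\<^bsub>G'\<^esub> f y"
  by (auto simp: additive_maps_def)

lemma additive_maps_comp:
  "\<lbrakk>f \<in> additive_maps G G'; g \<in> additive_maps G' G''\<rbrakk> \<Longrightarrow> (\<lambda>x. g (f x)) \<in> additive_maps G G''"
  by (auto simp: additive_maps_def Pi_iff)

lemma additive_maps_id: "(\<lambda>x. x) \<in> additive_maps G G"
  by (auto simp: additive_maps_def)

lemma additive_maps_hom: "f \<in> additive_maps G G' \<Longrightarrow> f \<in> hom (add_monoid G) (add_monoid G')"
  by (auto simp: additive_maps_def hom_def)

lemma additive_maps_zero: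
  assumes "f \<in> additive_maps G G'" "abelian_group G" "abelian_group G'"
  shows "f \<zero>\<^bsub>G\<^esub> = \<zero>\<^bsub>G'\<^esub>"
  using hom_one[OF additive_maps_hom[OF assms(1)]] assms(2,3)
  by (simp add: abelian_group.a_group)

lemma additive_maps_minus:
  assumes "f \<in> additive_maps G G'" "abelian_group G" "abelian_group G'"
    and "x \<in> carrier G" "y \<in> carrier G"
  shows "f (x \<ominus>\<^bsub>G\<^esub> y) = f x \<ominus>\<^bsub>G'\<^esub> f y"
proof -
  interpret G: abelian_group G by fact
  interpret G': abelian_group G' by fact
  have "f (\<ominus>\<^bsub>G\<^esub> y) = \<ominus>\<^bsub>G'\<^esub> f y"
    by (metis G'.minus_equality G.a_inv_closed G.l_neg additive_maps_add additive_maps_closed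
        additive_maps_zero assms)
  then show ?thesis
    using assms by (simp add: a_minus_def additive_maps_add)
qed

text \<open>Commutativity of the target makes this work. It allows a sum of two maps to be compared
  with a third map on generators, as distributivity laws require.\<close>

lemma additive_maps_add_pointwise:
  assumes "f \<in> additive_maps G G'" "g \<in> additive_maps G G'" "abelian_group G'"
  shows "(\<lambda>x. f x \<oplus>\<^bsub>G'\<^esub> g x) \<in> additive_maps G G'"
proof -
  interpret G': abelian_group G' by fact
  show ?thesis
    using assms by (intro additive_mapsI)
      (auto simp: additive_maps_add additive_maps_closed G'.a_ac)
qed

text \<open>Associativity of the actions is not needed to form tensor products of bimodules.\<close>

locale biaction = abelian_group B
  for R :: "('r, 'c) ring_scheme" and B :: "('r, 'b, 'd) bimodule_scheme" +
  assumes lact_closed: "\<lbrakk>a \<in> carrier R; x \<in> carrier B\<rbrakk> \<Longrightarrow> lact B a x \<in> carrier B"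
    and ract_closed: "\<lbrakk>a \<in> carrier R; x \<in> carrier B\<rbrakk> \<Longrightarrow> ract B x a \<in> carrier B"
    and lact_add: "\<lbrakk>a \<in> carrier R; x \<in> carrier B; y \<in> carrier B\<rbrakk> \<Longrightarrow>
      lact B a (x \<oplus>\<^bsub>B\<^esub> y) = lact B a x \<oplus>\<^bsub>B\<^esub> lact B a y"
    and ract_add: "\<lbrakk>a \<in> carrier R; x \<in> carrier B; y \<in> carrier B\<rbrakk> \<Longrightarrow>
      ract B (x \<oplus>\<^bsub>B\<^esub> y) a = ract B x a \<oplus>\<^bsub>B\<^esub> ract B y a"
    and lact_ract: "\<lbrakk>a \<in> carrier R; b \<in> carrier R; x \<in> carrier B\<rbrakk> \<Longrightarrow>
      lact B a (ract B x b) = ract B (lact B a x) b"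

section \<open>Biadditive balanced maps\<close>

definition balanced ::
  "('r, 'c) ring_scheme \<Rightarrow> ('r, 'm, 'd) bimodule_scheme \<Rightarrow> ('r, 'n, 'e) bimodule_scheme
    \<Rightarrow> ('g, 'f) ring_scheme \<Rightarrow> ('m \<Rightarrow> 'n \<Rightarrow> 'g) \<Rightarrow> bool"
  where "balanced R B C G f \<longleftrightarrow>
    (\<forall>c\<in>carrier C. (\<lambda>b. f b c) \<in> additive_maps B G) \<and>
    (\<forall>b\<in>carrier B. f b \<in> additive_maps C G) \<and>
    (\<forall>b\<in>carrier B. \<forall>a\<in>carrier R. \<forall>c\<in>carrier C. f (ract B b a) c = f b (lact C a c))"

lemma balancedI:
  assumes "\<And>c. c \<in> carrier C \<Longrightarrow> (\<lambda>b. f b c) \<in> additive_maps B G"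
    and "\<And>b. b \<in> carrier B \<Longrightarrow> f b \<in> additive_maps C G"
    and "\<And>b a c. \<lbrakk>b \<in> carrier B; a \<in> carrier R; c \<in> carrier C\<rbrakk> \<Longrightarrow>
      f (ract B b a) c = f b (lact C a c)"
  shows "balanced R B C G f"
  using assms by (auto simp: balanced_def)

lemma balanced_left: "\<lbrakk>balanced R B C G f; c \<in> carrier C\<rbrakk> \<Longrightarrow> (\<lambda>b. f b c) \<in> additive_maps B G"
  by (auto simp: balanced_def)

lemma balanced_right: "\<lbrakk>balanced R B C G f; b \<in> carrier B\<rbrakk> \<Longrightarrow> f b \<in> additive_maps C G"
  by (auto simp: balanced_def)

lemma balanced_act:
  "\<lbrakk>balanced R B C G f; b \<in> carrier B; a \<in> carrier R; c \<in> carrier C\<rbrakk> \<Longrightarrow>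
    f (ract B b a) c = f b (lact C a c)"
  by (auto simp: balanced_def)

lemma balanced_closed: "\<lbrakk>balanced R B C G f; b \<in> carrier B; c \<in> carrier C\<rbrakk> \<Longrightarrow> f b c \<in> carrier G"
  by (auto simp: balanced_def additive_maps_def)

lemma balanced_comp:
  assumes "balanced R B C G f" "\<phi> \<in> additive_maps G G'"
  shows "balanced R B C G' (\<lambda>b c. \<phi> (f b c))"
proof (rule balancedI)
  show "(\<lambda>b. \<phi> (f b c)) \<in> additive_maps B G'" if "c \<in> carrier C" for c
    using additive_maps_comp[OF balanced_left[OF assms(1) that] assms(2)] .
  show "(\<lambda>c. \<phi> (f b c)) \<in> additive_maps C G'" if "b \<in> carrier B" for b
    using additive_maps_comp[OF balanced_right[OF assms(1) that] assms(2)] .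
qed (simp add: balanced_act[OF assms(1)])

text \<open>The function whose image of a coset \<open>tensor_lift\<close> inspects. It has its own
  name so that it can be studied on the free abelian group before passing to the quotient.\<close>

definition linear_extension ::
  "('g, 'c) ring_scheme \<Rightarrow> ('m \<Rightarrow> 'n \<Rightarrow> 'g) \<Rightarrow> ('m \<times> 'n \<Rightarrow>\<^sub>0 int) \<Rightarrow> 'g"
  where "linear_extension G f p =
    (\<Oplus>\<^bsub>G\<^esub>z\<in>Poly_Mapping.keys p. [Poly_Mapping.lookup p z] \<cdot>\<^bsub>G\<^esub> f (fst z) (snd z))"

section \<open>The universal property of the tensor product\<close>

locale tensor_pair = B: biaction R B + C: biaction R C
  for R :: "('r, 'c) ring_scheme" and B :: "('r, 'm, 'd) bimodule_scheme"
    and C :: "('r, 'n, 'e) bimodule_scheme"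
begin

abbreviation F where "F \<equiv> free_Abelian_group (carrier B \<times> carrier C)"
abbreviation N where "N \<equiv> tensor_kernel R B C"
abbreviation T where "T \<equiv> tensor_group R B C"
abbreviation pure where "pure \<equiv> tensor R B C"

sublocale F: comm_group F
  by (rule abelian_free_Abelian_group)

declare carrier_free_Abelian_group_iff [simp del]

lemma diff_closed: "\<lbrakk>p \<in> carrier F; q \<in> carrier F\<rbrakk> \<Longrightarrow> p - q \<in> carrier F"
  using keys_diff[of p q] by (auto simp: carrier_free_Abelian_group_iff)

lemma sum_closed: "\<lbrakk>p \<in> carrier F; q \<in> carrier F\<rbrakk> \<Longrightarrow> p + q \<in> carrier F"
  using keys_add[of p q] by (auto simp: carrier_free_Abelian_group_iff)

lemma tensor_relations_subset: "tensor_relations R B C \<subseteq> carrier F"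
  unfolding tensor_relations_def
  by (auto intro!: diff_closed simp: B.ract_closed C.lact_closed)

sublocale N: normal N F
  unfolding tensor_kernel_def
  by (metis F.generate_is_subgroup F.normal_iff_subgroup tensor_relations_subset)

lemma add_monoid_tensor_group: "add_monoid T = F Mod N"
  by (simp add: tensor_group_def Let_def FactGroup_def)

sublocale T: abelian_group T
proof -
  have "comm_group (add_monoid T)"
    unfolding add_monoid_tensor_group by (rule F.abelian_FactGroup) (rule N.is_subgroup)
  then show "abelian_group T"
    by (simp add: abelian_group_def abelian_monoid_def abelian_group_axioms_def comm_group_def)
qed

lemma carrier_tensor_group: "carrier T = (\<lambda>p. N #>\<^bsub>F\<^esub> p) ` carrier F"
  using carrier_FactGroup[of F N] by (simp add: tensor_group_def Let_def)

lemma tensor_group_add: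
  "\<lbrakk>p \<in> carrier F; q \<in> carrier F\<rbrakk> \<Longrightarrow> (N #>\<^bsub>F\<^esub> p) \<oplus>\<^bsub>T\<^esub> (N #>\<^bsub>F\<^esub> q) = N #>\<^bsub>F\<^esub> (p + q)"
  using N.rcos_sum[of p q] by (simp add: tensor_group_def Let_def FactGroup_def)

lemma tensor_group_zero: "\<zero>\<^bsub>T\<^esub> = N #>\<^bsub>F\<^esub> 0"
  using F.coset_mult_one[OF N.subset] by (simp add: tensor_group_def Let_def)

lemma coset_kernel: "p \<in> N \<Longrightarrow> N #>\<^bsub>F\<^esub> p = \<zero>\<^bsub>T\<^esub>"
  using F.coset_join2[OF subsetD[OF N.subset] N.is_subgroup]
  by (simp add: tensor_group_def Let_def)

lemma coset_eqI:
  assumes "p \<in> carrier F" "q \<in> carrier F" "p - q \<in> N"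
  shows "N #>\<^bsub>F\<^esub> p = N #>\<^bsub>F\<^esub> q"
proof -
  have "N #>\<^bsub>F\<^esub> q \<in> carrier T" using assms(2) carrier_tensor_group by blast
  moreover have "N #>\<^bsub>F\<^esub> p = (N #>\<^bsub>F\<^esub> (p - q)) \<oplus>\<^bsub>T\<^esub> (N #>\<^bsub>F\<^esub> q)"
    using tensor_group_add[OF diff_closed[OF assms(1,2)] assms(2)] by simp
  ultimately show ?thesis using coset_kernel[OF assms(3)] by (simp only: T.l_zero)
qed

lemma pure_closed [simp, intro]: "\<lbrakk>b \<in> carrier B; c \<in> carrier C\<rbrakk> \<Longrightarrow> pure b c \<in> carrier T"
  unfolding carrier_tensor_group tensor_def by (rule imageI) simp

lemma pure_balanced: "balanced R B C T pure"
proof (rule balancedI)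
  have gen: "p \<in> N" if "p \<in> tensor_relations R B C" for p
    unfolding tensor_kernel_def using that by (rule generate.incl)
  show "(\<lambda>b. pure b c) \<in> additive_maps B T" if c: "c \<in> carrier C" for c
  proof (rule additive_mapsI)
    fix x y assume xy: "x \<in> carrier B" "y \<in> carrier B"
    have "frag_of (x \<oplus>\<^bsub>B\<^esub> y, c) - frag_of (x, c) - frag_of (y, c) \<in> tensor_relations R B C"
      unfolding tensor_relations_def using xy c by blast
    moreover have "frag_of (x, c) + frag_of (y, c) \<in> carrier F"
      using xy c by (intro sum_closed) auto
    ultimately have "N #>\<^bsub>F\<^esub> frag_of (x \<oplus>\<^bsub>B\<^esub> y, c) = N #>\<^bsub>F\<^esub> (frag_of (x, c) + frag_of (y, c))"
      using xy c gen by (intro coset_eqI) (auto simp: diff_diff_eq)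
    then show "pure (x \<oplus>\<^bsub>B\<^esub> y) c = pure x c \<oplus>\<^bsub>T\<^esub> pure y c"
      unfolding tensor_def using xy c by (subst tensor_group_add) auto
  qed (use c in auto)
  show "pure b \<in> additive_maps C T" if b: "b \<in> carrier B" for b
  proof (rule additive_mapsI)
    fix x y assume xy: "x \<in> carrier C" "y \<in> carrier C"
    have "frag_of (b, x \<oplus>\<^bsub>C\<^esub> y) - frag_of (b, x) - frag_of (b, y) \<in> tensor_relations R B C"
      unfolding tensor_relations_def using xy b by blast
    moreover have "frag_of (b, x) + frag_of (b, y) \<in> carrier F"
      using xy b by (intro sum_closed) auto
    ultimately have "N #>\<^bsub>F\<^esub> frag_of (b, x \<oplus>\<^bsub>C\<^esub> y) = N #>\<^bsub>F\<^esub> (frag_of (b, x) + frag_of (b, y))"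
      using xy b gen by (intro coset_eqI) (auto simp: diff_diff_eq)
    then show "pure b (x \<oplus>\<^bsub>C\<^esub> y) = pure b x \<oplus>\<^bsub>T\<^esub> pure b y"
      unfolding tensor_def using xy b by (subst tensor_group_add) auto
  qed (use b in auto)
  show "pure (ract B b a) c = pure b (lact C a c)"
    if "b \<in> carrier B" "a \<in> carrier R" "c \<in> carrier C" for b a c
  proof -
    have "frag_of (ract B b a, c) - frag_of (b, lact C a c) \<in> tensor_relations R B C"
      unfolding tensor_relations_def using that by blast
    then show ?thesis
      unfolding tensor_def using that gen
      by (intro coset_eqI) (auto simp: B.ract_closed C.lact_closed)
  qed
qed

text \<open>Differences replace sums because generators of a free abelian group reach all integer
  combinations by subtraction; negative coefficients then need no case of their own.\<close>

lemma tensor_induct [consumes 1, case_names zero minus pure]: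
  assumes "X \<in> carrier T"
    and "P \<zero>\<^bsub>T\<^esub>"
    and "\<And>X Y. \<lbrakk>X \<in> carrier T; Y \<in> carrier T; P X; P Y\<rbrakk> \<Longrightarrow> P (X \<ominus>\<^bsub>T\<^esub> Y)"
    and "\<And>b c. \<lbrakk>b \<in> carrier B; c \<in> carrier C\<rbrakk> \<Longrightarrow> P (pure b c)"
  shows "P X"
proof -
  obtain p where p: "p \<in> carrier F" "X = N #>\<^bsub>F\<^esub> p"
    using assms(1) carrier_tensor_group by auto
  from p(1) have "Poly_Mapping.keys p \<subseteq> carrier B \<times> carrier C"
    by (simp add: carrier_free_Abelian_group_iff)
  then have "P (N #>\<^bsub>F\<^esub> p)"
  proof (induction p rule: free_Abelian_group_induct[consumes 1])
    case 1
    then show ?case using assms(2) by (simp add: tensor_group_zero)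
  next
    case (2 x y)
    have x: "x \<in> carrier F" and y: "y \<in> carrier F"
      using 2(1,2) by (simp_all add: carrier_free_Abelian_group_iff)
    then have d: "x - y \<in> carrier F" by (rule diff_closed)
    have c: "N #>\<^bsub>F\<^esub> z \<in> carrier T" if "z \<in> carrier F" for z
      using that carrier_tensor_group by blast
    \<comment> \<open>So far only sums of cosets are computed; the difference is obtained by adding
      the coset of \<open>y\<close> back and cancelling.\<close>
    have "(N #>\<^bsub>F\<^esub> (x - y)) \<oplus>\<^bsub>T\<^esub> (N #>\<^bsub>F\<^esub> y) = N #>\<^bsub>F\<^esub> x"
      using tensor_group_add[OF d y] by simp
    then have "N #>\<^bsub>F\<^esub> (x - y) = (N #>\<^bsub>F\<^esub> x) \<ominus>\<^bsub>T\<^esub> (N #>\<^bsub>F\<^esub> y)"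
      using c[OF d] c[OF x] c[OF y] by (metis T.add.inv_solve_right a_minus_def)
    then show ?case using 2 assms(3) c[OF x] c[OF y] by simp
  next
    case (3 a)
    then show ?case using assms(4) by (cases a) (auto simp: tensor_def)
  qed
  with p show ?thesis by simp
qed

text \<open>The elements on which two additive maps agree include zero and are closed under
  differences, and pure tensors generate. The conclusion concerns a single element of the carrier
  because additive maps are not controlled outside it. This is the uniqueness half of the universal
  property.\<close>

lemma tensor_ext:
  assumes "abelian_group G" "f \<in> additive_maps T G" "g \<in> additive_maps T G"
    and "\<And>b c. \<lbrakk>b \<in> carrier B; c \<in> carrier C\<rbrakk> \<Longrightarrow> f (pure b c) = g (pure b c)"
    and "X \<in> carrier T"
  shows "f X = g X"
  using assms(5)
proof (induction X rule: tensor_induct)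
  case zero
  then show ?case
    using additive_maps_zero[OF assms(2) T.abelian_group_axioms assms(1)]
      additive_maps_zero[OF assms(3) T.abelian_group_axioms assms(1)] by simp
next
  case (minus X Y)
  then show ?case
    using additive_maps_minus[OF assms(2) T.abelian_group_axioms assms(1)]
      additive_maps_minus[OF assms(3) T.abelian_group_axioms assms(1)] by simp
qed (rule assms)

section \<open>Existence of the induced map\<close>

context
  fixes G :: "('g, 'f) ring_scheme" and f :: "'m \<Rightarrow> 'n \<Rightarrow> 'g"
  assumes G: "abelian_group G" and f: "balanced R B C G f"
begin

interpretation G: abelian_group G by (rule G)

text \<open>Coefficients can cancel in \<open>p + q\<close>, so the supports of \<open>p\<close>,
  \<open>q\<close> and \<open>p + q\<close> differ. Extra indices contribute coefficient 0, and a
  common finite index set makes the three sums comparable.\<close>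

lemma linear_extension_superset:
  assumes "Poly_Mapping.keys p \<subseteq> S" "finite S" "S \<subseteq> carrier B \<times> carrier C"
  shows "linear_extension G f p = (\<Oplus>\<^bsub>G\<^esub>z\<in>S. [Poly_Mapping.lookup p z] \<cdot>\<^bsub>G\<^esub> f (fst z) (snd z))"
proof -
  have "[(0::int)] \<cdot>\<^bsub>G\<^esub> x = \<zero>\<^bsub>G\<^esub>" for x by (simp add: add_pow_def)
  then show ?thesis
    unfolding linear_extension_def using assms balanced_closed[OF f]
    by (intro G.add.finprod_mono_neutral_cong_left)
      (auto simp: in_keys_iff intro!: G.add.int_pow_closed)
qed

lemma linear_extension_hom: "linear_extension G f \<in> hom F (add_monoid G)"
proof (rule homI)
  fix p q assume p: "p \<in> carrier F" and q: "q \<in> carrier F"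
  let ?S = "Poly_Mapping.keys p \<union> Poly_Mapping.keys q"
  have cl: "[k] \<cdot>\<^bsub>G\<^esub> f (fst z) (snd z) \<in> carrier G" if "z \<in> ?S" for z and k :: int
    using that p q balanced_closed[OF f]
    by (auto intro!: G.add.int_pow_closed simp: carrier_free_Abelian_group_iff)
  have "linear_extension G f (p + q) =
      (\<Oplus>\<^bsub>G\<^esub>z\<in>?S. [Poly_Mapping.lookup (p + q) z] \<cdot>\<^bsub>G\<^esub> f (fst z) (snd z))"
    using p q keys_add[of p q]
    by (intro linear_extension_superset) (auto simp: carrier_free_Abelian_group_iff)
  also have "\<dots> = (\<Oplus>\<^bsub>G\<^esub>z\<in>?S. [Poly_Mapping.lookup p z] \<cdot>\<^bsub>G\<^esub> f (fst z) (snd z) \<oplus>\<^bsub>G\<^esub>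
      [Poly_Mapping.lookup q z] \<cdot>\<^bsub>G\<^esub> f (fst z) (snd z))"
    using p q balanced_closed[OF f] cl
    by (intro G.add.finprod_cong') (auto simp: lookup_add G.add.int_pow_mult carrier_free_Abelian_group_iff)
  also have "\<dots> = (\<Oplus>\<^bsub>G\<^esub>z\<in>?S. [Poly_Mapping.lookup p z] \<cdot>\<^bsub>G\<^esub> f (fst z) (snd z)) \<oplus>\<^bsub>G\<^esub>
      (\<Oplus>\<^bsub>G\<^esub>z\<in>?S. [Poly_Mapping.lookup q z] \<cdot>\<^bsub>G\<^esub> f (fst z) (snd z))"
    using cl by (intro G.finsum_addf) auto
  also have "\<dots> = linear_extension G f p \<oplus>\<^bsub>G\<^esub> linear_extension G f q"
    using p q linear_extension_superset[of p ?S] linear_extension_superset[of q ?S]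
    by (simp add: carrier_free_Abelian_group_iff)
  finally show "linear_extension G f (p \<otimes>\<^bsub>F\<^esub> q) =
      linear_extension G f p \<otimes>\<^bsub>add_monoid G\<^esub> linear_extension G f q"
    by simp
next
  fix p assume "p \<in> carrier F"
  then show "linear_extension G f p \<in> carrier (add_monoid G)"
    using balanced_closed[OF f]
    by (auto simp: linear_extension_def carrier_free_Abelian_group_iff
        intro!: G.finsum_closed G.add.int_pow_closed)
qed

lemma linear_extension_frag_of:
  "\<lbrakk>b \<in> carrier B; c \<in> carrier C\<rbrakk> \<Longrightarrow> linear_extension G f (frag_of (b, c)) = f b c"
  using balanced_closed[OF f, of b c] by (simp add: linear_extension_def)

interpretation h: group_hom F "add_monoid G" "linear_extension G f"
  by (simp add: group_hom_def group_hom_axioms_def linear_extension_hom G.a_group)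

lemma linear_extension_diff:
  assumes "p \<in> carrier F" "q \<in> carrier F"
  shows "linear_extension G f (p - q) = linear_extension G f p \<ominus>\<^bsub>G\<^esub> linear_extension G f q"
  using h.hom_mult[OF assms(1) F.inv_closed[OF assms(2)]] h.hom_inv[OF assms(2)] inv_free_Abelian_group[of q] assms(2)
  by (simp add: a_minus_def a_inv_def carrier_free_Abelian_group_iff)

text \<open>Each of the three families of relations is sent to zero by one clause of
  \<open>balanced\<close>. The kernel of a homomorphism is a subgroup, hence it contains the
  subgroup generated by the relations.\<close>

lemma linear_extension_kernel:
  assumes "p \<in> N" shows "linear_extension G f p = \<zero>\<^bsub>G\<^esub>"
proof -
  have "tensor_relations R B C \<subseteq> kernel F (add_monoid G) (linear_extension G f)"
  proof
    fix p assume p: "p \<in> tensor_relations R B C"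
    then have pF: "p \<in> carrier F" using tensor_relations_subset by blast
    have fF: "frag_of (b, c) \<in> carrier F" if "b \<in> carrier B" "c \<in> carrier C" for b c
      using that by simp
    have dF: "frag_of (b, c) - frag_of (b', c') \<in> carrier F"
      if "b \<in> carrier B" "c \<in> carrier C" "b' \<in> carrier B" "c' \<in> carrier C" for b c b' c'
      using that by (intro diff_closed) auto
    note simps = linear_extension_diff linear_extension_frag_of fF dF
    from p have "linear_extension G f p = \<zero>\<^bsub>G\<^esub>"
      unfolding tensor_relations_def
    proof (elim UnE CollectE exE conjE)
      fix b b' c assume "b \<in> carrier B" "b' \<in> carrier B" "c \<in> carrier C"
        "p = frag_of (b \<oplus>\<^bsub>B\<^esub> b', c) - frag_of (b, c) - frag_of (b', c)"
      then show ?thesis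
        using balanced_closed[OF f] additive_maps_add[OF balanced_left[OF f]]
        by (simp add: simps)
          (simp add: a_minus_def G.a_ac G.r_neg G.r_neg1)
    next
      fix b c c' assume "b \<in> carrier B" "c' \<in> carrier C" "c \<in> carrier C"
        "p = frag_of (b, c \<oplus>\<^bsub>C\<^esub> c') - frag_of (b, c) - frag_of (b, c')"
      then show ?thesis
        using balanced_closed[OF f] additive_maps_add[OF balanced_right[OF f]]
        by (simp add: simps)
          (simp add: a_minus_def G.a_ac G.r_neg G.r_neg1)
    next
      fix b a c assume "b \<in> carrier B" "a \<in> carrier R" "c \<in> carrier C"
        "p = frag_of (ract B b a, c) - frag_of (b, lact C a c)"
      then show ?thesis
        using balanced_closed[OF f] balanced_act[OF f] B.ract_closed C.lact_closed
        by (simp add: simps)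
          (simp add: a_minus_def G.r_neg)
    qed
    then show "p \<in> kernel F (add_monoid G) (linear_extension G f)"
      using pF by (simp add: kernel_def)
  qed
  then have "N \<subseteq> kernel F (add_monoid G) (linear_extension G f)"
    unfolding tensor_kernel_def by (rule F.generate_subgroup_incl) (rule h.subgroup_kernel)
  then show ?thesis using assms by (auto simp: kernel_def)
qed

text \<open>A member of the coset is \<open>n + p\<close> with \<open>n\<close> in the relation
  subgroup, which contributes zero. The image is thus a singleton, and this is what gives
  \<open>the_elem\<close> a meaning.\<close>

lemma tensor_lift_coset:
  assumes p: "p \<in> carrier F"
  shows "tensor_lift G f (N #>\<^bsub>F\<^esub> p) = linear_extension G f p"
proof -
  have "linear_extension G f ` (N #>\<^bsub>F\<^esub> p) = {linear_extension G f p}"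
  proof (rule equalityI)
    show "linear_extension G f ` (N #>\<^bsub>F\<^esub> p) \<subseteq> {linear_extension G f p}"
    proof
      fix y assume "y \<in> linear_extension G f ` (N #>\<^bsub>F\<^esub> p)"
      then obtain n where n: "n \<in> N" "y = linear_extension G f (n + p)"
        by (auto simp: r_coset_def)
      have "linear_extension G f (n + p) = linear_extension G f n \<oplus>\<^bsub>G\<^esub> linear_extension G f p"
        using h.hom_mult[of n p] n N.subset p by auto
      then show "y \<in> {linear_extension G f p}"
        using linear_extension_kernel n h.hom_closed[OF p] by simp
    qed
    show "{linear_extension G f p} \<subseteq> linear_extension G f ` (N #>\<^bsub>F\<^esub> p)"
      using F.rcos_self[OF p N.is_subgroup] by auto
  qed
  then show ?thesis unfolding tensor_lift_def linear_extension_def[symmetric] by (simp only: the_elem_eq)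
qed

lemma tensor_lift_pure: "\<lbrakk>b \<in> carrier B; c \<in> carrier C\<rbrakk> \<Longrightarrow> tensor_lift G f (pure b c) = f b c"
  using tensor_lift_coset[of "frag_of (b, c)"] linear_extension_frag_of by (simp add: tensor_def)

lemma tensor_lift_additive: "tensor_lift G f \<in> additive_maps T G"
proof (rule additive_mapsI)
  fix X assume "X \<in> carrier T"
  then show "tensor_lift G f X \<in> carrier G"
    using h.hom_closed by (auto simp: carrier_tensor_group tensor_lift_coset)
next
  fix X Y assume "X \<in> carrier T" "Y \<in> carrier T"
  then obtain p q where "p \<in> carrier F" "X = N #>\<^bsub>F\<^esub> p" "q \<in> carrier F" "Y = N #>\<^bsub>F\<^esub> q"
    using carrier_tensor_group by auto
  then show "tensor_lift G f (X \<oplus>\<^bsub>T\<^esub> Y) = tensor_lift G f X \<oplus>\<^bsub>G\<^esub> tensor_lift G f Y"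
    using h.hom_mult[of p q] by (simp add: tensor_group_add tensor_lift_coset sum_closed)
qed

lemma tensor_lift_closed: "X \<in> carrier T \<Longrightarrow> tensor_lift G f X \<in> carrier G"
  by (rule additive_maps_closed[OF tensor_lift_additive])

lemma tensor_lift_unique:
  assumes "\<phi> \<in> additive_maps T G" "X \<in> carrier T"
    and "\<And>b c. \<lbrakk>b \<in> carrier B; c \<in> carrier C\<rbrakk> \<Longrightarrow> \<phi> (pure b c) = f b c"
  shows "\<phi> X = tensor_lift G f X"
  using tensor_ext[OF G assms(1) tensor_lift_additive _ assms(2)] assms(3) tensor_lift_pure by simp

end

text \<open>By uniqueness of induced maps. In Sweedler notation this moves \<phi> inside the sum
  over the components of \<open>X\<close>; nearly every computation with \<Delta>(h) below starts or
  ends with it.\<close>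

lemma tensor_lift_comp:
  assumes "abelian_group G" "abelian_group G'" "balanced R B C G f" "\<phi> \<in> additive_maps G G'"
    and "X \<in> carrier T"
  shows "\<phi> (tensor_lift G f X) = tensor_lift G' (\<lambda>b c. \<phi> (f b c)) X"
proof (rule tensor_lift_unique[where \<phi> = "\<lambda>X. \<phi> (tensor_lift G f X)"])
  show "(\<lambda>X. \<phi> (tensor_lift G f X)) \<in> additive_maps T G'"
    using additive_maps_comp[OF tensor_lift_additive[OF assms(1,3)] assms(4)] .
qed (use assms balanced_comp[OF assms(3,4)] in \<open>simp_all add: tensor_lift_pure\<close>)

text \<open>The companion of \<open>tensor_lift_comp\<close>: it rewrites the summand of a Sweedler
  sum. Balancedness is asked of \<open>f\<close> only, since \<open>g\<close> inherits it from
  agreement on the carriers, which are closed under addition and both actions.\<close>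

lemma tensor_lift_cong:
  assumes "abelian_group G" "balanced R B C G f" "X \<in> carrier T"
    and eq: "\<And>b c. \<lbrakk>b \<in> carrier B; c \<in> carrier C\<rbrakk> \<Longrightarrow> f b c = g b c"
  shows "tensor_lift G f X = tensor_lift G g X"
proof (rule tensor_lift_unique)
  show "balanced R B C G g"
    using assms(2) eq B.ract_closed C.lact_closed B.a_closed C.a_closed
    by (simp add: balanced_def additive_maps_def Pi_iff)
qed (use assms in \<open>simp_all add: tensor_lift_pure tensor_lift_additive\<close>)

end

section \<open>Bimodule structure on the tensor product\<close>

context tensor_pair
begin

text \<open>The balancing relation uses the right action on \<open>B\<close>, while \<open>a\<close>
  acts from the left. The law \<open>lact_ract\<close> lets the two pass each other, so the left
  action survives in the quotient.\<close>

lemma lact_balanced: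
  assumes a: "a \<in> carrier R" shows "balanced R B C T (\<lambda>b c. pure (lact B a b) c)"
proof (rule balancedI)
  have l: "lact B a \<in> additive_maps B B"
    using a by (intro additive_mapsI) (simp_all add: B.lact_closed B.lact_add)
  show "(\<lambda>b. pure (lact B a b) c) \<in> additive_maps B T" if "c \<in> carrier C" for c
    using additive_maps_comp[OF l balanced_left[OF pure_balanced that]] .
  show "pure (lact B a b) \<in> additive_maps C T" if "b \<in> carrier B" for b
    using that a by (intro balanced_right[OF pure_balanced] B.lact_closed)
  show "pure (lact B a (ract B b r)) c = pure (lact B a b) (lact C r c)"
    if "b \<in> carrier B" "r \<in> carrier R" "c \<in> carrier C" for b r c
    using that a balanced_act[OF pure_balanced, of "lact B a b" r c]
    by (simp add: B.lact_ract B.lact_closed)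
qed

lemma ract_balanced:
  assumes a: "a \<in> carrier R" shows "balanced R B C T (\<lambda>b c. pure b (ract C c a))"
proof (rule balancedI)
  have r: "(\<lambda>c. ract C c a) \<in> additive_maps C C"
    using a by (intro additive_mapsI) (simp_all add: C.ract_closed C.ract_add)
  show "(\<lambda>c. pure b (ract C c a)) \<in> additive_maps C T" if "b \<in> carrier B" for b
    using additive_maps_comp[OF r balanced_right[OF pure_balanced that]] .
  show "(\<lambda>b. pure b (ract C c a)) \<in> additive_maps B T" if "c \<in> carrier C" for c
    using that a by (intro balanced_left[OF pure_balanced] C.ract_closed)
  show "pure (ract B b r) (ract C c a) = pure b (ract C (lact C r c) a)"
    if "b \<in> carrier B" "r \<in> carrier R" "c \<in> carrier C" for b r c
    using that a balanced_act[OF pure_balanced, of b r "ract C c a"]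
    by (simp add: C.lact_ract C.ract_closed)
qed

abbreviation BC where "BC \<equiv> tensor_bimodule R B C"

lemma lact_tensor_additive: "a \<in> carrier R \<Longrightarrow> lact BC a \<in> additive_maps T T"
  using tensor_lift_additive[OF T.abelian_group_axioms lact_balanced]
  by (simp add: tensor_bimodule_def Let_def)

lemma ract_tensor_additive: "a \<in> carrier R \<Longrightarrow> (\<lambda>X. ract BC X a) \<in> additive_maps T T"
  using tensor_lift_additive[OF T.abelian_group_axioms ract_balanced]
  by (simp add: tensor_bimodule_def Let_def)

lemma lact_tensor_pure:
  "\<lbrakk>a \<in> carrier R; b \<in> carrier B; c \<in> carrier C\<rbrakk> \<Longrightarrow> lact BC a (pure b c) = pure (lact B a b) c"
  using tensor_lift_pure[OF T.abelian_group_axioms lact_balanced]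
  by (simp add: tensor_bimodule_def Let_def)

lemma ract_tensor_pure:
  "\<lbrakk>a \<in> carrier R; b \<in> carrier B; c \<in> carrier C\<rbrakk> \<Longrightarrow> ract BC (pure b c) a = pure b (ract C c a)"
  using tensor_lift_pure[OF T.abelian_group_axioms ract_balanced]
  by (simp add: tensor_bimodule_def Let_def)

end

text \<open>Several records share one underlying group. Since \<open>additive_maps\<close> reads
  only the carrier and the addition, all such sets are normalised to the bare group; the analogous
  rules for modules serve the same purpose.\<close>

lemma additive_maps_tensor_bimodule [simp]:
  "additive_maps (tensor_bimodule R B C) G = additive_maps (tensor_group R B C) G"
  "additive_maps G (tensor_bimodule R B C) = additive_maps G (tensor_group R B C)"
  by (simp_all add: additive_maps_def tensor_bimodule_def Let_def)

lemma tensor_bimodule_simps [simp]: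
  "carrier (tensor_bimodule R B C) = carrier (tensor_group R B C)"
  "add (tensor_bimodule R B C) = add (tensor_group R B C)"
  "\<zero>\<^bsub>tensor_bimodule R B C\<^esub> = \<zero>\<^bsub>tensor_group R B C\<^esub>"
  by (simp_all add: tensor_bimodule_def Let_def)

lemma abelian_group_cong:
  assumes "abelian_group G" "carrier G' = carrier G" "add G' = add G" "\<zero>\<^bsub>G'\<^esub> = \<zero>\<^bsub>G\<^esub>"
  shows "abelian_group G'"
proof -
  interpret G: abelian_group G by fact
  show ?thesis
    using assms(2-4) G.l_neg by (intro abelian_groupI) (auto simp: G.a_ac intro: G.a_inv_closed)
qed

text \<open>The left action touches the first factor and the right action the second, so they
  commute on pure tensors. This makes triple tensor products, and hence coassociativity, instances
  of \<open>tensor_pair\<close>.\<close>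

lemma (in tensor_pair) biaction_tensor: "biaction R BC"
proof -
  have "lact BC a (ract BC X r) = ract BC (lact BC a X) r"
    if a: "a \<in> carrier R" and r: "r \<in> carrier R" and X: "X \<in> carrier T" for a r X
  proof (rule tensor_ext[OF T.abelian_group_axioms _ _ _ X])
    show "(\<lambda>X. lact BC a (ract BC X r)) \<in> additive_maps T T"
      using additive_maps_comp[OF ract_tensor_additive[OF r] lact_tensor_additive[OF a]] .
    show "(\<lambda>X. ract BC (lact BC a X) r) \<in> additive_maps T T"
      using additive_maps_comp[OF lact_tensor_additive[OF a] ract_tensor_additive[OF r]] .
  qed (use a r in \<open>simp add: lact_tensor_pure ract_tensor_pure B.lact_closed C.ract_closed\<close>)
  moreover have "abelian_group BC"
    by (rule abelian_group_cong[OF T.abelian_group_axioms]) simp_all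
  ultimately show ?thesis
    by (simp add: biaction_def biaction_axioms_def
        additive_maps_closed[OF lact_tensor_additive] additive_maps_closed[OF ract_tensor_additive]
        additive_maps_add[OF lact_tensor_additive] additive_maps_add[OF ract_tensor_additive])
qed

section \<open>The tensor product of two modules\<close>

lemma module_bimodule_simps [simp]:
  "carrier (module_bimodule \<alpha> \<beta> M) = carrier M"
  "\<zero>\<^bsub>module_bimodule \<alpha> \<beta> M\<^esub> = \<zero>\<^bsub>M\<^esub>"
  "add (module_bimodule \<alpha> \<beta> M) = add M"
  "lact (module_bimodule \<alpha> \<beta> M) a m = \<alpha> a \<odot>\<^bsub>M\<^esub> m"
  "ract (module_bimodule \<alpha> \<beta> M) m a = \<beta> a \<odot>\<^bsub>M\<^esub> m"
  by (simp_all add: module_bimodule_def)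

lemma regular_module_simps [simp]:
  "carrier (regular_module A) = carrier A"
  "\<zero>\<^bsub>regular_module A\<^esub> = \<zero>\<^bsub>A\<^esub>"
  "add (regular_module A) = add A"
  "smult (regular_module A) = monoid.mult A"
  by (simp_all add: regular_module_def)

lemma additive_maps_module_bimodule [simp]:
  "additive_maps (module_bimodule \<alpha> \<beta> M) G = additive_maps M G"
  "additive_maps G (module_bimodule \<alpha> \<beta> M) = additive_maps G M"
  by (simp_all add: additive_maps_def)

lemma additive_maps_regular_module [simp]:
  "additive_maps (regular_module A) G = additive_maps A G"
  "additive_maps G (regular_module A) = additive_maps G A"
  by (simp_all add: additive_maps_def)

lemma additive_maps_tensor_module [simp]:
  "additive_maps (tensor_module R \<alpha> \<beta> \<Delta> M N) G =
    additive_maps (tensor_group R (module_bimodule \<alpha> \<beta> M) (module_bimodule \<alpha> \<beta> N)) G"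
  "additive_maps G (tensor_module R \<alpha> \<beta> \<Delta> M N) =
    additive_maps G (tensor_group R (module_bimodule \<alpha> \<beta> M) (module_bimodule \<alpha> \<beta> N))"
  by (simp_all add: additive_maps_def tensor_module_def Let_def)

lemma tensor_module_simps [simp]:
  "carrier (tensor_module R \<alpha> \<beta> \<Delta> M N) =
    carrier (tensor_group R (module_bimodule \<alpha> \<beta> M) (module_bimodule \<alpha> \<beta> N))"
  "add (tensor_module R \<alpha> \<beta> \<Delta> M N) =
    add (tensor_group R (module_bimodule \<alpha> \<beta> M) (module_bimodule \<alpha> \<beta> N))"
  "\<zero>\<^bsub>tensor_module R \<alpha> \<beta> \<Delta> M N\<^esub> =
    \<zero>\<^bsub>tensor_group R (module_bimodule \<alpha> \<beta> M) (module_bimodule \<alpha> \<beta> N)\<^esub>"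
  by (simp_all add: tensor_module_def Let_def)

lemma left_module_additive_act:
  assumes "left_module H M" "x \<in> carrier H"
  shows "(\<lambda>m. x \<odot>\<^bsub>M\<^esub> m) \<in> additive_maps M M"
  using assms by (intro additive_mapsI) (simp_all add: left_module.act_closed left_module.act_add_right)

lemma left_module_additive_orbit:
  assumes "left_module H M" "m \<in> carrier M"
  shows "(\<lambda>x. x \<odot>\<^bsub>M\<^esub> m) \<in> additive_maps H M"
  using assms by (intro additive_mapsI) (simp_all add: left_module.act_closed left_module.act_add_left)

lemma left_module_abelian_group: "left_module H M \<Longrightarrow> abelian_group M"
  by (simp add: left_module_def)

text \<open>With this, H \<otimes> H becomes the special case M = N = H of M \<otimes> N, and lemmas
  about pairs of modules apply to it.\<close>

lemma left_module_regular: "ring A \<Longrightarrow> left_module A (regular_module A)"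
  using abelian_group_cong[of A "regular_module A"]
  by (auto simp: left_module_def left_module_axioms_def ring.is_abelian_group ring.ring_simprules)

context hopf_algebroid
begin

lemma source_closed [simp, intro]: "a \<in> carrier R \<Longrightarrow> \<alpha> a \<in> carrier H"
  and source_mult: "\<lbrakk>a \<in> carrier R; b \<in> carrier R\<rbrakk> \<Longrightarrow> \<alpha> (a \<otimes>\<^bsub>R\<^esub> b) = \<alpha> a \<otimes>\<^bsub>H\<^esub> \<alpha> b"
  and source_add: "\<lbrakk>a \<in> carrier R; b \<in> carrier R\<rbrakk> \<Longrightarrow> \<alpha> (a \<oplus>\<^bsub>R\<^esub> b) = \<alpha> a \<oplus>\<^bsub>H\<^esub> \<alpha> b"
  and source_one: "\<alpha> \<one>\<^bsub>R\<^esub> = \<one>\<^bsub>H\<^esub>"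
  using source_hom by (auto simp: algebra_hom_def ring_hom_def)

lemma target_closed [simp, intro]: "a \<in> carrier R \<Longrightarrow> \<beta> a \<in> carrier H"
  and target_mult: "\<lbrakk>a \<in> carrier R; b \<in> carrier R\<rbrakk> \<Longrightarrow> \<beta> (a \<otimes>\<^bsub>R\<^esub> b) = \<beta> b \<otimes>\<^bsub>H\<^esub> \<beta> a"
  and target_add: "\<lbrakk>a \<in> carrier R; b \<in> carrier R\<rbrakk> \<Longrightarrow> \<beta> (a \<oplus>\<^bsub>R\<^esub> b) = \<beta> a \<oplus>\<^bsub>H\<^esub> \<beta> b"
  and target_one: "\<beta> \<one>\<^bsub>R\<^esub> = \<one>\<^bsub>H\<^esub>"
  using target_antihom by (auto simp: algebra_hom_def ring_hom_def opposite_def)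

abbreviation bim where "bim \<equiv> module_bimodule \<alpha> \<beta>"
abbreviation HB where "HB \<equiv> bim (regular_module H)"
abbreviation HH where "HH \<equiv> tensor_group R HB HB"

lemma left_module_H: "left_module H (regular_module H)"
  by (rule left_module_regular) (rule H.ring_axioms)

text \<open>The left and right R-actions commute because the images of \<alpha> and \<beta> commute
  in H.\<close>

lemma biaction_module:
  assumes "left_module H M" shows "biaction R (bim M)"
proof -
  interpret M: left_module H M by fact
  have "\<alpha> a \<odot>\<^bsub>M\<^esub> (\<beta> b \<odot>\<^bsub>M\<^esub> m) = \<beta> b \<odot>\<^bsub>M\<^esub> (\<alpha> a \<odot>\<^bsub>M\<^esub> m)"
    if "a \<in> carrier R" "b \<in> carrier R" "m \<in> carrier M" for a b m
    using that source_target_commute[of a b] by (simp flip: M.act_mult)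
  then show ?thesis
    using abelian_group_cong[OF M.abelian_group_axioms, of "bim M"]
    by (auto simp: biaction_def biaction_axioms_def M.act_closed M.act_add_right)
qed

lemma tensor_pair_modules:
  "\<lbrakk>left_module H M; left_module H N\<rbrakk> \<Longrightarrow> tensor_pair R (bim M) (bim N)"
  by (simp add: tensor_pair_def biaction_module)

sublocale HH: tensor_pair R HB HB
  by (intro tensor_pair_modules left_module_H)

lemma comult_closed [simp, intro]: "h \<in> carrier H \<Longrightarrow> \<Delta> h \<in> carrier HH"
  and comult_additive: "\<Delta> \<in> additive_maps H HH"
  and comult_lact: "\<lbrakk>a \<in> carrier R; h \<in> carrier H\<rbrakk> \<Longrightarrow>
    \<Delta> (\<alpha> a \<otimes>\<^bsub>H\<^esub> h) = lact (tensor_bimodule R HB HB) a (\<Delta> h)"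
  and comult_ract: "\<lbrakk>a \<in> carrier R; h \<in> carrier H\<rbrakk> \<Longrightarrow>
    \<Delta> (\<beta> a \<otimes>\<^bsub>H\<^esub> h) = ract (tensor_bimodule R HB HB) (\<Delta> h) a"
  using comult_hom by (auto simp: bimodule_hom_def total_bimodule_def additive_maps_def)

text \<open>For X = \<Sum> x \<otimes> y this is \<Sum> xm \<otimes> yn. The arguments
  \<open>m\<close> and \<open>n\<close> stay separate because for general X the value is not a
  function of m \<otimes> n.\<close>

definition pair_act ::
  "('h, 'm) module \<Rightarrow> ('h, 'n) module \<Rightarrow> ('h \<times> 'h \<Rightarrow>\<^sub>0 int) set \<Rightarrow> 'm \<Rightarrow> 'n
    \<Rightarrow> ('m \<times> 'n \<Rightarrow>\<^sub>0 int) set"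
  where "pair_act M N X m n = tensor_lift (tensor_group R (bim M) (bim N))
    (\<lambda>x y. tensor R (bim M) (bim N) (x \<odot>\<^bsub>M\<^esub> m) (y \<odot>\<^bsub>N\<^esub> n)) X"

text \<open>In the regular module, acting on \<open>x\<close> and \<open>y\<close> from the left by
  the components of X is multiplying X on the right by x \<otimes> y. The axioms stated with
  \<open>tensor_rmult\<close> thereby become statements about \<open>pair_act\<close>.\<close>

lemma tensor_rmult_eq:
  "tensor_rmult R H \<alpha> \<beta> = pair_act (regular_module H) (regular_module H)"
  by (simp add: fun_eq_iff tensor_rmult_def total_bimodule_def pair_act_def Let_def)

context
  fixes M :: "('h, 'm) module" and N :: "('h, 'n) module"
  assumes M: "left_module H M" and N: "left_module H N"
begin

interpretation M: left_module H M by (rule M)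
interpretation N: left_module H N by (rule N)
interpretation MN: tensor_pair R "bim M" "bim N" by (rule tensor_pair_modules[OF M N])

text \<open>The factors \<beta>(a) and \<alpha>(a) stand to the left of \<open>x\<close> and
  \<open>y\<close>, so they act last, on xm and yn, where the balancing relation of M \<otimes> N
  exchanges them. Hence every X is admissible here.\<close>

lemma pair_act_balanced:
  assumes m: "m \<in> carrier M" and n: "n \<in> carrier N"
  shows "balanced R HB HB MN.T (\<lambda>x y. MN.pure (x \<odot>\<^bsub>M\<^esub> m) (y \<odot>\<^bsub>N\<^esub> n))"
proof (rule balancedI)
  show "(\<lambda>x. MN.pure (x \<odot>\<^bsub>M\<^esub> m) (y \<odot>\<^bsub>N\<^esub> n)) \<in> additive_maps HB MN.T" if "y \<in> carrier HB" for y
    using additive_maps_comp[OF left_module_additive_orbit[OF M m]]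
      balanced_left[OF MN.pure_balanced, of "y \<odot>\<^bsub>N\<^esub> n"] that N.act_closed n by simp
  show "(\<lambda>y. MN.pure (x \<odot>\<^bsub>M\<^esub> m) (y \<odot>\<^bsub>N\<^esub> n)) \<in> additive_maps HB MN.T" if "x \<in> carrier HB" for x
    using additive_maps_comp[OF left_module_additive_orbit[OF N n]]
      balanced_right[OF MN.pure_balanced, of "x \<odot>\<^bsub>M\<^esub> m"] that M.act_closed m by simp
  show "MN.pure (ract HB x a \<odot>\<^bsub>M\<^esub> m) (y \<odot>\<^bsub>N\<^esub> n) = MN.pure (x \<odot>\<^bsub>M\<^esub> m) (lact HB a y \<odot>\<^bsub>N\<^esub> n)"
    if "x \<in> carrier HB" "a \<in> carrier R" "y \<in> carrier HB" for x a y
    using that m n balanced_act[OF MN.pure_balanced, of "x \<odot>\<^bsub>M\<^esub> m" a "y \<odot>\<^bsub>N\<^esub> n"]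
    by (simp add: M.act_mult N.act_mult M.act_closed N.act_closed)
qed

lemma pair_act_additive:
  "\<lbrakk>m \<in> carrier M; n \<in> carrier N\<rbrakk> \<Longrightarrow> (\<lambda>X. pair_act M N X m n) \<in> additive_maps HH MN.T"
  unfolding pair_act_def by (intro HH.tensor_lift_additive pair_act_balanced MN.T.abelian_group_axioms)

lemma pair_act_closed:
  "\<lbrakk>X \<in> carrier HH; m \<in> carrier M; n \<in> carrier N\<rbrakk> \<Longrightarrow> pair_act M N X m n \<in> carrier MN.T"
  by (rule additive_maps_closed[OF pair_act_additive])

lemma pair_act_pure:
  assumes "x \<in> carrier H" "y \<in> carrier H" "m \<in> carrier M" "n \<in> carrier N"
  shows "pair_act M N (HH.pure x y) m n = MN.pure (x \<odot>\<^bsub>M\<^esub> m) (y \<odot>\<^bsub>N\<^esub> n)"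
  using HH.tensor_lift_pure[OF MN.T.abelian_group_axioms pair_act_balanced, of m n x y] assms
  by (simp add: pair_act_def)

text \<open>The comparison runs over X, not over the module elements: for fixed elements both sides
  are additive in X, and for pure X the claim follows from additivity of the actions and of pure
  tensors.\<close>

lemma pair_act_add_left:
  assumes "X \<in> carrier HH" and m: "m \<in> carrier M" "m' \<in> carrier M" "n \<in> carrier N"
  shows "pair_act M N X (m \<oplus>\<^bsub>M\<^esub> m') n = pair_act M N X m n \<oplus>\<^bsub>MN.T\<^esub> pair_act M N X m' n"
proof (rule HH.tensor_ext[OF MN.T.abelian_group_axioms _ _ _ assms(1)])
  show "(\<lambda>X. pair_act M N X (m \<oplus>\<^bsub>M\<^esub> m') n) \<in> additive_maps HH MN.T"
    using m by (simp add: pair_act_additive)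
  show "(\<lambda>X. pair_act M N X m n \<oplus>\<^bsub>MN.T\<^esub> pair_act M N X m' n) \<in> additive_maps HH MN.T"
    using m by (intro additive_maps_add_pointwise pair_act_additive MN.T.abelian_group_axioms)
  show "pair_act M N (HH.pure x y) (m \<oplus>\<^bsub>M\<^esub> m') n =
    pair_act M N (HH.pure x y) m n \<oplus>\<^bsub>MN.T\<^esub> pair_act M N (HH.pure x y) m' n"
    if "x \<in> carrier HB" "y \<in> carrier HB" for x y
    using that m additive_maps_add[OF balanced_left[OF MN.pure_balanced, of "y \<odot>\<^bsub>N\<^esub> n"]]
    by (simp add: pair_act_pure M.act_add_right M.act_closed N.act_closed)
qed

lemma pair_act_add_right:
  assumes "X \<in> carrier HH" and m: "m \<in> carrier M" "n \<in> carrier N" "n' \<in> carrier N"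
  shows "pair_act M N X m (n \<oplus>\<^bsub>N\<^esub> n') = pair_act M N X m n \<oplus>\<^bsub>MN.T\<^esub> pair_act M N X m n'"
proof (rule HH.tensor_ext[OF MN.T.abelian_group_axioms _ _ _ assms(1)])
  show "(\<lambda>X. pair_act M N X m (n \<oplus>\<^bsub>N\<^esub> n')) \<in> additive_maps HH MN.T"
    using m by (simp add: pair_act_additive)
  show "(\<lambda>X. pair_act M N X m n \<oplus>\<^bsub>MN.T\<^esub> pair_act M N X m n') \<in> additive_maps HH MN.T"
    using m by (intro additive_maps_add_pointwise pair_act_additive MN.T.abelian_group_axioms)
  show "pair_act M N (HH.pure x y) m (n \<oplus>\<^bsub>N\<^esub> n') =
    pair_act M N (HH.pure x y) m n \<oplus>\<^bsub>MN.T\<^esub> pair_act M N (HH.pure x y) m n'"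
    if "x \<in> carrier HB" "y \<in> carrier HB" for x y
    using that m additive_maps_add[OF balanced_right[OF MN.pure_balanced, of "x \<odot>\<^bsub>M\<^esub> m"]]
    by (simp add: pair_act_pure N.act_add_right M.act_closed N.act_closed)
qed

end

text \<open>On pure X this is associativity of the two module actions. It turns an identity between
  right multiples of \<Delta>(h) into an identity on arbitrary modules.\<close>

lemma pair_act_pair_act:
  fixes M :: "('h, 'm) module" and N :: "('h, 'n) module"
  assumes M: "left_module H M" and N: "left_module H N"
    and X: "X \<in> carrier HH" and x: "x \<in> carrier H" "y \<in> carrier H"
    and m: "m \<in> carrier M" "n \<in> carrier N"
  shows "pair_act M N (pair_act (regular_module H) (regular_module H) X x y) m n =
    pair_act M N X (x \<odot>\<^bsub>M\<^esub> m) (y \<odot>\<^bsub>N\<^esub> n)"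
proof -
  interpret M: left_module H M by fact
  interpret N: left_module H N by fact
  interpret MN: tensor_pair R "bim M" "bim N" by (rule tensor_pair_modules[OF M N])
  let ?A = "pair_act (regular_module H) (regular_module H)"
  show ?thesis
  proof (rule HH.tensor_ext[OF MN.T.abelian_group_axioms _ _ _ X])
    show "(\<lambda>X. pair_act M N (?A X x y) m n) \<in> additive_maps HH MN.T"
      using additive_maps_comp[OF pair_act_additive[OF left_module_H left_module_H, of x y]
          pair_act_additive[OF M N, of m n]] x m by simp
    show "(\<lambda>X. pair_act M N X (x \<odot>\<^bsub>M\<^esub> m) (y \<odot>\<^bsub>N\<^esub> n)) \<in> additive_maps HH MN.T"
      using x m by (simp add: pair_act_additive[OF M N] M.act_closed N.act_closed)
    show "pair_act M N (?A (HH.pure u v) x y) m n =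
        pair_act M N (HH.pure u v) (x \<odot>\<^bsub>M\<^esub> m) (y \<odot>\<^bsub>N\<^esub> n)"
      if "u \<in> carrier HB" "v \<in> carrier HB" for u v
      using that x m
      by (simp add: pair_act_pure M N left_module_H M.act_closed N.act_closed M.act_mult N.act_mult)
  qed
qed

text \<open>The pairs (\<beta>(a)m, n) and (m, \<alpha>(a)n) arise from (m, n) by applying
  \<beta>(a) \<otimes> 1 and 1 \<otimes> \<alpha>(a). By \<open>pair_act_pair_act\<close> these
  become right multiples of \<Delta>(h), which the axiom \<open>comult_balanced\<close> identifies.
  This is why \<Delta>(h), unlike a general X, acts on M \<otimes> N.\<close>

lemma pair_act_comult_balanced:
  fixes M :: "('h, 'm) module" and N :: "('h, 'n) module"
  assumes M: "left_module H M" and N: "left_module H N" and h: "h \<in> carrier H"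
  shows "balanced R (bim M) (bim N) (tensor_group R (bim M) (bim N)) (pair_act M N (\<Delta> h))"
proof -
  interpret M: left_module H M by fact
  interpret N: left_module H N by fact
  interpret MN: tensor_pair R "bim M" "bim N" by (rule tensor_pair_modules[OF M N])
  let ?A = "pair_act (regular_module H) (regular_module H)"
  \<comment> \<open>The axiom says that a difference vanishes; closure of both terms in H \<otimes>
    H turns it into an equation.\<close>
  have A: "?A (\<Delta> h) (\<beta> a) \<one>\<^bsub>H\<^esub> = ?A (\<Delta> h) \<one>\<^bsub>H\<^esub> (\<alpha> a)" if a: "a \<in> carrier R" for a
  proof -
    have "?A (\<Delta> h) x y \<in> carrier HH" if "x \<in> carrier H" "y \<in> carrier H" for x y
      using that h by (simp add: pair_act_closed left_module_H)
    then show ?thesis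
      using comult_balanced[OF h a] a
      by (metis HH.T.a_inv_closed HH.T.minus_equality HH.T.minus_minus H.one_closed a_minus_def
          source_closed target_closed tensor_rmult_eq total_bimodule_def)
  qed
  show ?thesis
  proof (rule balancedI)
    show "(\<lambda>m. pair_act M N (\<Delta> h) m n) \<in> additive_maps (bim M) MN.T" if "n \<in> carrier (bim N)" for n
      using that h pair_act_closed[OF M N] pair_act_add_left[OF M N]
      by (intro additive_mapsI) simp_all
    show "pair_act M N (\<Delta> h) m \<in> additive_maps (bim N) MN.T" if "m \<in> carrier (bim M)" for m
      using that h pair_act_closed[OF M N] pair_act_add_right[OF M N]
      by (intro additive_mapsI) simp_all
    show "pair_act M N (\<Delta> h) (ract (bim M) m a) n = pair_act M N (\<Delta> h) m (lact (bim N) a n)"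
      if "m \<in> carrier (bim M)" "a \<in> carrier R" "n \<in> carrier (bim N)" for m a n
      using pair_act_pair_act[OF M N, of "\<Delta> h" "\<beta> a" "\<one>\<^bsub>H\<^esub>" m n]
        pair_act_pair_act[OF M N, of "\<Delta> h" "\<one>\<^bsub>H\<^esub>" "\<alpha> a" m n] that h A[of a]
      by (simp add: M.act_one N.act_one)
  qed
qed

lemma smult_tensor_module:
  fixes M :: "('h, 'm) module" and N :: "('h, 'n) module"
  shows
  "h \<odot>\<^bsub>tensor_module R \<alpha> \<beta> \<Delta> M N\<^esub> t =
    tensor_lift (tensor_group R (bim M) (bim N)) (pair_act M N (\<Delta> h)) t"
  by (simp add: tensor_module_def Let_def pair_act_def[abs_def])

text \<open>Distributivity and the unit law follow from additivity of \<Delta> and from \<Delta>(1)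
  = 1 \<otimes> 1. Only the associativity of the action needs the product in H \<otimes> H.\<close>

lemma left_module_tensor_module:
  fixes M :: "('h, 'm) module" and N :: "('h, 'n) module"
  assumes M: "left_module H M" and N: "left_module H N"
  shows "left_module H (tensor_module R \<alpha> \<beta> \<Delta> M N)" (is "left_module H ?T")
proof -
  interpret M: left_module H M by fact
  interpret N: left_module H N by fact
  interpret MN: tensor_pair R "bim M" "bim N" by (rule tensor_pair_modules[OF M N])
  note ab = MN.T.abelian_group_axioms
  note bal = pair_act_comult_balanced[OF M N]
  note smult = smult_tensor_module[where M = M and N = N]
  have pure: "h \<odot>\<^bsub>?T\<^esub> MN.pure m n = pair_act M N (\<Delta> h) m n"
    if "h \<in> carrier H" "m \<in> carrier M" "n \<in> carrier N" for h m n
    using that MN.tensor_lift_pure[OF ab bal] by (simp add: smult)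
  have add: "(\<lambda>t. h \<odot>\<^bsub>?T\<^esub> t) \<in> additive_maps MN.T MN.T" if "h \<in> carrier H" for h
    using that MN.tensor_lift_additive[OF ab bal[OF that]] by (simp add: smult)
  have cl: "h \<odot>\<^bsub>?T\<^esub> t \<in> carrier MN.T" if "h \<in> carrier H" "t \<in> carrier MN.T" for h t
    using additive_maps_closed[OF add that(2)] that(1) .
  show ?thesis
  proof (rule left_module.intro)
    show "abelian_group ?T" by (rule abelian_group_cong[OF ab]) simp_all
    show "left_module_axioms H ?T"
    proof
      fix g h t assume g: "g \<in> carrier H" and h: "h \<in> carrier H" and t: "t \<in> carrier ?T"
      from t have tT: "t \<in> carrier MN.T" by simp
      show "(g \<oplus>\<^bsub>H\<^esub> h) \<odot>\<^bsub>?T\<^esub> t = g \<odot>\<^bsub>?T\<^esub> t \<oplus>\<^bsub>?T\<^esub> h \<odot>\<^bsub>?T\<^esub> t"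
        unfolding tensor_module_simps
      proof (rule MN.tensor_ext[OF ab _ _ _ tT])
        show "(\<lambda>t. (g \<oplus>\<^bsub>H\<^esub> h) \<odot>\<^bsub>?T\<^esub> t) \<in> additive_maps MN.T MN.T" using g h by (simp add: add)
        show "(\<lambda>t. g \<odot>\<^bsub>?T\<^esub> t \<oplus>\<^bsub>MN.T\<^esub> h \<odot>\<^bsub>?T\<^esub> t) \<in> additive_maps MN.T MN.T"
          using g h by (intro additive_maps_add_pointwise add ab)
        show "(g \<oplus>\<^bsub>H\<^esub> h) \<odot>\<^bsub>?T\<^esub> MN.pure m n = g \<odot>\<^bsub>?T\<^esub> MN.pure m n \<oplus>\<^bsub>MN.T\<^esub> h \<odot>\<^bsub>?T\<^esub> MN.pure m n"
          if "m \<in> carrier (bim M)" "n \<in> carrier (bim N)" for m n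
          using that g h additive_maps_add[OF comult_additive g h]
            additive_maps_add[OF pair_act_additive[OF M N, of m n]] by (simp add: pure)
      qed
      \<comment> \<open>The heart of associativity: \<Delta>(gh)(m, n) is obtained by letting
        \<open>g\<close> act on \<Delta>(h)(m, n). Here \<Delta>(gh) is the lift of
        \<open>?A\<close>, right multiplication on \<Delta>(g), evaluated at \<Delta>(h).\<close>
      have X: "pair_act M N (\<Delta> (g \<otimes>\<^bsub>H\<^esub> h)) m n = g \<odot>\<^bsub>?T\<^esub> pair_act M N (\<Delta> h) m n"
        if m: "m \<in> carrier M" and n: "n \<in> carrier N" for m n
      proof -
        let ?A = "pair_act (regular_module H) (regular_module H) (\<Delta> g)"
        note HHab = HH.T.abelian_group_axioms
        note balA = pair_act_comult_balanced[OF left_module_H left_module_H g]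
        have "\<Delta> (g \<otimes>\<^bsub>H\<^esub> h) = tensor_lift HH ?A (\<Delta> h)"
          using comult_mult[OF g h]
          by (simp add: tensor_mult_def Let_def total_bimodule_def tensor_rmult_eq)
        \<comment> \<open>Replacing \<Delta>(h) by an arbitrary \<open>Y\<close> allows comparison
          on pure tensors. For Y = x \<otimes> y the claim is \<open>pair_act_pair_act\<close> with
          X = \<Delta>(g).\<close>
        moreover have "pair_act M N (tensor_lift HH ?A Y) m n = g \<odot>\<^bsub>?T\<^esub> pair_act M N Y m n"
          if Y: "Y \<in> carrier HH" for Y
        proof (rule HH.tensor_ext[OF ab _ _ _ Y])
          show "(\<lambda>Y. pair_act M N (tensor_lift HH ?A Y) m n) \<in> additive_maps HH MN.T"
            using additive_maps_comp[OF HH.tensor_lift_additive[OF HHab balA]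
                pair_act_additive[OF M N m n]] .
          show "(\<lambda>Y. g \<odot>\<^bsub>?T\<^esub> pair_act M N Y m n) \<in> additive_maps HH MN.T"
            using additive_maps_comp[OF pair_act_additive[OF M N m n] add[OF g]] .
          show "pair_act M N (tensor_lift HH ?A (HH.pure x y)) m n =
              g \<odot>\<^bsub>?T\<^esub> pair_act M N (HH.pure x y) m n"
            if "x \<in> carrier HB" "y \<in> carrier HB" for x y
            using that m n g
            by (simp add: HH.tensor_lift_pure[OF HHab balA] pair_act_pure[OF M N] pure
                pair_act_pair_act[OF M N] M.act_closed N.act_closed)
        qed
        ultimately show ?thesis using h by simp
      qed
      show "(g \<otimes>\<^bsub>H\<^esub> h) \<odot>\<^bsub>?T\<^esub> t = g \<odot>\<^bsub>?T\<^esub> (h \<odot>\<^bsub>?T\<^esub> t)"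
      proof (rule MN.tensor_ext[OF ab _ _ _ tT])
        show "(\<lambda>t. (g \<otimes>\<^bsub>H\<^esub> h) \<odot>\<^bsub>?T\<^esub> t) \<in> additive_maps MN.T MN.T" using g h by (simp add: add)
        show "(\<lambda>t. g \<odot>\<^bsub>?T\<^esub> (h \<odot>\<^bsub>?T\<^esub> t)) \<in> additive_maps MN.T MN.T"
          using additive_maps_comp[OF add[OF h] add[OF g]] .
        show "(g \<otimes>\<^bsub>H\<^esub> h) \<odot>\<^bsub>?T\<^esub> MN.pure m n = g \<odot>\<^bsub>?T\<^esub> (h \<odot>\<^bsub>?T\<^esub> MN.pure m n)"
          if "m \<in> carrier (bim M)" "n \<in> carrier (bim N)" for m n
          using that g h X by (simp add: pure)
      qed
    next
      fix t assume "t \<in> carrier ?T"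
      then have tT: "t \<in> carrier MN.T" by simp
      show "\<one>\<^bsub>H\<^esub> \<odot>\<^bsub>?T\<^esub> t = t"
      proof (rule MN.tensor_ext[OF ab add additive_maps_id _ tT])
        show "\<one>\<^bsub>H\<^esub> \<odot>\<^bsub>?T\<^esub> MN.pure m n = MN.pure m n"
          if "m \<in> carrier (bim M)" "n \<in> carrier (bim N)" for m n
          using that comult_one
          by (simp add: pure total_bimodule_def pair_act_pure[OF M N] M.act_one N.act_one)
      qed simp
    qed (use cl additive_maps_add[OF add] in simp_all)
  qed (rule H.ring_axioms)
qed

text \<open>Since \<Delta> respects both R-actions and \<Delta>(1) = 1 \<otimes> 1, it sends
  \<alpha>(a) to \<alpha>(a) \<otimes> 1 and \<beta>(a) to 1 \<otimes> \<beta>(a). The R-actions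
  induced by the H-module structure are therefore those used to form a further tensor
  product.\<close>

lemma lact_tensor_module_pure:
  fixes M :: "('h, 'm) module" and N :: "('h, 'n) module"
  assumes M: "left_module H M" and N: "left_module H N"
    and a: "a \<in> carrier R" and m: "m \<in> carrier M" and n: "n \<in> carrier N"
  shows "\<alpha> a \<odot>\<^bsub>tensor_module R \<alpha> \<beta> \<Delta> M N\<^esub> tensor R (bim M) (bim N) m n =
      tensor R (bim M) (bim N) (\<alpha> a \<odot>\<^bsub>M\<^esub> m) n"
    and "\<beta> a \<odot>\<^bsub>tensor_module R \<alpha> \<beta> \<Delta> M N\<^esub> tensor R (bim M) (bim N) m n =
      tensor R (bim M) (bim N) m (\<beta> a \<odot>\<^bsub>N\<^esub> n)"
proof -
  interpret M: left_module H M by fact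
  interpret N: left_module H N by fact
  interpret MN: tensor_pair R "bim M" "bim N" by (rule tensor_pair_modules[OF M N])
  have pure: "h \<odot>\<^bsub>tensor_module R \<alpha> \<beta> \<Delta> M N\<^esub> MN.pure m n = pair_act M N (\<Delta> h) m n"
    if "h \<in> carrier H" for h
    using m n MN.tensor_lift_pure[OF MN.T.abelian_group_axioms pair_act_comult_balanced[OF M N that]]
    by (simp add: smult_tensor_module)
  have "\<Delta> (\<alpha> a) = HH.pure (\<alpha> a) \<one>\<^bsub>H\<^esub>"
    using comult_lact[OF a H.one_closed] HH.lact_tensor_pure[OF a] comult_one a
    by (simp add: total_bimodule_def)
  then show "\<alpha> a \<odot>\<^bsub>tensor_module R \<alpha> \<beta> \<Delta> M N\<^esub> MN.pure m n = MN.pure (\<alpha> a \<odot>\<^bsub>M\<^esub> m) n"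
    using a m n by (simp add: pure pair_act_pure[OF M N] N.act_one)
  have "\<Delta> (\<beta> a) = HH.pure \<one>\<^bsub>H\<^esub> (\<beta> a)"
    using comult_ract[OF a H.one_closed] HH.ract_tensor_pure[OF a] comult_one a
    by (simp add: total_bimodule_def)
  then show "\<beta> a \<odot>\<^bsub>tensor_module R \<alpha> \<beta> \<Delta> M N\<^esub> MN.pure m n = MN.pure m (\<beta> a \<odot>\<^bsub>N\<^esub> n)"
    using a m n by (simp add: pure pair_act_pure[OF M N] M.act_one)
qed

end

section \<open>Coassociativity applied to trilinear maps\<close>

text \<open>For fixed parameters both sides are additive in \<open>X\<close>, so the comparison is
  made on pure tensors. It is used for nested lifts, where the inner integrand depends on a variable
  in which the outer map must be additive.\<close>

lemma (in tensor_pair) tensor_lift_additive_param: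
  assumes G: "abelian_group G" and X: "X \<in> carrier T" and A: "abelian_group A"
    and bal: "\<And>x. x \<in> carrier A \<Longrightarrow> balanced R B C G (f x)"
    and add: "\<And>b c. \<lbrakk>b \<in> carrier B; c \<in> carrier C\<rbrakk> \<Longrightarrow> (\<lambda>x. f x b c) \<in> additive_maps A G"
  shows "(\<lambda>x. tensor_lift G (f x) X) \<in> additive_maps A G"
proof (rule additive_mapsI)
  interpret A: abelian_group A by fact
  fix x y assume x: "x \<in> carrier A" and y: "y \<in> carrier A"
  then have xy: "x \<oplus>\<^bsub>A\<^esub> y \<in> carrier A" by simp
  show "tensor_lift G (f (x \<oplus>\<^bsub>A\<^esub> y)) X = tensor_lift G (f x) X \<oplus>\<^bsub>G\<^esub> tensor_lift G (f y) X"
  proof (rule tensor_ext[OF G tensor_lift_additive[OF G bal[OF xy]] _ _ X])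
    show "(\<lambda>X. tensor_lift G (f x) X \<oplus>\<^bsub>G\<^esub> tensor_lift G (f y) X) \<in> additive_maps T G"
      by (intro additive_maps_add_pointwise tensor_lift_additive G bal x y)
  qed (use x y xy additive_maps_add[OF add] in \<open>simp add: tensor_lift_pure[OF G bal]\<close>)
qed (rule tensor_lift_closed[OF G bal X])

text \<open>The Sweedler form of coassociativity for a map \<open>f\<close> additive in each
  variable and balanced at both joints. Such an \<open>f\<close> induces an additive map \<Phi> on H
  \<otimes> (H \<otimes> H); applying \<Phi> to the two sides of the axiom gives the two nested
  sums.\<close>

lemma (in hopf_algebroid) coassoc_trilinear:
  assumes G: "abelian_group G"
    and add: "\<And>y z. \<lbrakk>y \<in> carrier H; z \<in> carrier H\<rbrakk> \<Longrightarrow> (\<lambda>x. f x y z) \<in> additive_maps H G"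
      "\<And>x z. \<lbrakk>x \<in> carrier H; z \<in> carrier H\<rbrakk> \<Longrightarrow> (\<lambda>y. f x y z) \<in> additive_maps H G"
      "\<And>x y. \<lbrakk>x \<in> carrier H; y \<in> carrier H\<rbrakk> \<Longrightarrow> f x y \<in> additive_maps H G"
    and bal: "\<And>a x y z. \<lbrakk>a \<in> carrier R; x \<in> carrier H; y \<in> carrier H; z \<in> carrier H\<rbrakk> \<Longrightarrow>
        f (\<beta> a \<otimes>\<^bsub>H\<^esub> x) y z = f x (\<alpha> a \<otimes>\<^bsub>H\<^esub> y) z"
      "\<And>a x y z. \<lbrakk>a \<in> carrier R; x \<in> carrier H; y \<in> carrier H; z \<in> carrier H\<rbrakk> \<Longrightarrow>
        f x (\<beta> a \<otimes>\<^bsub>H\<^esub> y) z = f x y (\<alpha> a \<otimes>\<^bsub>H\<^esub> z)"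
    and h: "h \<in> carrier H"
  shows "tensor_lift G (\<lambda>u z. tensor_lift G (\<lambda>x y. f x y z) (\<Delta> u)) (\<Delta> h) =
    tensor_lift G (\<lambda>x v. tensor_lift G (f x) (\<Delta> v)) (\<Delta> h)"
proof -
  let ?HHB = "tensor_bimodule R HB HB"
  interpret P: tensor_pair R HB ?HHB
    by (intro tensor_pair.intro biaction_module left_module_H HH.biaction_tensor)
  interpret Q: tensor_pair R ?HHB HB
    by (intro tensor_pair.intro biaction_module left_module_H HH.biaction_tensor)
  note Pab = P.T.abelian_group_axioms and Qab = Q.T.abelian_group_axioms
  have Hab: "abelian_group H" by (rule H.is_abelian_group)
  have bal_xy: "balanced R HB HB G (\<lambda>x y. f x y z)" if "z \<in> carrier H" for z
    by (rule balancedI) (use that add(1,2) bal(1) in simp_all)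
  have bal_yz: "balanced R HB HB G (f x)" if "x \<in> carrier H" for x
    by (rule balancedI) (use that add(2,3) bal(2) in simp_all)
  define \<Phi> where "\<Phi> = tensor_lift G (\<lambda>x. tensor_lift G (f x))"
  have bal_\<Phi>: "balanced R HB ?HHB G (\<lambda>x. tensor_lift G (f x))"
  proof (rule balancedI)
    show "(\<lambda>x. tensor_lift G (f x) Y) \<in> additive_maps HB G" if "Y \<in> carrier ?HHB" for Y
      using HH.tensor_lift_additive_param[OF G _ Hab bal_yz, of Y "\<lambda>x. x"] that add(1) by simp
    show "tensor_lift G (f x) \<in> additive_maps ?HHB G" if "x \<in> carrier HB" for x
      using that by (simp add: HH.tensor_lift_additive[OF G bal_yz])
    \<comment> \<open>On Y = y \<otimes> z the left action multiplies \<open>y\<close> by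
      \<alpha>(a), so the first balance hypothesis on \<open>f\<close> is what is needed. The second
      one was spent on the inner lift.\<close>
    show "tensor_lift G (f (ract HB x a)) Y = tensor_lift G (f x) (lact ?HHB a Y)"
      if x: "x \<in> carrier HB" and a: "a \<in> carrier R" and Y: "Y \<in> carrier ?HHB" for x a Y
    proof (rule HH.tensor_ext[OF G _ _ _ Y[unfolded tensor_bimodule_simps]])
      show "tensor_lift G (f (ract HB x a)) \<in> additive_maps HH G"
        using x a by (intro HH.tensor_lift_additive[OF G bal_yz]) simp
      show "(\<lambda>Y. tensor_lift G (f x) (lact ?HHB a Y)) \<in> additive_maps HH G"
        using additive_maps_comp[OF HH.lact_tensor_additive[OF a]
            HH.tensor_lift_additive[OF G bal_yz, of x]] x by simp
      show "tensor_lift G (f (ract HB x a)) (HH.pure y z) =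
          tensor_lift G (f x) (lact ?HHB a (HH.pure y z))"
        if "y \<in> carrier HB" "z \<in> carrier HB" for y z
        using that x a bal by (simp add: HH.lact_tensor_pure HH.tensor_lift_pure[OF G bal_yz])
    qed
  qed
  have \<Phi>_add: "\<Phi> \<in> additive_maps P.T G"
    unfolding \<Phi>_def by (rule P.tensor_lift_additive[OF G bal_\<Phi>])
  have \<Phi>_pure: "\<Phi> (P.pure x Y) = tensor_lift G (f x) Y" if "x \<in> carrier H" "Y \<in> carrier HH" for x Y
    unfolding \<Phi>_def using that by (simp add: P.tensor_lift_pure[OF G bal_\<Phi>])

  have bal_right: "balanced R HB HB P.T (\<lambda>x v. P.pure x (\<Delta> v))"
  proof (rule balancedI)
    show "(\<lambda>x. P.pure x (\<Delta> v)) \<in> additive_maps HB P.T" if "v \<in> carrier HB" for v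
      using that by (intro balanced_left[OF P.pure_balanced]) simp
    show "(\<lambda>v. P.pure x (\<Delta> v)) \<in> additive_maps HB P.T" if "x \<in> carrier HB" for x
      using additive_maps_comp[OF comult_additive] balanced_right[OF P.pure_balanced that] by simp
    show "P.pure (ract HB x a) (\<Delta> v) = P.pure x (\<Delta> (lact HB a v))"
      if "x \<in> carrier HB" "a \<in> carrier R" "v \<in> carrier HB" for x a v
      using that balanced_act[OF P.pure_balanced, of x a "\<Delta> v"] by (simp add: comult_lact)
  qed
  have "\<Phi> (tensor_map R HB ?HHB (\<lambda>x. x) \<Delta> (\<Delta> h)) =
      tensor_lift G (\<lambda>x v. \<Phi> (P.pure x (\<Delta> v))) (\<Delta> h)"
    unfolding tensor_map_def by (rule HH.tensor_lift_comp[OF Pab G bal_right \<Phi>_add comult_closed[OF h]])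
  also have "\<dots> = tensor_lift G (\<lambda>x v. tensor_lift G (f x) (\<Delta> v)) (\<Delta> h)"
    using h by (intro HH.tensor_lift_cong[OF G balanced_comp[OF bal_right \<Phi>_add]]) (simp_all add: \<Phi>_pure)
  finally have right: "\<Phi> (tensor_map R HB ?HHB (\<lambda>x. x) \<Delta> (\<Delta> h)) =
      tensor_lift G (\<lambda>x v. tensor_lift G (f x) (\<Delta> v)) (\<Delta> h)" .

  have bal_inner: "balanced R HB HB P.T (\<lambda>x y. P.pure x (HH.pure y z))" if z: "z \<in> carrier H" for z
  proof (rule balancedI)
    show "(\<lambda>x. P.pure x (HH.pure y z)) \<in> additive_maps HB P.T" if "y \<in> carrier HB" for y
      using that z by (intro balanced_left[OF P.pure_balanced]) simp
    show "(\<lambda>y. P.pure x (HH.pure y z)) \<in> additive_maps HB P.T" if "x \<in> carrier HB" for x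
      using additive_maps_comp[OF balanced_left[OF HH.pure_balanced, of z], of "P.pure x"]
        balanced_right[OF P.pure_balanced that] z by simp
    show "P.pure (ract HB x a) (HH.pure y z) = P.pure x (HH.pure (lact HB a y) z)"
      if "x \<in> carrier HB" "a \<in> carrier R" "y \<in> carrier HB" for x a y
      using that z balanced_act[OF P.pure_balanced, of x a "HH.pure y z"]
      by (simp add: HH.lact_tensor_pure)
  qed
  \<comment> \<open>The element (\<Delta> \<otimes> id)\<Delta>(h) lives in (H \<otimes> H)
    \<otimes> H and has to be moved to the domain of \<Phi>. The canonical map is itself a nested
    lift, whose balancedness must be shown before it can be evaluated.\<close>
  define assoc where "assoc = tensor_assoc R HB HB HB"
  have assoc_eq: "assoc = tensor_lift P.T (\<lambda>U z. tensor_lift P.T (\<lambda>x y. P.pure x (HH.pure y z)) U)"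
    by (simp add: assoc_def tensor_assoc_def Let_def)
  have bal_assoc: "balanced R ?HHB HB P.T (\<lambda>U z. tensor_lift P.T (\<lambda>x y. P.pure x (HH.pure y z)) U)"
  proof (rule balancedI)
    show "tensor_lift P.T (\<lambda>x y. P.pure x (HH.pure y z)) \<in> additive_maps ?HHB P.T"
      if "z \<in> carrier HB" for z
      using that by (simp add: HH.tensor_lift_additive[OF Pab bal_inner])
    show "(\<lambda>z. tensor_lift P.T (\<lambda>x y. P.pure x (HH.pure y z)) U) \<in> additive_maps HB P.T"
      if U: "U \<in> carrier ?HHB" for U
      unfolding additive_maps_module_bimodule additive_maps_regular_module
    proof (rule HH.tensor_lift_additive_param[OF Pab _ Hab bal_inner])
      show "(\<lambda>z. P.pure x (HH.pure y z)) \<in> additive_maps H P.T"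
        if "x \<in> carrier HB" "y \<in> carrier HB" for x y
        using additive_maps_comp[OF balanced_right[OF HH.pure_balanced, of y], of "P.pure x"]
          balanced_right[OF P.pure_balanced that(1)] that by simp
    qed (use U in simp_all)
    \<comment> \<open>The right action on U = x \<otimes> y multiplies \<open>y\<close> by
      \<beta>(a), and the relation inside the inner product y \<otimes> z carries it over to
      \<open>z\<close> as \<alpha>(a).\<close>
    show "tensor_lift P.T (\<lambda>x y. P.pure x (HH.pure y z)) (ract ?HHB U a) =
        tensor_lift P.T (\<lambda>x y. P.pure x (HH.pure y (lact HB a z))) U"
      if U: "U \<in> carrier ?HHB" and a: "a \<in> carrier R" and z: "z \<in> carrier HB" for U a z
    proof -
      have z': "z \<in> carrier H" "lact HB a z \<in> carrier H" using a z by simp_all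
      show ?thesis
      proof (rule HH.tensor_ext[OF Pab _ _ _ U[unfolded tensor_bimodule_simps]])
        show "(\<lambda>U. tensor_lift P.T (\<lambda>x y. P.pure x (HH.pure y z)) (ract ?HHB U a)) \<in> additive_maps HH P.T"
          using additive_maps_comp[OF HH.ract_tensor_additive[OF a]
              HH.tensor_lift_additive[OF Pab bal_inner[OF z'(1)]]] .
        show "tensor_lift P.T (\<lambda>x y. P.pure x (HH.pure y (lact HB a z))) \<in> additive_maps HH P.T"
          by (rule HH.tensor_lift_additive[OF Pab bal_inner[OF z'(2)]])
        show "tensor_lift P.T (\<lambda>x y. P.pure x (HH.pure y z)) (ract ?HHB (HH.pure x y) a) =
            tensor_lift P.T (\<lambda>x y. P.pure x (HH.pure y (lact HB a z))) (HH.pure x y)"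
          if xy: "x \<in> carrier HB" "y \<in> carrier HB" for x y
          using xy z' a HH.tensor_lift_pure[OF Pab bal_inner[OF z'(1)]]
            HH.tensor_lift_pure[OF Pab bal_inner[OF z'(2)]]
            balanced_act[OF HH.pure_balanced, of y a z]
          by (simp add: HH.ract_tensor_pure)
      qed
    qed
  qed
  have bal_left: "balanced R HB HB Q.T (\<lambda>u z. Q.pure (\<Delta> u) z)"
  proof (rule balancedI)
    show "(\<lambda>u. Q.pure (\<Delta> u) z) \<in> additive_maps HB Q.T" if "z \<in> carrier HB" for z
      using additive_maps_comp[OF comult_additive] balanced_left[OF Q.pure_balanced that] by simp
    show "Q.pure (\<Delta> u) \<in> additive_maps HB Q.T" if "u \<in> carrier HB" for u
      using that by (intro balanced_right[OF Q.pure_balanced]) simp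
    show "Q.pure (\<Delta> (ract HB u a)) z = Q.pure (\<Delta> u) (lact HB a z)"
      if "u \<in> carrier HB" "a \<in> carrier R" "z \<in> carrier HB" for u a z
      using that balanced_act[OF Q.pure_balanced, of "\<Delta> u" a z] by (simp add: comult_ract)
  qed
  have assoc_add: "assoc \<in> additive_maps Q.T P.T"
    unfolding assoc_eq by (rule Q.tensor_lift_additive[OF Pab bal_assoc])
  have assoc_\<Phi>: "(\<lambda>V. \<Phi> (assoc V)) \<in> additive_maps Q.T G"
    by (rule additive_maps_comp[OF assoc_add \<Phi>_add])
  have "\<Phi> (assoc (tensor_map R ?HHB HB \<Delta> (\<lambda>x. x) (\<Delta> h))) =
      tensor_lift G (\<lambda>u z. \<Phi> (assoc (Q.pure (\<Delta> u) z))) (\<Delta> h)"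
    unfolding tensor_map_def by (rule HH.tensor_lift_comp[OF Qab G bal_left assoc_\<Phi> comult_closed[OF h]])
  also have "\<dots> = tensor_lift G (\<lambda>u z. tensor_lift G (\<lambda>x y. f x y z) (\<Delta> u)) (\<Delta> h)"
  proof (rule HH.tensor_lift_cong[OF G balanced_comp[OF bal_left assoc_\<Phi>] comult_closed[OF h]])
    fix u z assume "u \<in> carrier HB" "z \<in> carrier HB"
    then have u: "u \<in> carrier H" and z: "z \<in> carrier H" by simp_all
    have "\<Phi> (assoc (Q.pure (\<Delta> u) z)) =
        \<Phi> (tensor_lift P.T (\<lambda>x y. P.pure x (HH.pure y z)) (\<Delta> u))"
      unfolding assoc_eq using u z by (simp add: Q.tensor_lift_pure[OF Pab bal_assoc])
    also have "\<dots> = tensor_lift G (\<lambda>x y. \<Phi> (P.pure x (HH.pure y z))) (\<Delta> u)"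
      by (rule HH.tensor_lift_comp[OF Pab G bal_inner[OF z] \<Phi>_add comult_closed[OF u]])
    also have "\<dots> = tensor_lift G (\<lambda>x y. f x y z) (\<Delta> u)"
      using u z by (intro HH.tensor_lift_cong[OF G balanced_comp[OF bal_inner[OF z] \<Phi>_add]])
        (simp_all add: \<Phi>_pure HH.tensor_lift_pure[OF G bal_yz])
    finally show "\<Phi> (assoc (Q.pure (\<Delta> u) z)) = tensor_lift G (\<lambda>x y. f x y z) (\<Delta> u)" .
  qed
  finally show ?thesis
    using coassoc[OF h] right by (simp add: assoc_def total_bimodule_def)
qed

section \<open>Transport to the universe of module elements\<close>

lemma transport_module_simps:
  assumes "inj_on f (carrier M)"
  shows "carrier (transport_module f M) = f ` carrier M"
    and "\<zero>\<^bsub>transport_module f M\<^esub> = f \<zero>\<^bsub>M\<^esub>"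
    and "\<lbrakk>x \<in> carrier M; y \<in> carrier M\<rbrakk> \<Longrightarrow> f x \<oplus>\<^bsub>transport_module f M\<^esub> f y = f (x \<oplus>\<^bsub>M\<^esub> y)"
    and "x \<in> carrier M \<Longrightarrow> h \<odot>\<^bsub>transport_module f M\<^esub> f x = f (h \<odot>\<^bsub>M\<^esub> x)"
  using assms by (simp_all add: transport_module_def Let_def)

lemma transport_module_additive:
  assumes "inj_on f (carrier M)"
  shows "f \<in> additive_maps M (transport_module f M)"
  using assms by (intro additive_mapsI) (simp_all add: transport_module_simps)

lemma transport_module_additive_inv:
  assumes f: "inj_on f (carrier M)" and M: "abelian_group M"
  shows "inv_into (carrier M) f \<in> additive_maps (transport_module f M) M"
proof -
  interpret M: abelian_group M by fact
  show ?thesis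
    using f by (intro additive_mapsI) (auto simp: transport_module_simps)
qed

lemma left_module_transport:
  assumes f: "inj_on f (carrier M)" and M: "left_module H M"
  shows "left_module H (transport_module f M)"
proof -
  interpret M: left_module H M by fact
  note simps = transport_module_simps[OF f]
  have "\<exists>y\<in>carrier M. f (y \<oplus>\<^bsub>M\<^esub> x) = f \<zero>\<^bsub>M\<^esub>" if "x \<in> carrier M" for x
    using M.l_neg[OF that] M.a_inv_closed[OF that] by metis
  then have "abelian_group (transport_module f M)"
    by (intro abelian_groupI) (auto simp: simps M.a_ac)
  then show ?thesis
    by (auto simp: left_module_def left_module_axioms_def M.ring_axioms simps M.act_closed
        M.act_add_left M.act_add_right M.act_mult M.act_one)
qed

text \<open>The list enumerates the support together with its coefficients. It guarantees that the
  choice in \<open>encode\<close> has a solution for every nonempty set.\<close>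

lemma encode_witness:
  fixes p :: "'a \<times> 'b \<Rightarrow>\<^sub>0 int"
  obtains xs where "(\<Sum>(m, n, c)\<leftarrow>xs. Poly_Mapping.single (m, n) c) = p"
proof -
  obtain zs where zs: "set zs = Poly_Mapping.keys p" "distinct zs"
    using finite_distinct_list[OF finite_keys[of p]] by blast
  have "(\<Sum>(m, n, c)\<leftarrow>map (\<lambda>(m, n). (m, n, Poly_Mapping.lookup p (m, n))) zs.
      Poly_Mapping.single (m, n) c) = (\<Sum>z\<leftarrow>zs. Poly_Mapping.single z (Poly_Mapping.lookup p z))"
    by (induction zs) auto
  also have "\<dots> = (\<Sum>z\<in>Poly_Mapping.keys p. Poly_Mapping.single z (Poly_Mapping.lookup p z))"
    using zs by (simp add: sum_list_distinct_conv_sum_set)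
  \<comment> \<open>Each term is an integer multiple of a generator, so the sum is recognised as the
    extension of \<open>frag_of\<close>, which \<open>frag_expansion\<close> identifies with
    \<open>p\<close>.\<close>
  also have "\<dots> = frag_extend frag_of p"
    unfolding frag_extend_def
    by (rule sum.cong[OF refl], rule poly_mapping_eqI) (simp add: lookup_single when_def)
  also have "\<dots> = p"
    by (rule frag_expansion[symmetric])
  finally show ?thesis using that by blast
qed

text \<open>Equal codes contain the same chosen list, and its sum lies in both sets. For arbitrary
  sets equality cannot be concluded; for cosets a common element suffices.\<close>

lemma encode_eqD:
  assumes "p \<in> X" "q \<in> Y" "encode X = encode Y"
  shows "X \<inter> Y \<noteq> {}"
proof -
  have "(\<Sum>(m, n, c)\<leftarrow>(SOME xs. (\<Sum>(m, n, c)\<leftarrow>xs. Poly_Mapping.single (m, n) c) \<in> Z).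
      Poly_Mapping.single (m, n) c) \<in> Z" if "r \<in> Z"
    for r and Z :: "(('a, 'b) elt \<times> ('a, 'b) elt \<Rightarrow>\<^sub>0 int) set"
    by (rule someI_ex) (metis encode_witness that)
  from this[OF assms(1)] this[OF assms(2)] show ?thesis
    using assms(3) by (auto simp: encode_def)
qed

lemma (in tensor_pair) tensor_group_disjoint:
  assumes "X \<in> carrier T" "Y \<in> carrier T" "X \<inter> Y \<noteq> {}"
  shows "X = Y"
proof -
  obtain p where p: "p \<in> X" "p \<in> Y" using assms(3) by auto
  have Z: "Z = N #>\<^bsub>F\<^esub> p" if "Z \<in> carrier T" "p \<in> Z" for Z
  proof -
    obtain q where q: "q \<in> carrier F" "Z = N #>\<^bsub>F\<^esub> q"
      using \<open>Z \<in> carrier T\<close> carrier_tensor_group by auto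
    show ?thesis
      unfolding q(2)
      by (rule F.repr_independence[OF that(2)[unfolded q(2)] q(1) N.is_subgroup])
  qed
  show ?thesis by (rule trans[OF Z[OF assms(1) p(1)] Z[OF assms(2) p(2), symmetric]])
qed

lemma (in tensor_pair) tensor_group_nonempty:
  assumes "X \<in> carrier T" shows "X \<noteq> {}"
  using assms F.rcos_self[OF _ N.is_subgroup] by (auto simp: carrier_tensor_group)

text \<open>Cosets are nonempty, so their codes name genuine elements, and two cosets with a common
  element coincide.\<close>

lemma inj_on_encode:
  assumes "tensor_pair R B C" shows "inj_on encode (carrier (tensor_group R B C))"
proof (rule inj_onI)
  interpret tensor_pair R B C by fact
  fix X Y assume "X \<in> carrier T" "Y \<in> carrier T" "encode X = encode Y"
  then show "X = Y"
    using tensor_group_disjoint[of X Y] tensor_group_nonempty[of X] tensor_group_nonempty[of Y]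
      encode_eqD[of _ X _ Y] by blast
qed

section \<open>Homomorphisms of modules\<close>

lemma additive_maps_restrict:
  assumes "f \<in> additive_maps M N" "abelian_group M"
  shows "restrict f (carrier M) \<in> additive_maps M N"
proof -
  interpret M: abelian_group M by fact
  show ?thesis using assms(1) by (auto simp: additive_maps_def)
qed

lemma rep_hom_additive: "f \<in> rep_hom H M N \<Longrightarrow> f \<in> additive_maps M N"
  by (auto simp: rep_hom_def additive_maps_def)

lemma rep_hom_closed: "\<lbrakk>f \<in> rep_hom H M N; x \<in> carrier M\<rbrakk> \<Longrightarrow> f x \<in> carrier N"
  by (auto simp: rep_hom_def)

lemma rep_hom_linear:
  "\<lbrakk>f \<in> rep_hom H M N; h \<in> carrier H; x \<in> carrier M\<rbrakk> \<Longrightarrow> f (h \<odot>\<^bsub>M\<^esub> x) = h \<odot>\<^bsub>N\<^esub> f x"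
  by (auto simp: rep_hom_def)

text \<open>Morphisms are extensional, so that their equality is equality on the carrier.
  Restricting an additive map keeps its linearity because the carrier is closed under addition and
  the action.\<close>

lemma rep_hom_restrictI:
  assumes M: "left_module H M" and f: "f \<in> additive_maps M N"
    and lin: "\<And>h x. \<lbrakk>h \<in> carrier H; x \<in> carrier M\<rbrakk> \<Longrightarrow> f (h \<odot>\<^bsub>M\<^esub> x) = h \<odot>\<^bsub>N\<^esub> f x"
  shows "restrict f (carrier M) \<in> rep_hom H M N"
proof -
  interpret M: left_module H M by fact
  show ?thesis
    using f lin by (auto simp: rep_hom_def additive_maps_def M.act_closed)
qed

lemma rep_hom_eqI:
  assumes "f \<in> rep_hom H M N" "g \<in> rep_hom H M N"
    and "\<And>x. x \<in> carrier M \<Longrightarrow> f x = g x"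
  shows "f = g"
  using assms by (auto simp: rep_hom_def intro: PiE_ext)

lemma rep_comp_apply: "x \<in> carrier L \<Longrightarrow> rep_comp L M N g f x = g (f x)"
  by (simp add: rep_comp_def compose_def)

lemma rep_id_apply: "x \<in> carrier M \<Longrightarrow> rep_id M x = x"
  by (simp add: rep_id_def)

lemma rep_comp_hom:
  assumes A: "left_module H A" and f: "f \<in> rep_hom H A B" and g: "g \<in> rep_hom H B C"
  shows "rep_comp A B C g f \<in> rep_hom H A C"
  unfolding rep_comp_def compose_def
  using additive_maps_comp[OF rep_hom_additive[OF f] rep_hom_additive[OF g]]
  by (rule rep_hom_restrictI[OF A])
    (simp add: rep_hom_linear[OF f] rep_hom_linear[OF g] rep_hom_closed[OF f])

lemma rep_id_hom: "left_module H A \<Longrightarrow> rep_id A \<in> rep_hom H A A"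
  unfolding rep_id_def by (intro rep_hom_restrictI additive_maps_id refl)

lemma category_rep:
  fixes H :: "('h, 'c) ring_scheme"
  shows "category (rep_obj H :: ('h, ('r, 'u) elt) module set) (rep_hom H) rep_id rep_comp"
proof (unfold_locales, unfold rep_obj_def mem_Collect_eq)
qed (auto simp: rep_comp_hom rep_id_hom,
    auto simp: rep_hom_def rep_comp_def rep_id_def compose_def restrict_def PiE_def extensional_def
      fun_eq_iff Pi_iff)

text \<open>A set-theoretic inverse of a module homomorphism is automatically a homomorphism, so
  inverses need only be given as functions between the carriers.\<close>

lemma rep_isoI:
  fixes M N :: "('h, ('r, 'u) elt) module"
  assumes M: "left_module H M" and N: "left_module H N" and f: "f \<in> rep_hom H M N"
    and g: "\<And>y. y \<in> carrier N \<Longrightarrow> g y \<in> carrier M"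
    and gf: "\<And>x. x \<in> carrier M \<Longrightarrow> g (f x) = x" and fg: "\<And>y. y \<in> carrier N \<Longrightarrow> f (g y) = y"
  shows "f \<in> category.Iso (rep_hom H) rep_id rep_comp M N"
proof -
  interpret M: left_module H M by fact
  interpret N: left_module H N by fact
  interpret category "rep_obj H :: ('h, ('r, 'u) elt) module set" "rep_hom H" rep_id rep_comp
    by (rule category_rep)
  have f': "f (x \<oplus>\<^bsub>M\<^esub> y) = f x \<oplus>\<^bsub>N\<^esub> f y" if "x \<in> carrier M" "y \<in> carrier M" for x y
    using additive_maps_add[OF rep_hom_additive[OF f] that] .
  \<comment> \<open>By linearity \<open>f\<close> sends the sum of \<open>g x\<close> and
    \<open>g y\<close> to the sum of \<open>x\<close> and \<open>y\<close>; applying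
    \<open>g\<close> recovers that sum. The action is treated in the same way.\<close>
  have "g (x \<oplus>\<^bsub>N\<^esub> y) = g x \<oplus>\<^bsub>M\<^esub> g y" if "x \<in> carrier N" "y \<in> carrier N" for x y
    using gf[of "g x \<oplus>\<^bsub>M\<^esub> g y"] f' g fg that by simp
  moreover have "g (h \<odot>\<^bsub>N\<^esub> x) = h \<odot>\<^bsub>M\<^esub> g x" if "h \<in> carrier H" "x \<in> carrier N" for h x
    using gf[of "h \<odot>\<^bsub>M\<^esub> g x"] rep_hom_linear[OF f, of h "g x"] M.act_closed g fg that by simp
  ultimately have "restrict g (carrier N) \<in> rep_hom H N M"
    using N g by (intro rep_hom_restrictI additive_mapsI)
  moreover have "rep_comp M N M (restrict g (carrier N)) f = rep_id M"
    "rep_comp N M N f (restrict g (carrier N)) = rep_id N"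
    using gf fg rep_hom_closed[OF f] by (auto simp: rep_comp_def rep_id_def compose_def)
  ultimately show ?thesis using f unfolding Iso_def by blast
qed

section \<open>Tensor products inside the universe\<close>

context hopf_algebroid
begin

abbreviation tens :: "('h, ('r, 'u) elt) module \<Rightarrow> ('h, ('r, 'u) elt) module \<Rightarrow> ('h, ('r, 'u) elt) module"
  where "tens \<equiv> rep_tensor R \<alpha> \<beta> \<Delta>"

abbreviation rpure :: "('h, ('r, 'u) elt) module \<Rightarrow> ('h, ('r, 'u) elt) module
    \<Rightarrow> ('r, 'u) elt \<Rightarrow> ('r, 'u) elt \<Rightarrow> ('r, 'u) elt"
  where "rpure \<equiv> rep_pure R \<alpha> \<beta>"

abbreviation rdec :: "('h, ('r, 'u) elt) module \<Rightarrow> ('h, ('r, 'u) elt) module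
    \<Rightarrow> ('r, 'u) elt \<Rightarrow> (('r, 'u) elt \<times> ('r, 'u) elt \<Rightarrow>\<^sub>0 int) set"
  where "rdec \<equiv> rep_decode R \<alpha> \<beta>"

context
  fixes M N :: "('h, ('r, 'u) elt) module"
  assumes M: "left_module H M" and N: "left_module H N"
begin

interpretation M: left_module H M by (rule M)
interpretation N: left_module H N by (rule N)
interpretation MN: tensor_pair R "bim M" "bim N" by (rule tensor_pair_modules[OF M N])

lemma inj_encode: "inj_on encode (carrier (tensor_module R \<alpha> \<beta> \<Delta> M N))"
  using inj_on_encode[OF MN.tensor_pair_axioms] by simp

lemma left_module_rep_tensor: "left_module H (tens M N)"
  unfolding rep_tensor_def by (intro left_module_transport inj_encode left_module_tensor_module M N)

lemma encode_additive: "encode \<in> additive_maps MN.T (tens M N)"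
  using transport_module_additive[OF inj_encode] by (simp add: rep_tensor_def)

lemma carrier_rep_tensor: "carrier (tens M N) = encode ` carrier MN.T"
  using transport_module_simps(1)[OF inj_encode] by (simp add: rep_tensor_def)

lemma rdec_additive: "rdec M N \<in> additive_maps (tens M N) MN.T"
  using transport_module_additive_inv[OF inj_encode left_module_abelian_group[OF left_module_tensor_module[OF M N]]]
  by (simp add: rep_tensor_def rep_decode_def)

lemma rdec_encode: "X \<in> carrier MN.T \<Longrightarrow> rdec M N (encode X) = X"
  using inj_encode by (simp add: rep_decode_def)

lemma rpure_balanced: "balanced R (bim M) (bim N) (tens M N) (rpure M N)"
  using balanced_comp[OF MN.pure_balanced encode_additive] by (simp add: rep_pure_def[abs_def])

lemma rpure_closed:
  "\<lbrakk>m \<in> carrier M; n \<in> carrier N\<rbrakk> \<Longrightarrow> rpure M N m n \<in> carrier (tens M N)"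
  using balanced_closed[OF rpure_balanced] by simp

lemma rdec_rpure: "\<lbrakk>m \<in> carrier M; n \<in> carrier N\<rbrakk> \<Longrightarrow> rdec M N (rpure M N m n) = MN.pure m n"
  by (simp add: rep_pure_def rdec_encode)

text \<open>Each element is the code of a coset, and composing with \<open>encode\<close> reduces
  the claim to \<open>tensor_ext\<close>. From here on arguments need only \<open>rpure\<close> and
  not the underlying cosets.\<close>

lemma rep_tensor_ext:
  assumes "abelian_group G" and f: "f \<in> additive_maps (tens M N) G" and g: "g \<in> additive_maps (tens M N) G"
    and eq: "\<And>m n. \<lbrakk>m \<in> carrier M; n \<in> carrier N\<rbrakk> \<Longrightarrow> f (rpure M N m n) = g (rpure M N m n)"
    and t: "t \<in> carrier (tens M N)"
  shows "f t = g t"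
proof -
  obtain X where X: "X \<in> carrier MN.T" "t = encode X" using t carrier_rep_tensor by auto
  have "f (encode X) = g (encode X)"
    using eq by (intro MN.tensor_ext[OF assms(1) additive_maps_comp[OF encode_additive f]
        additive_maps_comp[OF encode_additive g] _ X(1)]) (simp add: rep_pure_def)
  then show ?thesis by (simp add: X(2))
qed

context
  fixes G :: "('g, 'd) ring_scheme" and f
  assumes G: "abelian_group G" and f: "balanced R (bim M) (bim N) G f"
begin

text \<open>The pattern for all structure maps: decode an element to its coset, then apply the
  induced map.\<close>

lemma rep_lift_additive: "(\<lambda>t. tensor_lift G f (rdec M N t)) \<in> additive_maps (tens M N) G"
  using additive_maps_comp[OF rdec_additive MN.tensor_lift_additive[OF G f]] .

lemma rep_lift_rpure:
  "\<lbrakk>m \<in> carrier M; n \<in> carrier N\<rbrakk> \<Longrightarrow> tensor_lift G f (rdec M N (rpure M N m n)) = f m n"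
  by (simp add: rdec_rpure MN.tensor_lift_pure[OF G f])

end

lemma smult_encode:
  assumes "X \<in> carrier MN.T"
  shows "h \<odot>\<^bsub>tens M N\<^esub> encode X = encode (h \<odot>\<^bsub>tensor_module R \<alpha> \<beta> \<Delta> M N\<^esub> X)"
  using transport_module_simps(4)[OF inj_encode] assms by (simp add: rep_tensor_def)

text \<open>With \<open>\<phi>\<close> the identity this describes the action itself.\<close>

lemma additive_smult_rpure:
  assumes G: "abelian_group G" and \<phi>: "\<phi> \<in> additive_maps (tens M N) G"
    and h: "h \<in> carrier H" and m: "m \<in> carrier M" and n: "n \<in> carrier N"
  shows "\<phi> (h \<odot>\<^bsub>tens M N\<^esub> rpure M N m n) =
      tensor_lift G (\<lambda>x y. \<phi> (rpure M N (x \<odot>\<^bsub>M\<^esub> m) (y \<odot>\<^bsub>N\<^esub> n))) (\<Delta> h)"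
proof -
  note ab = MN.T.abelian_group_axioms
  have "h \<odot>\<^bsub>tens M N\<^esub> rpure M N m n = encode (pair_act M N (\<Delta> h) m n)"
    using m n MN.tensor_lift_pure[OF ab pair_act_comult_balanced[OF M N h]]
    by (simp add: rep_pure_def smult_encode smult_tensor_module)
  then have "\<phi> (h \<odot>\<^bsub>tens M N\<^esub> rpure M N m n) =
      \<phi> (encode (tensor_lift MN.T (\<lambda>x y. MN.pure (x \<odot>\<^bsub>M\<^esub> m) (y \<odot>\<^bsub>N\<^esub> n)) (\<Delta> h)))"
    by (simp add: pair_act_def)
  also have "\<dots> = tensor_lift G (\<lambda>x y. \<phi> (encode (MN.pure (x \<odot>\<^bsub>M\<^esub> m) (y \<odot>\<^bsub>N\<^esub> n)))) (\<Delta> h)"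
    by (rule HH.tensor_lift_comp[OF ab G pair_act_balanced[OF M N m n]
          additive_maps_comp[OF encode_additive \<phi>] comult_closed[OF h]])
  finally show ?thesis by (simp add: rep_pure_def)
qed

lemma rpure_act_balanced:
  assumes "m \<in> carrier M" "n \<in> carrier N"
  shows "balanced R HB HB (tens M N) (\<lambda>x y. rpure M N (x \<odot>\<^bsub>M\<^esub> m) (y \<odot>\<^bsub>N\<^esub> n))"
  using balanced_comp[OF pair_act_balanced[OF M N assms] encode_additive] by (simp add: rep_pure_def)

lemma rpure_add_left:
  "n \<in> carrier N \<Longrightarrow> (\<lambda>m. rpure M N m n) \<in> additive_maps M (tens M N)"
  and rpure_add_right:
  "m \<in> carrier M \<Longrightarrow> rpure M N m \<in> additive_maps N (tens M N)"
  using balanced_left[OF rpure_balanced] balanced_right[OF rpure_balanced] by simp_all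

lemma rpure_act:
  "\<lbrakk>m \<in> carrier M; a \<in> carrier R; n \<in> carrier N\<rbrakk> \<Longrightarrow>
    rpure M N (\<beta> a \<odot>\<^bsub>M\<^esub> m) n = rpure M N m (\<alpha> a \<odot>\<^bsub>N\<^esub> n)"
  using balanced_act[OF rpure_balanced] by simp

text \<open>These rules say which factor \<alpha>(a) and \<beta>(a) reach in a product. In iterated
  products they are combined with \<open>rpure_act\<close>, which moves a scalar across a tensor
  sign.\<close>

lemma source_smult_rpure:
  "\<lbrakk>a \<in> carrier R; m \<in> carrier M; n \<in> carrier N\<rbrakk> \<Longrightarrow>
    \<alpha> a \<odot>\<^bsub>tens M N\<^esub> rpure M N m n = rpure M N (\<alpha> a \<odot>\<^bsub>M\<^esub> m) n"
  and target_smult_rpure: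
  "\<lbrakk>a \<in> carrier R; m \<in> carrier M; n \<in> carrier N\<rbrakk> \<Longrightarrow>
    \<beta> a \<odot>\<^bsub>tens M N\<^esub> rpure M N m n = rpure M N m (\<beta> a \<odot>\<^bsub>N\<^esub> n)"
  by (simp_all add: rep_pure_def smult_encode lact_tensor_module_pure[OF M N])

end

text \<open>Fixing the last factor leaves a map additive in the inner tensor, so extensionality
  applies twice. The variants below adapt this to the other bracketing and to four factors.\<close>

lemma rep_tensor_ext_left:
  assumes M: "left_module H L" "left_module H M" "left_module H N" and G: "abelian_group G"
    and f: "f \<in> additive_maps (tens (tens L M) N) G" and g: "g \<in> additive_maps (tens (tens L M) N) G"
    and eq: "\<And>l m n. \<lbrakk>l \<in> carrier L; m \<in> carrier M; n \<in> carrier N\<rbrakk> \<Longrightarrow>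
      f (rpure (tens L M) N (rpure L M l m) n) = g (rpure (tens L M) N (rpure L M l m) n)"
    and t: "t \<in> carrier (tens (tens L M) N)"
  shows "f t = g t"
proof (rule rep_tensor_ext[OF _ M(3) G f g _ t])
  show LM: "left_module H (tens L M)" by (rule left_module_rep_tensor[OF M(1,2)])
  fix u n assume u: "u \<in> carrier (tens L M)" and n: "n \<in> carrier N"
  note p = rpure_add_left[OF LM M(3) n]
  show "f (rpure (tens L M) N u n) = g (rpure (tens L M) N u n)"
    using eq n by (intro rep_tensor_ext[OF M(1,2) G additive_maps_comp[OF p f]
          additive_maps_comp[OF p g] _ u])
qed

lemma rep_tensor_ext_right:
  assumes M: "left_module H L" "left_module H M" "left_module H N" and G: "abelian_group G"
    and f: "f \<in> additive_maps (tens L (tens M N)) G" and g: "g \<in> additive_maps (tens L (tens M N)) G"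
    and eq: "\<And>l m n. \<lbrakk>l \<in> carrier L; m \<in> carrier M; n \<in> carrier N\<rbrakk> \<Longrightarrow>
      f (rpure L (tens M N) l (rpure M N m n)) = g (rpure L (tens M N) l (rpure M N m n))"
    and t: "t \<in> carrier (tens L (tens M N))"
  shows "f t = g t"
proof (rule rep_tensor_ext[OF M(1) _ G f g _ t])
  show MN: "left_module H (tens M N)" by (rule left_module_rep_tensor[OF M(2,3)])
  fix l v assume l: "l \<in> carrier L" and v: "v \<in> carrier (tens M N)"
  note p = rpure_add_right[OF M(1) MN l]
  show "f (rpure L (tens M N) l v) = g (rpure L (tens M N) l v)"
    using eq l by (intro rep_tensor_ext[OF M(2,3) G additive_maps_comp[OF p f]
          additive_maps_comp[OF p g] _ v])
qed

lemma rep_tensor_ext_left4: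
  assumes M: "left_module H L" "left_module H M" "left_module H N" "left_module H P"
    and G: "abelian_group G"
    and f: "f \<in> additive_maps (tens (tens (tens L M) N) P) G"
    and g: "g \<in> additive_maps (tens (tens (tens L M) N) P) G"
    and eq: "\<And>l m n p. \<lbrakk>l \<in> carrier L; m \<in> carrier M; n \<in> carrier N; p \<in> carrier P\<rbrakk> \<Longrightarrow>
      f (rpure (tens (tens L M) N) P (rpure (tens L M) N (rpure L M l m) n) p) =
      g (rpure (tens (tens L M) N) P (rpure (tens L M) N (rpure L M l m) n) p)"
    and t: "t \<in> carrier (tens (tens (tens L M) N) P)"
  shows "f t = g t"
proof (rule rep_tensor_ext[OF _ M(4) G f g _ t])
  show LMN: "left_module H (tens (tens L M) N)" by (intro left_module_rep_tensor M)
  fix u p assume u: "u \<in> carrier (tens (tens L M) N)" and p: "p \<in> carrier P"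
  note q = rpure_add_left[OF LMN M(4) p]
  show "f (rpure (tens (tens L M) N) P u p) = g (rpure (tens (tens L M) N) P u p)"
    using eq p by (intro rep_tensor_ext_left[OF M(1-3) G additive_maps_comp[OF q f]
          additive_maps_comp[OF q g] _ u])
qed

text \<open>Linearity is a comparison of Sweedler sums: expand the action on a pure tensor, pass
  \<open>f\<close> and \<open>g\<close> through the two component actions, and fold the sum back on
  the target side.\<close>

lemma rep_tensor_map:
  assumes M: "left_module H M" "left_module H M'" and N: "left_module H N" "left_module H N'"
    and f: "f \<in> rep_hom H M M'" and g: "g \<in> rep_hom H N N'"
  shows rep_tensor_map_hom:
      "rep_tensor_map R \<alpha> \<beta> \<Delta> M M' N N' f g \<in> rep_hom H (tens M N) (tens M' N')"
    and rep_tensor_map_rpure: "\<lbrakk>m \<in> carrier M; n \<in> carrier N\<rbrakk> \<Longrightarrow>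
      rep_tensor_map R \<alpha> \<beta> \<Delta> M M' N N' f g (rpure M N m n) = rpure M' N' (f m) (g n)"
proof -
  let ?MN' = "tensor_group R (bim M') (bim N')"
  interpret MN': tensor_pair R "bim M'" "bim N'" by (rule tensor_pair_modules[OF M(2) N(2)])
  note MN = left_module_rep_tensor[OF M(1) N(1)] and MN' = left_module_rep_tensor[OF M(2) N(2)]
  note ab = MN'.T.abelian_group_axioms and ab' = left_module_abelian_group[OF MN']
  define \<phi> where "\<phi> t = encode (tensor_lift ?MN' (\<lambda>m n. MN'.pure (f m) (g n)) (rdec M N t))" for t
  have bal: "balanced R (bim M) (bim N) ?MN' (\<lambda>m n. MN'.pure (f m) (g n))"
  proof (rule balancedI)
    show "(\<lambda>m. MN'.pure (f m) (g n)) \<in> additive_maps (bim M) ?MN'" if "n \<in> carrier (bim N)" for n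
      using additive_maps_comp[OF rep_hom_additive[OF f]] balanced_left[OF MN'.pure_balanced, of "g n"]
        rep_hom_closed[OF g] that by simp
    show "(\<lambda>n. MN'.pure (f m) (g n)) \<in> additive_maps (bim N) ?MN'" if "m \<in> carrier (bim M)" for m
      using additive_maps_comp[OF rep_hom_additive[OF g]] balanced_right[OF MN'.pure_balanced, of "f m"]
        rep_hom_closed[OF f] that by simp
    \<comment> \<open>Linearity over H at \<beta>(a) and at \<alpha>(a) makes \<open>f\<close> and
      \<open>g\<close> compatible with the R-actions, which is what balancedness requires.\<close>
    show "MN'.pure (f (ract (bim M) m a)) (g n) = MN'.pure (f m) (g (lact (bim N) a n))"
      if "m \<in> carrier (bim M)" "a \<in> carrier R" "n \<in> carrier (bim N)" for m a n
      using that balanced_act[OF MN'.pure_balanced, of "f m" a "g n"]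
      by (simp add: rep_hom_linear[OF f] rep_hom_linear[OF g] rep_hom_closed[OF f] rep_hom_closed[OF g])
  qed
  have \<phi>: "\<phi> \<in> additive_maps (tens M N) (tens M' N')"
    unfolding \<phi>_def
    by (rule additive_maps_comp[OF rep_lift_additive[OF M(1) N(1) ab bal] encode_additive[OF M(2) N(2)]])
  have \<phi>_rpure: "\<phi> (rpure M N m n) = rpure M' N' (f m) (g n)"
    if "m \<in> carrier M" "n \<in> carrier N" for m n
    using that by (simp add: \<phi>_def rep_lift_rpure[OF M(1) N(1) ab bal]) (simp add: rep_pure_def)
  have eq: "rep_tensor_map R \<alpha> \<beta> \<Delta> M M' N N' f g = restrict \<phi> (carrier (tens M N))"
    by (simp add: rep_tensor_map_def \<phi>_def tensor_map_def restrict_def fun_eq_iff)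
  show "rep_tensor_map R \<alpha> \<beta> \<Delta> M M' N N' f g (rpure M N m n) = rpure M' N' (f m) (g n)"
    if "m \<in> carrier M" "n \<in> carrier N" for m n
    using that by (simp add: eq \<phi>_rpure rpure_closed[OF M(1) N(1)])
  show "rep_tensor_map R \<alpha> \<beta> \<Delta> M M' N N' f g \<in> rep_hom H (tens M N) (tens M' N')"
    unfolding eq
  proof (rule rep_hom_restrictI[OF MN \<phi>])
    fix h t assume h: "h \<in> carrier H" and t: "t \<in> carrier (tens M N)"
    show "\<phi> (h \<odot>\<^bsub>tens M N\<^esub> t) = h \<odot>\<^bsub>tens M' N'\<^esub> \<phi> t"
    proof (rule rep_tensor_ext[OF M(1) N(1) ab' additive_maps_comp[OF left_module_additive_act[OF MN h] \<phi>]
          additive_maps_comp[OF \<phi> left_module_additive_act[OF MN' h]] _ t])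
      fix m n assume m: "m \<in> carrier M" and n: "n \<in> carrier N"
      then have fm: "f m \<in> carrier M'" and gn: "g n \<in> carrier N'"
        using rep_hom_closed[OF f] rep_hom_closed[OF g] by auto
      have "\<phi> (h \<odot>\<^bsub>tens M N\<^esub> rpure M N m n) =
          tensor_lift (tens M' N') (\<lambda>x y. \<phi> (rpure M N (x \<odot>\<^bsub>M\<^esub> m) (y \<odot>\<^bsub>N\<^esub> n))) (\<Delta> h)"
        by (rule additive_smult_rpure[OF M(1) N(1) ab' \<phi> h m n])
      also have "\<dots> = tensor_lift (tens M' N')
          (\<lambda>x y. rpure M' N' (x \<odot>\<^bsub>M'\<^esub> f m) (y \<odot>\<^bsub>N'\<^esub> g n)) (\<Delta> h)"
        using m n
        by (intro HH.tensor_lift_cong[OF ab' balanced_comp[OF rpure_act_balanced[OF M(1) N(1) m n] \<phi>]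
              comult_closed[OF h]])
          (simp add: \<phi>_rpure left_module.act_closed[OF M(1)] left_module.act_closed[OF N(1)]
            rep_hom_linear[OF f] rep_hom_linear[OF g])
      also have "\<dots> = h \<odot>\<^bsub>tens M' N'\<^esub> \<phi> (rpure M N m n)"
        using additive_smult_rpure[OF M(2) N(2) ab' additive_maps_id h fm gn] m n by (simp add: \<phi>_rpure)
      finally show "\<phi> (h \<odot>\<^bsub>tens M N\<^esub> rpure M N m n) = h \<odot>\<^bsub>tens M' N'\<^esub> \<phi> (rpure M N m n)" .
    qed
  qed
qed

end

section \<open>The associator\<close>

context hopf_algebroid
begin

context
  fixes L M N :: "('h, ('r, 'u) elt) module"
  assumes L: "left_module H L" and M: "left_module H M" and N: "left_module H N"
begin

interpretation L: left_module H L by (rule L)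
interpretation M: left_module H M by (rule M)
interpretation N: left_module H N by (rule N)

abbreviation (input) LM where "LM \<equiv> tens L M"
abbreviation (input) MN where "MN \<equiv> tens M N"
abbreviation (input) LM_N where "LM_N \<equiv> tens LM N"
abbreviation (input) L_MN where "L_MN \<equiv> tens L MN"

interpretation LM: left_module H LM by (rule left_module_rep_tensor[OF L M])
interpretation MN: left_module H MN by (rule left_module_rep_tensor[OF M N])
interpretation LM_N: left_module H LM_N
  by (rule left_module_rep_tensor[OF LM.left_module_axioms N])
interpretation L_MN: left_module H L_MN
  by (rule left_module_rep_tensor[OF L MN.left_module_axioms])
interpretation LMt: tensor_pair R "bim L" "bim M" by (rule tensor_pair_modules[OF L M])
interpretation MNt: tensor_pair R "bim M" "bim N" by (rule tensor_pair_modules[OF M N])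

lemmas lm_LM = LM.left_module_axioms and lm_MN = MN.left_module_axioms
lemmas ab_LM_N = LM_N.abelian_group_axioms and ab_L_MN = L_MN.abelian_group_axioms

text \<open>In L \<otimes> (M \<otimes> N) the scalar leaves \<open>l\<close> as \<alpha>(a) acting
  on m \<otimes> n, and \<Delta>(\<alpha>(a)) = \<alpha>(a) \<otimes> 1 puts it on
  \<open>m\<close>.\<close>

lemma assoc_inner_balanced:
  assumes n: "n \<in> carrier N"
  shows "balanced R (bim L) (bim M) L_MN (\<lambda>l m. rpure L MN l (rpure M N m n))"
proof (rule balancedI)
  show "(\<lambda>l. rpure L MN l (rpure M N m n)) \<in> additive_maps (bim L) L_MN" if "m \<in> carrier (bim M)" for m
    using that n rpure_add_left[OF L lm_MN] rpure_closed[OF M N] by simp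
  show "(\<lambda>m. rpure L MN l (rpure M N m n)) \<in> additive_maps (bim M) L_MN" if "l \<in> carrier (bim L)" for l
    using additive_maps_comp[OF rpure_add_left[OF M N n] rpure_add_right[OF L lm_MN]] that by simp
  show "rpure L MN (ract (bim L) l a) (rpure M N m n) = rpure L MN l (rpure M N (lact (bim M) a m) n)"
    if "l \<in> carrier (bim L)" "a \<in> carrier R" "m \<in> carrier (bim M)" for l a m
    using that n rpure_act[OF L lm_MN] source_smult_rpure[OF M N] rpure_closed[OF M N] by simp
qed

text \<open>For u = l \<otimes> m the element \<beta>(a) acts on \<open>m\<close>, since
  \<Delta>(\<beta>(a)) = 1 \<otimes> \<beta>(a); the relation of M \<otimes> N then moves it to
  \<open>n\<close>. General \<open>u\<close> follows because both sides are additive in it.\<close>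

lemma assoc_outer_balanced:
  "balanced R (bim LM) (bim N) L_MN
    (\<lambda>u n. tensor_lift L_MN (\<lambda>l m. rpure L MN l (rpure M N m n)) (rdec L M u))"
proof (rule balancedI)
  let ?f = "\<lambda>n l m. rpure L MN l (rpure M N m n)"
  note bal = assoc_inner_balanced
  show "(\<lambda>u. tensor_lift L_MN (?f n) (rdec L M u)) \<in> additive_maps (bim LM) L_MN"
    if "n \<in> carrier (bim N)" for n
    using that rep_lift_additive[OF L M ab_L_MN bal] by simp
  show "(\<lambda>n. tensor_lift L_MN (?f n) (rdec L M u)) \<in> additive_maps (bim N) L_MN"
    if u: "u \<in> carrier (bim LM)" for u
    unfolding additive_maps_module_bimodule
  proof (rule LMt.tensor_lift_additive_param[OF ab_L_MN _ N.abelian_group_axioms bal])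
    show "rdec L M u \<in> carrier LMt.T"
      using u additive_maps_closed[OF rdec_additive[OF L M]] by simp
    show "(\<lambda>n. ?f n l m) \<in> additive_maps N L_MN" if "l \<in> carrier (bim L)" "m \<in> carrier (bim M)" for l m
      using additive_maps_comp[OF rpure_add_right[OF M N] rpure_add_right[OF L lm_MN]] that by simp
  qed
  show "tensor_lift L_MN (?f n) (rdec L M (ract (bim LM) u a)) =
      tensor_lift L_MN (?f (lact (bim N) a n)) (rdec L M u)"
    if u: "u \<in> carrier (bim LM)" and a: "a \<in> carrier R" and n: "n \<in> carrier (bim N)" for u a n
  proof -
    have n': "n \<in> carrier N" "\<alpha> a \<odot>\<^bsub>N\<^esub> n \<in> carrier N" using n a by (simp_all add: N.act_closed)
    have "tensor_lift L_MN (?f n) (rdec L M (\<beta> a \<odot>\<^bsub>LM\<^esub> u)) =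
        tensor_lift L_MN (?f (\<alpha> a \<odot>\<^bsub>N\<^esub> n)) (rdec L M u)"
    proof (rule rep_tensor_ext[OF L M ab_L_MN
          additive_maps_comp[OF left_module_additive_act[OF lm_LM target_closed[OF a]]
            rep_lift_additive[OF L M ab_L_MN bal[OF n'(1)]]]
          rep_lift_additive[OF L M ab_L_MN bal[OF n'(2)]]])
      fix l m assume lm: "l \<in> carrier L" "m \<in> carrier M"
      then show "tensor_lift L_MN (?f n) (rdec L M (\<beta> a \<odot>\<^bsub>LM\<^esub> rpure L M l m)) =
          tensor_lift L_MN (?f (\<alpha> a \<odot>\<^bsub>N\<^esub> n)) (rdec L M (rpure L M l m))"
        using a n' rep_lift_rpure[OF L M ab_L_MN bal[OF n'(1)], of l "\<beta> a \<odot>\<^bsub>M\<^esub> m"]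
          rep_lift_rpure[OF L M ab_L_MN bal[OF n'(2)] lm] rpure_act[OF M N]
        by (simp add: target_smult_rpure[OF L M] M.act_closed)
    qed (use u in simp)
    then show ?thesis by simp
  qed
qed

lemma rep_assoc_eq:
  "rep_assoc R \<alpha> \<beta> \<Delta> L M N = restrict (\<lambda>t. tensor_lift L_MN
    (\<lambda>u n. tensor_lift L_MN (\<lambda>l m. rpure L MN l (rpure M N m n)) (rdec L M u)) (rdec LM N t))
    (carrier LM_N)"
  by (simp add: rep_assoc_def Let_def)

lemma rep_assoc_additive: "rep_assoc R \<alpha> \<beta> \<Delta> L M N \<in> additive_maps LM_N L_MN"
  unfolding rep_assoc_eq
  by (rule additive_maps_restrict[OF rep_lift_additive[OF lm_LM N ab_L_MN assoc_outer_balanced] ab_LM_N])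

lemma rep_assoc_rpure:
  assumes "l \<in> carrier L" "m \<in> carrier M" "n \<in> carrier N"
  shows "rep_assoc R \<alpha> \<beta> \<Delta> L M N (rpure LM N (rpure L M l m) n) = rpure L MN l (rpure M N m n)"
  using assms rep_lift_rpure[OF lm_LM N ab_L_MN assoc_outer_balanced, of "rpure L M l m" n]
    rep_lift_rpure[OF L M ab_L_MN assoc_inner_balanced]
  by (simp add: rep_assoc_eq rpure_closed[OF L M] rpure_closed[OF lm_LM N])

text \<open>Acting by \<open>h\<close> before the associator gives a sum over \<Delta>(h) with
  \<Delta> applied again to its first component; acting afterwards gives one with \<Delta> applied
  to the second. Both have summand \<open>?F\<close>, to which \<open>coassoc_trilinear\<close>
  applies.\<close>

lemma rep_assoc_hom: "rep_assoc R \<alpha> \<beta> \<Delta> L M N \<in> rep_hom H LM_N L_MN"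
proof -
  let ?a = "rep_assoc R \<alpha> \<beta> \<Delta> L M N"
  have "?a (h \<odot>\<^bsub>LM_N\<^esub> t) = h \<odot>\<^bsub>L_MN\<^esub> ?a t" if h: "h \<in> carrier H" and t: "t \<in> carrier LM_N" for h t
  proof (rule rep_tensor_ext_left[OF L M N ab_L_MN
        additive_maps_comp[OF left_module_additive_act[OF LM_N.left_module_axioms h] rep_assoc_additive]
        additive_maps_comp[OF rep_assoc_additive left_module_additive_act[OF L_MN.left_module_axioms h]] _ t])
    fix l m n assume l: "l \<in> carrier L" and m: "m \<in> carrier M" and n: "n \<in> carrier N"
    let ?F = "\<lambda>x y z. rpure L MN (x \<odot>\<^bsub>L\<^esub> l) (rpure M N (y \<odot>\<^bsub>M\<^esub> m) (z \<odot>\<^bsub>N\<^esub> n))"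
    have lm: "rpure L M l m \<in> carrier LM" and mn: "rpure M N m n \<in> carrier MN"
      using l m n by (simp_all add: rpure_closed[OF L M] rpure_closed[OF M N])
    have "?a (h \<odot>\<^bsub>LM_N\<^esub> rpure LM N (rpure L M l m) n) =
        tensor_lift L_MN (\<lambda>u z. ?a (rpure LM N (u \<odot>\<^bsub>LM\<^esub> rpure L M l m) (z \<odot>\<^bsub>N\<^esub> n))) (\<Delta> h)"
      by (rule additive_smult_rpure[OF lm_LM N ab_L_MN rep_assoc_additive h lm n])
    also have "\<dots> = tensor_lift L_MN (\<lambda>u z. tensor_lift L_MN (\<lambda>x y. ?F x y z) (\<Delta> u)) (\<Delta> h)"
    proof (rule HH.tensor_lift_cong[OF ab_L_MN
          balanced_comp[OF rpure_act_balanced[OF lm_LM N lm n] rep_assoc_additive] comult_closed[OF h]])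
      fix u z assume "u \<in> carrier HB" "z \<in> carrier HB"
      then have u: "u \<in> carrier H" and zn: "z \<odot>\<^bsub>N\<^esub> n \<in> carrier N" using n by (simp_all add: N.act_closed)
      note add = additive_maps_comp[OF rpure_add_left[OF lm_LM N zn] rep_assoc_additive]
      have "?a (rpure LM N (u \<odot>\<^bsub>LM\<^esub> rpure L M l m) (z \<odot>\<^bsub>N\<^esub> n)) = tensor_lift L_MN
          (\<lambda>x y. ?a (rpure LM N (rpure L M (x \<odot>\<^bsub>L\<^esub> l) (y \<odot>\<^bsub>M\<^esub> m)) (z \<odot>\<^bsub>N\<^esub> n))) (\<Delta> u)"
        by (rule additive_smult_rpure[OF L M ab_L_MN add u l m])
      also have "\<dots> = tensor_lift L_MN (\<lambda>x y. ?F x y z) (\<Delta> u)"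
        using l m zn
        by (intro HH.tensor_lift_cong[OF ab_L_MN balanced_comp[OF rpure_act_balanced[OF L M l m] add]
              comult_closed[OF u]]) (simp add: rep_assoc_rpure L.act_closed M.act_closed)
      finally show "?a (rpure LM N (u \<odot>\<^bsub>LM\<^esub> rpure L M l m) (z \<odot>\<^bsub>N\<^esub> n)) =
          tensor_lift L_MN (\<lambda>x y. ?F x y z) (\<Delta> u)" .
    qed
    \<comment> \<open>The balance conditions on \<open>?F\<close> are the relations at the two
      tensor signs; the first also uses that \<alpha>(a) acts on a product through its left
      factor.\<close>
    also have "\<dots> = tensor_lift L_MN (\<lambda>x v. tensor_lift L_MN (?F x) (\<Delta> v)) (\<Delta> h)"
    proof (rule coassoc_trilinear[OF ab_L_MN _ _ _ _ _ h])
      show "(\<lambda>x. ?F x y z) \<in> additive_maps H L_MN" if "y \<in> carrier H" "z \<in> carrier H" for y z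
        using that m n rpure_closed[OF M N] M.act_closed N.act_closed
        by (intro additive_maps_comp[OF left_module_additive_orbit[OF L l] rpure_add_left[OF L lm_MN]]) simp
      show "(\<lambda>y. ?F x y z) \<in> additive_maps H L_MN" if "x \<in> carrier H" "z \<in> carrier H" for x z
        using that l n L.act_closed N.act_closed
        by (intro additive_maps_comp[OF additive_maps_comp[OF left_module_additive_orbit[OF M m]
                rpure_add_left[OF M N]] rpure_add_right[OF L lm_MN]]) simp_all
      show "?F x y \<in> additive_maps H L_MN" if "x \<in> carrier H" "y \<in> carrier H" for x y
        using that l m L.act_closed M.act_closed
        by (intro additive_maps_comp[OF additive_maps_comp[OF left_module_additive_orbit[OF N n]
                rpure_add_right[OF M N]] rpure_add_right[OF L lm_MN]]) simp_all
      show "?F (\<beta> a \<otimes>\<^bsub>H\<^esub> x) y z = ?F x (\<alpha> a \<otimes>\<^bsub>H\<^esub> y) z"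
        if "a \<in> carrier R" "x \<in> carrier H" "y \<in> carrier H" "z \<in> carrier H" for a x y z
        using that l m n
        by (simp add: L.act_mult M.act_mult L.act_closed M.act_closed N.act_closed rpure_closed[OF M N]
            rpure_act[OF L lm_MN] source_smult_rpure[OF M N])
      show "?F x (\<beta> a \<otimes>\<^bsub>H\<^esub> y) z = ?F x y (\<alpha> a \<otimes>\<^bsub>H\<^esub> z)"
        if "a \<in> carrier R" "x \<in> carrier H" "y \<in> carrier H" "z \<in> carrier H" for a x y z
        using that m n
        by (simp add: M.act_mult N.act_mult M.act_closed N.act_closed rpure_act[OF M N])
    qed
    also have "\<dots> = tensor_lift L_MN (\<lambda>x v. rpure L MN (x \<odot>\<^bsub>L\<^esub> l) (v \<odot>\<^bsub>MN\<^esub> rpure M N m n)) (\<Delta> h)"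
    proof (rule HH.tensor_lift_cong[OF ab_L_MN rpure_act_balanced[OF L lm_MN l mn] comult_closed[OF h],
          symmetric])
      fix x v assume "x \<in> carrier HB" "v \<in> carrier HB"
      then have xl: "x \<odot>\<^bsub>L\<^esub> l \<in> carrier L" and v: "v \<in> carrier H" using l by (simp_all add: L.act_closed)
      show "rpure L MN (x \<odot>\<^bsub>L\<^esub> l) (v \<odot>\<^bsub>MN\<^esub> rpure M N m n) = tensor_lift L_MN (?F x) (\<Delta> v)"
        by (rule additive_smult_rpure[OF M N ab_L_MN rpure_add_right[OF L lm_MN xl] v m n])
    qed
    also have "\<dots> = h \<odot>\<^bsub>L_MN\<^esub> rpure L MN l (rpure M N m n)"
      by (rule additive_smult_rpure[OF L lm_MN ab_L_MN additive_maps_id h l mn, symmetric])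
    finally show "?a (h \<odot>\<^bsub>LM_N\<^esub> rpure LM N (rpure L M l m) n) =
        h \<odot>\<^bsub>L_MN\<^esub> ?a (rpure LM N (rpure L M l m) n)"
      using l m n by (simp add: rep_assoc_rpure)
  qed
  \<comment> \<open>The associator is already a restriction to this carrier, so restricting it once
    more leaves it unchanged.\<close>
  then show ?thesis
    using rep_hom_restrictI[OF LM_N.left_module_axioms rep_assoc_additive]
    by (simp add: rep_assoc_eq)
qed

section \<open>The inverse of the associator\<close>

lemma assoc_inv_inner_balanced:
  assumes l: "l \<in> carrier L"
  shows "balanced R (bim M) (bim N) LM_N (\<lambda>m n. rpure LM N (rpure L M l m) n)"
proof (rule balancedI)
  show "(\<lambda>n. rpure LM N (rpure L M l m) n) \<in> additive_maps (bim N) LM_N" if "m \<in> carrier (bim M)" for m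
    using that l rpure_add_right[OF lm_LM N] rpure_closed[OF L M] by simp
  show "(\<lambda>m. rpure LM N (rpure L M l m) n) \<in> additive_maps (bim M) LM_N" if "n \<in> carrier (bim N)" for n
    using additive_maps_comp[OF rpure_add_right[OF L M l] rpure_add_left[OF lm_LM N]] that by simp
  show "rpure LM N (rpure L M l (ract (bim M) m a)) n = rpure LM N (rpure L M l m) (lact (bim N) a n)"
    if "m \<in> carrier (bim M)" "a \<in> carrier R" "n \<in> carrier (bim N)" for m a n
    using that l rpure_act[OF lm_LM N] target_smult_rpure[OF L M, symmetric] rpure_closed[OF L M] by simp
qed

text \<open>The mirror image of \<open>assoc_outer_balanced\<close>: \<beta>(a) on \<open>l\<close>
  crosses to \<open>m\<close> as \<alpha>(a), which is also where \<alpha>(a) acts in m \<otimes>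
  n.\<close>

lemma assoc_inv_outer_balanced:
  "balanced R (bim L) (bim MN) LM_N
    (\<lambda>l v. tensor_lift LM_N (\<lambda>m n. rpure LM N (rpure L M l m) n) (rdec M N v))"
proof (rule balancedI)
  let ?f = "\<lambda>l m n. rpure LM N (rpure L M l m) n"
  note bal = assoc_inv_inner_balanced
  show "(\<lambda>v. tensor_lift LM_N (?f l) (rdec M N v)) \<in> additive_maps (bim MN) LM_N"
    if "l \<in> carrier (bim L)" for l
    using that rep_lift_additive[OF M N ab_LM_N bal] by simp
  show "(\<lambda>l. tensor_lift LM_N (?f l) (rdec M N v)) \<in> additive_maps (bim L) LM_N"
    if v: "v \<in> carrier (bim MN)" for v
    unfolding additive_maps_module_bimodule
  proof (rule MNt.tensor_lift_additive_param[OF ab_LM_N _ L.abelian_group_axioms bal])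
    show "rdec M N v \<in> carrier MNt.T"
      using v additive_maps_closed[OF rdec_additive[OF M N]] by simp
    show "(\<lambda>l. ?f l m n) \<in> additive_maps L LM_N" if "m \<in> carrier (bim M)" "n \<in> carrier (bim N)" for m n
      using additive_maps_comp[OF rpure_add_left[OF L M] rpure_add_left[OF lm_LM N]] that by simp
  qed
  show "tensor_lift LM_N (?f (ract (bim L) l a)) (rdec M N v) =
      tensor_lift LM_N (?f l) (rdec M N (lact (bim MN) a v))"
    if l: "l \<in> carrier (bim L)" and a: "a \<in> carrier R" and v: "v \<in> carrier (bim MN)" for l a v
  proof -
    have l': "l \<in> carrier L" "\<beta> a \<odot>\<^bsub>L\<^esub> l \<in> carrier L" using l a by (simp_all add: L.act_closed)
    have "tensor_lift LM_N (?f (\<beta> a \<odot>\<^bsub>L\<^esub> l)) (rdec M N v) =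
        tensor_lift LM_N (?f l) (rdec M N (\<alpha> a \<odot>\<^bsub>MN\<^esub> v))"
    proof (rule rep_tensor_ext[OF M N ab_LM_N
          rep_lift_additive[OF M N ab_LM_N bal[OF l'(2)]]
          additive_maps_comp[OF left_module_additive_act[OF lm_MN source_closed[OF a]]
            rep_lift_additive[OF M N ab_LM_N bal[OF l'(1)]]]])
      fix m n assume mn: "m \<in> carrier M" "n \<in> carrier N"
      then show "tensor_lift LM_N (?f (\<beta> a \<odot>\<^bsub>L\<^esub> l)) (rdec M N (rpure M N m n)) =
          tensor_lift LM_N (?f l) (rdec M N (\<alpha> a \<odot>\<^bsub>MN\<^esub> rpure M N m n))"
        using a l' rep_lift_rpure[OF M N ab_LM_N bal[OF l'(1)], of "\<alpha> a \<odot>\<^bsub>M\<^esub> m" n]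
          rep_lift_rpure[OF M N ab_LM_N bal[OF l'(2)] mn] rpure_act[OF L M]
        by (simp add: source_smult_rpure[OF M N] M.act_closed)
    qed (use v in simp)
    then show ?thesis by simp
  qed
qed

text \<open>The reverse map \<open>b\<close> is built merely as an additive map. On pure tensors it
  undoes the associator in both orders, and \<open>rep_isoI\<close> supplies its linearity.\<close>

lemma rep_assoc_iso:
  "rep_assoc R \<alpha> \<beta> \<Delta> L M N \<in> category.Iso (rep_hom H) rep_id rep_comp LM_N L_MN"
proof -
  let ?a = "rep_assoc R \<alpha> \<beta> \<Delta> L M N"
  define b where "b t = tensor_lift LM_N
    (\<lambda>l v. tensor_lift LM_N (\<lambda>m n. rpure LM N (rpure L M l m) n) (rdec M N v)) (rdec L MN t)" for t
  have b: "b \<in> additive_maps L_MN LM_N"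
    unfolding b_def by (rule rep_lift_additive[OF L lm_MN ab_LM_N assoc_inv_outer_balanced])
  have b_rpure: "b (rpure L MN l (rpure M N m n)) = rpure LM N (rpure L M l m) n"
    if "l \<in> carrier L" "m \<in> carrier M" "n \<in> carrier N" for l m n
    unfolding b_def
    using that rep_lift_rpure[OF L lm_MN ab_LM_N assoc_inv_outer_balanced, of l "rpure M N m n"]
      rep_lift_rpure[OF M N ab_LM_N assoc_inv_inner_balanced]
    by (simp add: rpure_closed[OF M N])
  show ?thesis
  proof (rule rep_isoI[OF LM_N.left_module_axioms L_MN.left_module_axioms rep_assoc_hom])
    show "b y \<in> carrier LM_N" if "y \<in> carrier L_MN" for y
      using additive_maps_closed[OF b that] .
    show "b (?a x) = x" if "x \<in> carrier LM_N" for x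
      by (rule rep_tensor_ext_left[OF L M N ab_LM_N additive_maps_comp[OF rep_assoc_additive b]
            additive_maps_id _ that]) (simp add: rep_assoc_rpure b_rpure)
    show "?a (b y) = y" if "y \<in> carrier L_MN" for y
      by (rule rep_tensor_ext_right[OF L M N ab_L_MN additive_maps_comp[OF b rep_assoc_additive]
            additive_maps_id _ that]) (simp add: rep_assoc_rpure b_rpure)
  qed
qed

end

end

section \<open>Naturality and coherence of the associator\<close>

context hopf_algebroid
begin

lemma rep_tensor_hom_eqI:
  assumes M: "left_module H M" "left_module H N" "left_module H P"
    and f: "f \<in> rep_hom H (tens M N) P" and g: "g \<in> rep_hom H (tens M N) P"
    and eq: "\<And>m n. \<lbrakk>m \<in> carrier M; n \<in> carrier N\<rbrakk> \<Longrightarrow> f (rpure M N m n) = g (rpure M N m n)"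
  shows "f = g"
proof (rule rep_hom_eqI[OF f g])
  show "f t = g t" if "t \<in> carrier (tens M N)" for t
    by (rule rep_tensor_ext[OF M(1,2) left_module_abelian_group[OF M(3)]
          rep_hom_additive[OF f] rep_hom_additive[OF g] _ that]) (rule eq)
qed

lemma rep_tensor_hom_eqI_left:
  assumes M: "left_module H L" "left_module H M" "left_module H N" "left_module H P"
    and f: "f \<in> rep_hom H (tens (tens L M) N) P" and g: "g \<in> rep_hom H (tens (tens L M) N) P"
    and eq: "\<And>l m n. \<lbrakk>l \<in> carrier L; m \<in> carrier M; n \<in> carrier N\<rbrakk> \<Longrightarrow>
      f (rpure (tens L M) N (rpure L M l m) n) = g (rpure (tens L M) N (rpure L M l m) n)"
  shows "f = g"
proof (rule rep_hom_eqI[OF f g])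
  show "f t = g t" if "t \<in> carrier (tens (tens L M) N)" for t
    by (rule rep_tensor_ext_left[OF M(1-3) left_module_abelian_group[OF M(4)]
          rep_hom_additive[OF f] rep_hom_additive[OF g] _ that]) (rule eq)
qed

lemma rep_tensor_hom_eqI_left4:
  assumes M: "left_module H L" "left_module H M" "left_module H N" "left_module H P" "left_module H Q"
    and f: "f \<in> rep_hom H (tens (tens (tens L M) N) P) Q"
    and g: "g \<in> rep_hom H (tens (tens (tens L M) N) P) Q"
    and eq: "\<And>l m n p. \<lbrakk>l \<in> carrier L; m \<in> carrier M; n \<in> carrier N; p \<in> carrier P\<rbrakk> \<Longrightarrow>
      f (rpure (tens (tens L M) N) P (rpure (tens L M) N (rpure L M l m) n) p) =
      g (rpure (tens (tens L M) N) P (rpure (tens L M) N (rpure L M l m) n) p)"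
  shows "f = g"
proof (rule rep_hom_eqI[OF f g])
  show "f t = g t" if "t \<in> carrier (tens (tens (tens L M) N) P)" for t
    by (rule rep_tensor_ext_left4[OF M(1-4) left_module_abelian_group[OF M(5)]
          rep_hom_additive[OF f] rep_hom_additive[OF g] _ that]) (rule eq)
qed

text \<open>\<open>rep_homs\<close> establishes that both sides of a coherence law are morphisms,
  and \<open>rep_eval\<close> computes them on pure tensors; with the extensionality rules above,
  such laws become rewriting problems.\<close>

lemmas rep_homs = rep_comp_hom rep_tensor_map_hom rep_id_hom rep_assoc_hom
lemmas rep_eval = rep_comp_apply rep_id_apply rep_tensor_map_rpure rep_assoc_rpure rpure_closed
  rep_hom_closed left_module_rep_tensor rep_homs

lemma rep_tensor_map_id:
  assumes "left_module H M" "left_module H N"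
  shows "rep_tensor_map R \<alpha> \<beta> \<Delta> M M N N (rep_id M) (rep_id N) = rep_id (tens M N)"
  using assms
  by (intro rep_tensor_hom_eqI[of M N "tens M N"] rep_homs left_module_rep_tensor)
    (simp_all add: rep_eval)

lemma rep_tensor_map_comp:
  assumes "left_module H M" "left_module H M'" "left_module H M''"
    and "left_module H N" "left_module H N'" "left_module H N''"
    and "f \<in> rep_hom H M M'" "f' \<in> rep_hom H M' M''" "g \<in> rep_hom H N N'" "g' \<in> rep_hom H N' N''"
  shows "rep_tensor_map R \<alpha> \<beta> \<Delta> M M'' N N'' (rep_comp M M' M'' f' f) (rep_comp N N' N'' g' g) =
    rep_comp (tens M N) (tens M' N') (tens M'' N'')
      (rep_tensor_map R \<alpha> \<beta> \<Delta> M' M'' N' N'' f' g') (rep_tensor_map R \<alpha> \<beta> \<Delta> M M' N N' f g)"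
proof (rule rep_tensor_hom_eqI[of M N "tens M'' N''"])
  fix m n assume "m \<in> carrier M" "n \<in> carrier N"
  then show "rep_tensor_map R \<alpha> \<beta> \<Delta> M M'' N N'' (rep_comp M M' M'' f' f) (rep_comp N N' N'' g' g)
      (rpure M N m n) =
    rep_comp (tens M N) (tens M' N') (tens M'' N'')
      (rep_tensor_map R \<alpha> \<beta> \<Delta> M' M'' N' N'' f' g') (rep_tensor_map R \<alpha> \<beta> \<Delta> M M' N N' f g)
      (rpure M N m n)"
    using assms rep_comp_hom[of H M f M' f' M''] rep_comp_hom[of H N g N' g' N'']
      rep_hom_closed[of f H M M' m] rep_hom_closed[of g H N N' n]
    by (simp add: rep_comp_apply rep_tensor_map_rpure rpure_closed)
qed (use assms in \<open>auto intro!: rep_homs left_module_rep_tensor intro: rep_comp_hom rep_tensor_map_hom\<close>)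

lemma rep_assoc_natural:
  assumes "left_module H L" "left_module H L'" "left_module H M" "left_module H M'"
    and "left_module H N" "left_module H N'"
    and f: "f \<in> rep_hom H L L'" and g: "g \<in> rep_hom H M M'" and h: "h \<in> rep_hom H N N'"
  shows "rep_comp (tens (tens L M) N) (tens (tens L' M') N') (tens L' (tens M' N'))
      (rep_assoc R \<alpha> \<beta> \<Delta> L' M' N') (rep_tensor_map R \<alpha> \<beta> \<Delta> (tens L M) (tens L' M') N N'
        (rep_tensor_map R \<alpha> \<beta> \<Delta> L L' M M' f g) h) =
    rep_comp (tens (tens L M) N) (tens L (tens M N)) (tens L' (tens M' N'))
      (rep_tensor_map R \<alpha> \<beta> \<Delta> L L' (tens M N) (tens M' N') f
        (rep_tensor_map R \<alpha> \<beta> \<Delta> M M' N N' g h)) (rep_assoc R \<alpha> \<beta> \<Delta> L M N)"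
proof (rule rep_tensor_hom_eqI_left[of L M N "tens L' (tens M' N')"])
  note fg = rep_tensor_map_hom[OF assms(1-4) f g] and gh = rep_tensor_map_hom[OF assms(3-6) g h]
  note lm = assms(1-6) left_module_rep_tensor
  show "rep_comp (tens (tens L M) N) (tens (tens L' M') N') (tens L' (tens M' N'))
      (rep_assoc R \<alpha> \<beta> \<Delta> L' M' N') (rep_tensor_map R \<alpha> \<beta> \<Delta> (tens L M) (tens L' M') N N'
        (rep_tensor_map R \<alpha> \<beta> \<Delta> L L' M M' f g) h) \<in> rep_hom H (tens (tens L M) N) (tens L' (tens M' N'))"
    by (intro rep_comp_hom[where B = "tens (tens L' M') N'"] rep_tensor_map_hom rep_assoc_hom lm f g h)
  show "rep_comp (tens (tens L M) N) (tens L (tens M N)) (tens L' (tens M' N'))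
      (rep_tensor_map R \<alpha> \<beta> \<Delta> L L' (tens M N) (tens M' N') f
        (rep_tensor_map R \<alpha> \<beta> \<Delta> M M' N N' g h)) (rep_assoc R \<alpha> \<beta> \<Delta> L M N)
      \<in> rep_hom H (tens (tens L M) N) (tens L' (tens M' N'))"
    by (intro rep_comp_hom[where B = "tens L (tens M N)"] rep_tensor_map_hom rep_assoc_hom lm f g h)
  fix l m n assume "l \<in> carrier L" "m \<in> carrier M" "n \<in> carrier N"
  then show "rep_comp (tens (tens L M) N) (tens (tens L' M') N') (tens L' (tens M' N'))
      (rep_assoc R \<alpha> \<beta> \<Delta> L' M' N') (rep_tensor_map R \<alpha> \<beta> \<Delta> (tens L M) (tens L' M') N N'
        (rep_tensor_map R \<alpha> \<beta> \<Delta> L L' M M' f g) h) (rpure (tens L M) N (rpure L M l m) n) =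
    rep_comp (tens (tens L M) N) (tens L (tens M N)) (tens L' (tens M' N'))
      (rep_tensor_map R \<alpha> \<beta> \<Delta> L L' (tens M N) (tens M' N') f
        (rep_tensor_map R \<alpha> \<beta> \<Delta> M M' N N' g h)) (rep_assoc R \<alpha> \<beta> \<Delta> L M N)
      (rpure (tens L M) N (rpure L M l m) n)"
    using assms fg gh
    by (simp add: rep_comp_apply rep_tensor_map_rpure rep_assoc_rpure rpure_closed
        left_module_rep_tensor rep_hom_closed[OF f] rep_hom_closed[OF g] rep_hom_closed[OF h])
qed (use assms in \<open>simp_all add: left_module_rep_tensor\<close>)

lemma rep_pentagon:
  assumes "left_module H A" "left_module H B" "left_module H C" "left_module H D"
  shows "rep_comp (tens (tens (tens A B) C) D) (tens (tens A B) (tens C D)) (tens A (tens B (tens C D)))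
      (rep_assoc R \<alpha> \<beta> \<Delta> A B (tens C D)) (rep_assoc R \<alpha> \<beta> \<Delta> (tens A B) C D) =
    rep_comp (tens (tens (tens A B) C) D) (tens A (tens (tens B C) D)) (tens A (tens B (tens C D)))
      (rep_tensor_map R \<alpha> \<beta> \<Delta> A A (tens (tens B C) D) (tens B (tens C D)) (rep_id A)
        (rep_assoc R \<alpha> \<beta> \<Delta> B C D))
      (rep_comp (tens (tens (tens A B) C) D) (tens (tens A (tens B C)) D) (tens A (tens (tens B C) D))
        (rep_assoc R \<alpha> \<beta> \<Delta> A (tens B C) D)
        (rep_tensor_map R \<alpha> \<beta> \<Delta> (tens (tens A B) C) (tens A (tens B C)) D D
          (rep_assoc R \<alpha> \<beta> \<Delta> A B C) (rep_id D)))"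
  using assms
  by (intro rep_tensor_hom_eqI_left4[of A B C D "tens A (tens B (tens C D))"] rep_homs
      left_module_rep_tensor) (simp_all add: rep_eval)

end

section \<open>The unit object\<close>

context anchored_hopf_algebroid
begin

lemma anchor_closed: "\<lbrakk>x \<in> carrier H; a \<in> carrier R\<rbrakk> \<Longrightarrow> \<mu> x a \<in> carrier R"
  and anchor_add_right: "\<lbrakk>x \<in> carrier H; a \<in> carrier R; b \<in> carrier R\<rbrakk> \<Longrightarrow>
    \<mu> x (a \<oplus>\<^bsub>R\<^esub> b) = \<mu> x a \<oplus>\<^bsub>R\<^esub> \<mu> x b"
  and anchor_add_left: "\<lbrakk>x \<in> carrier H; y \<in> carrier H; a \<in> carrier R\<rbrakk> \<Longrightarrow>
    \<mu> (x \<oplus>\<^bsub>H\<^esub> y) a = \<mu> x a \<oplus>\<^bsub>R\<^esub> \<mu> y a"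
  and anchor_mult: "\<lbrakk>x \<in> carrier H; y \<in> carrier H; a \<in> carrier R\<rbrakk> \<Longrightarrow>
    \<mu> (x \<otimes>\<^bsub>H\<^esub> y) a = \<mu> x (\<mu> y a)"
  and anchor_one: "a \<in> carrier R \<Longrightarrow> \<mu> \<one>\<^bsub>H\<^esub> a = a"
proof -
  have "\<mu> \<in> ring_hom H (End_algebra K R)"
    using anchor_algebra_hom by (simp add: algebra_hom_def)
  then have hom: "x \<in> carrier H \<Longrightarrow> \<mu> x \<in> carrier (End_algebra K R)"
      "\<lbrakk>x \<in> carrier H; y \<in> carrier H\<rbrakk> \<Longrightarrow> \<mu> (x \<oplus>\<^bsub>H\<^esub> y) = \<mu> x \<oplus>\<^bsub>End_algebra K R\<^esub> \<mu> y"
      "\<lbrakk>x \<in> carrier H; y \<in> carrier H\<rbrakk> \<Longrightarrow> \<mu> (x \<otimes>\<^bsub>H\<^esub> y) = \<mu> x \<otimes>\<^bsub>End_algebra K R\<^esub> \<mu> y"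
      "\<mu> \<one>\<^bsub>H\<^esub> = \<one>\<^bsub>End_algebra K R\<^esub>" for x y
    by (simp_all add: ring_hom_memE)
  have End: "\<mu> x \<in> carrier R \<rightarrow>\<^sub>E carrier R"
      "\<forall>a\<in>carrier R. \<forall>b\<in>carrier R. \<mu> x (a \<oplus>\<^bsub>R\<^esub> b) = \<mu> x a \<oplus>\<^bsub>R\<^esub> \<mu> x b"
    if "x \<in> carrier H" for x
    using hom(1)[OF that] by (simp_all add: End_algebra_def)
  show "\<mu> x a \<in> carrier R" if "x \<in> carrier H" "a \<in> carrier R" for x a
    using PiE_mem[OF End(1)] that by blast
  show "\<mu> x (a \<oplus>\<^bsub>R\<^esub> b) = \<mu> x a \<oplus>\<^bsub>R\<^esub> \<mu> x b"
    if "x \<in> carrier H" "a \<in> carrier R" "b \<in> carrier R" for x a b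
    using End(2) that by blast
  show "\<mu> (x \<oplus>\<^bsub>H\<^esub> y) a = \<mu> x a \<oplus>\<^bsub>R\<^esub> \<mu> y a"
    if "x \<in> carrier H" "y \<in> carrier H" "a \<in> carrier R" for x y a
    using that by (simp add: hom(2) End_algebra_def)
  show "\<mu> (x \<otimes>\<^bsub>H\<^esub> y) a = \<mu> x (\<mu> y a)"
    if "x \<in> carrier H" "y \<in> carrier H" "a \<in> carrier R" for x y a
    using that by (simp add: hom(3) End_algebra_def compose_def)
  show "\<mu> \<one>\<^bsub>H\<^esub> a = a" if "a \<in> carrier R" for a
    using that by (simp add: hom(4) End_algebra_def)
qed

text \<open>The bimodule condition on \<mu> is an equation between functions on R; here it is
  evaluated at a point.\<close>

lemma anchor_lact: "\<lbrakk>x \<in> carrier H; a \<in> carrier R; b \<in> carrier R\<rbrakk> \<Longrightarrow>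
    \<mu> (\<alpha> b \<otimes>\<^bsub>H\<^esub> x) a = b \<otimes>\<^bsub>R\<^esub> \<mu> x a"
  and anchor_ract: "\<lbrakk>x \<in> carrier H; a \<in> carrier R; b \<in> carrier R\<rbrakk> \<Longrightarrow>
    \<mu> (\<beta> b \<otimes>\<^bsub>H\<^esub> x) a = \<mu> x a \<otimes>\<^bsub>R\<^esub> b"
proof -
  have "\<mu> (\<alpha> b \<otimes>\<^bsub>H\<^esub> x) = lact (End_bimodule K R) b (\<mu> x)"
      "\<mu> (\<beta> b \<otimes>\<^bsub>H\<^esub> x) = ract (End_bimodule K R) (\<mu> x) b"
    if "x \<in> carrier H" "b \<in> carrier R" for x b
    using anchor_bimodule_hom that by (simp_all add: bimodule_hom_def total_bimodule_def)
  then show "\<mu> (\<alpha> b \<otimes>\<^bsub>H\<^esub> x) a = b \<otimes>\<^bsub>R\<^esub> \<mu> x a" "\<mu> (\<beta> b \<otimes>\<^bsub>H\<^esub> x) a = \<mu> x a \<otimes>\<^bsub>R\<^esub> b"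
    if "x \<in> carrier H" "a \<in> carrier R" "b \<in> carrier R" for x a b
    using that by (simp_all add: End_bimodule_def Let_def)
qed

lemma left_module_unit: "left_module H (unit_module R \<mu>)"
proof -
  have "abelian_group (unit_module R \<mu>)"
    by (rule abelian_group_cong[OF R.is_abelian_group]) (simp_all add: unit_module_def)
  then show ?thesis
    by (simp add: left_module_def left_module_axioms_def H.ring_axioms)
      (simp add: unit_module_def anchor_closed anchor_add_right anchor_add_left anchor_mult anchor_one)
qed

abbreviation I :: "('h, ('r, 'u) elt) module" where "I \<equiv> rep_unit R \<mu>"

lemma inj_Scalar: "inj_on Scalar (carrier (unit_module R \<mu>))"
  by (simp add: inj_on_def)

lemma left_module_rep_unit: "left_module H I"
  unfolding rep_unit_def by (rule left_module_transport[OF inj_Scalar left_module_unit])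

lemma carrier_rep_unit: "carrier I = Scalar ` carrier R"
  using transport_module_simps(1)[OF inj_Scalar] by (simp add: rep_unit_def unit_module_def)

lemma smult_rep_unit: "a \<in> carrier R \<Longrightarrow> h \<odot>\<^bsub>I\<^esub> Scalar a = Scalar (\<mu> h a)"
  using transport_module_simps(4)[OF inj_Scalar] by (simp add: rep_unit_def unit_module_def)

lemma add_rep_unit:
  "\<lbrakk>a \<in> carrier R; b \<in> carrier R\<rbrakk> \<Longrightarrow> Scalar a \<oplus>\<^bsub>I\<^esub> Scalar b = Scalar (a \<oplus>\<^bsub>R\<^esub> b)"
  using transport_module_simps(3)[OF inj_Scalar] by (simp add: rep_unit_def unit_module_def)

text \<open>Taking x = 1 in \<open>anchor_lact\<close> and \<open>anchor_ract\<close> shows that R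
  acts on the unit object by ordinary multiplication on either side.\<close>

lemma source_smult_rep_unit:
  "\<lbrakk>a \<in> carrier R; b \<in> carrier R\<rbrakk> \<Longrightarrow> \<alpha> b \<odot>\<^bsub>I\<^esub> Scalar a = Scalar (b \<otimes>\<^bsub>R\<^esub> a)"
  and target_smult_rep_unit:
  "\<lbrakk>a \<in> carrier R; b \<in> carrier R\<rbrakk> \<Longrightarrow> \<beta> b \<odot>\<^bsub>I\<^esub> Scalar a = Scalar (a \<otimes>\<^bsub>R\<^esub> b)"
  using anchor_lact[of "\<one>\<^bsub>H\<^esub>" a b] anchor_ract[of "\<one>\<^bsub>H\<^esub>" a b]
  by (simp_all add: smult_rep_unit anchor_one)

lemma anchor_source_balanced:
  assumes a: "a \<in> carrier R"
  shows "balanced R HB HB H (\<lambda>x y. \<alpha> (\<mu> x a) \<otimes>\<^bsub>H\<^esub> y)"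
  using a
  by (intro balancedI additive_mapsI)
    (simp_all add: anchor_closed anchor_add_left source_add H.l_distr H.r_distr anchor_ract
      source_mult H.m_assoc)

text \<open>Replacing \<open>y\<close> by \<alpha>(b)y multiplies y(a) by b on the left; as \<beta>
  reverses products, the factor \<beta>(b) ends up next to \<open>x\<close>.\<close>

lemma anchor_target_balanced:
  assumes a: "a \<in> carrier R"
  shows "balanced R HB HB H (\<lambda>x y. \<beta> (\<mu> y a) \<otimes>\<^bsub>H\<^esub> x)"
  using a
  by (intro balancedI additive_mapsI)
    (simp_all add: anchor_closed anchor_add_left target_add H.l_distr H.r_distr anchor_lact
      target_mult H.m_assoc)

section \<open>The unitors and their inverses\<close>

context
  fixes M :: "('h, ('r, 'u) elt) module"
  assumes M: "left_module H M"
begin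

interpretation M: left_module H M by (rule M)
interpretation I: left_module H "I :: ('h, ('r, 'u) elt) module" by (rule left_module_rep_unit)
interpretation IM: left_module H "tens I M" by (rule left_module_rep_tensor[OF left_module_rep_unit M])
interpretation MI: left_module H "tens M I" by (rule left_module_rep_tensor[OF M left_module_rep_unit])

lemma left_unitor_balanced:
  "balanced R (bim (I :: ('h, ('r, 'u) elt) module)) (bim M) M (\<lambda>a m. \<alpha> (unscalar a) \<odot>\<^bsub>M\<^esub> m)"
  by (intro balancedI additive_mapsI)
    (auto simp: carrier_rep_unit add_rep_unit source_add source_mult target_smult_rep_unit
      M.act_closed M.act_add_left M.act_add_right M.act_mult)

lemma right_unitor_balanced:
  "balanced R (bim M) (bim (I :: ('h, ('r, 'u) elt) module)) M (\<lambda>m a. \<beta> (unscalar a) \<odot>\<^bsub>M\<^esub> m)"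
  by (intro balancedI additive_mapsI)
    (auto simp: carrier_rep_unit add_rep_unit target_add target_mult source_smult_rep_unit
      M.act_closed M.act_add_left M.act_add_right M.act_mult)

lemmas IM_lift = rep_lift_additive[OF left_module_rep_unit M M.abelian_group_axioms left_unitor_balanced]
lemmas MI_lift = rep_lift_additive[OF M left_module_rep_unit M.abelian_group_axioms right_unitor_balanced]

lemma rep_left_unitor_additive: "rep_left_unitor R \<alpha> \<beta> \<Delta> \<mu> M \<in> additive_maps (tens I M) M"
  unfolding rep_left_unitor_def by (rule additive_maps_restrict[OF IM_lift IM.abelian_group_axioms])

lemma rep_right_unitor_additive: "rep_right_unitor R \<alpha> \<beta> \<Delta> \<mu> M \<in> additive_maps (tens M I) M"
  unfolding rep_right_unitor_def by (rule additive_maps_restrict[OF MI_lift MI.abelian_group_axioms])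

lemma rep_left_unitor_rpure:
  "\<lbrakk>a \<in> carrier R; m \<in> carrier M\<rbrakk> \<Longrightarrow>
    rep_left_unitor R \<alpha> \<beta> \<Delta> \<mu> M (rpure I M (Scalar a) m) = \<alpha> a \<odot>\<^bsub>M\<^esub> m"
  using rep_lift_rpure[OF left_module_rep_unit M M.abelian_group_axioms left_unitor_balanced, of "Scalar a" m]
    rpure_closed[OF left_module_rep_unit M, of "Scalar a" m]
  by (simp add: rep_left_unitor_def carrier_rep_unit)

lemma rep_right_unitor_rpure:
  "\<lbrakk>a \<in> carrier R; m \<in> carrier M\<rbrakk> \<Longrightarrow>
    rep_right_unitor R \<alpha> \<beta> \<Delta> \<mu> M (rpure M I m (Scalar a)) = \<beta> a \<odot>\<^bsub>M\<^esub> m"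
  using rep_lift_rpure[OF M left_module_rep_unit M.abelian_group_axioms right_unitor_balanced, of m "Scalar a"]
    rpure_closed[OF M left_module_rep_unit, of m "Scalar a"]
  by (simp add: rep_right_unitor_def carrier_rep_unit)

text \<open>With \<Delta>(h) = \<Sum> x \<otimes> y, the action of \<open>h\<close> on a \<otimes> m
  is sent to \<Sum> \<alpha>(x(a))ym. The coefficient of \<open>m\<close> is
  \<open>anchor_phi_source\<close> at \<Delta>(h) and \<open>a\<close>, which the anchor axiom
  evaluates to h\<alpha>(a).\<close>

lemma rep_left_unitor_hom: "rep_left_unitor R \<alpha> \<beta> \<Delta> \<mu> M \<in> rep_hom H (tens I M) M"
proof -
  let ?l = "rep_left_unitor R \<alpha> \<beta> \<Delta> \<mu> M"
  note ab = M.abelian_group_axioms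
  have "?l (h \<odot>\<^bsub>tens I M\<^esub> t) = h \<odot>\<^bsub>M\<^esub> ?l t" if h: "h \<in> carrier H" and t: "t \<in> carrier (tens I M)" for h t
  proof (rule rep_tensor_ext[OF left_module_rep_unit M ab
        additive_maps_comp[OF left_module_additive_act[OF IM.left_module_axioms h] rep_left_unitor_additive]
        additive_maps_comp[OF rep_left_unitor_additive left_module_additive_act[OF M h]] _ t])
    fix s m assume s: "s \<in> carrier (I :: ('h, ('r, 'u) elt) module)" and m: "m \<in> carrier M"
    then obtain a where a: "a \<in> carrier R" "s = Scalar a" by (auto simp: carrier_rep_unit)
    have "?l (h \<odot>\<^bsub>tens I M\<^esub> rpure I M s m) =
        tensor_lift M (\<lambda>x y. ?l (rpure I M (x \<odot>\<^bsub>I\<^esub> s) (y \<odot>\<^bsub>M\<^esub> m))) (\<Delta> h)"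
      by (rule additive_smult_rpure[OF left_module_rep_unit M ab rep_left_unitor_additive h s m])
    also have "\<dots> = tensor_lift M (\<lambda>x y. (\<alpha> (\<mu> x a) \<otimes>\<^bsub>H\<^esub> y) \<odot>\<^bsub>M\<^esub> m) (\<Delta> h)"
      using a m
      by (intro HH.tensor_lift_cong[OF ab balanced_comp[OF
              rpure_act_balanced[OF left_module_rep_unit M s m] rep_left_unitor_additive] comult_closed[OF h]])
        (simp add: smult_rep_unit rep_left_unitor_rpure anchor_closed M.act_closed M.act_mult)
    \<comment> \<open>The orbit map of \<open>m\<close> is additive from H to M, so \<open>m\<close>
      can be taken out of the sum; what remains is an element of H.\<close>
    also have "\<dots> = tensor_lift H (\<lambda>x y. \<alpha> (\<mu> x a) \<otimes>\<^bsub>H\<^esub> y) (\<Delta> h) \<odot>\<^bsub>M\<^esub> m"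
      by (rule HH.tensor_lift_comp[OF H.is_abelian_group ab anchor_source_balanced[OF a(1)]
            left_module_additive_orbit[OF M m] comult_closed[OF h], symmetric])
    also have "\<dots> = h \<odot>\<^bsub>M\<^esub> ?l (rpure I M s m)"
      using anchor_source[OF h a(1)] a m h
      by (simp add: anchor_phi_source_def M.act_mult rep_left_unitor_rpure)
    finally show "?l (h \<odot>\<^bsub>tens I M\<^esub> rpure I M s m) = h \<odot>\<^bsub>M\<^esub> ?l (rpure I M s m)" .
  qed
  then show ?thesis
    using rep_hom_restrictI[OF IM.left_module_axioms rep_left_unitor_additive]
    by (simp add: rep_left_unitor_def)
qed

lemma rep_right_unitor_hom: "rep_right_unitor R \<alpha> \<beta> \<Delta> \<mu> M \<in> rep_hom H (tens M I) M"
proof -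
  let ?r = "rep_right_unitor R \<alpha> \<beta> \<Delta> \<mu> M"
  note ab = M.abelian_group_axioms
  have "?r (h \<odot>\<^bsub>tens M I\<^esub> t) = h \<odot>\<^bsub>M\<^esub> ?r t" if h: "h \<in> carrier H" and t: "t \<in> carrier (tens M I)" for h t
  proof (rule rep_tensor_ext[OF M left_module_rep_unit ab
        additive_maps_comp[OF left_module_additive_act[OF MI.left_module_axioms h] rep_right_unitor_additive]
        additive_maps_comp[OF rep_right_unitor_additive left_module_additive_act[OF M h]] _ t])
    fix m s assume s: "s \<in> carrier (I :: ('h, ('r, 'u) elt) module)" and m: "m \<in> carrier M"
    then obtain a where a: "a \<in> carrier R" "s = Scalar a" by (auto simp: carrier_rep_unit)
    have "?r (h \<odot>\<^bsub>tens M I\<^esub> rpure M I m s) =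
        tensor_lift M (\<lambda>x y. ?r (rpure M I (x \<odot>\<^bsub>M\<^esub> m) (y \<odot>\<^bsub>I\<^esub> s))) (\<Delta> h)"
      by (rule additive_smult_rpure[OF M left_module_rep_unit ab rep_right_unitor_additive h m s])
    also have "\<dots> = tensor_lift M (\<lambda>x y. (\<beta> (\<mu> y a) \<otimes>\<^bsub>H\<^esub> x) \<odot>\<^bsub>M\<^esub> m) (\<Delta> h)"
      using a m
      by (intro HH.tensor_lift_cong[OF ab balanced_comp[OF
              rpure_act_balanced[OF M left_module_rep_unit m s] rep_right_unitor_additive] comult_closed[OF h]])
        (simp add: smult_rep_unit rep_right_unitor_rpure anchor_closed M.act_closed M.act_mult)
    also have "\<dots> = tensor_lift H (\<lambda>x y. \<beta> (\<mu> y a) \<otimes>\<^bsub>H\<^esub> x) (\<Delta> h) \<odot>\<^bsub>M\<^esub> m"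
      by (rule HH.tensor_lift_comp[OF H.is_abelian_group ab anchor_target_balanced[OF a(1)]
            left_module_additive_orbit[OF M m] comult_closed[OF h], symmetric])
    also have "\<dots> = h \<odot>\<^bsub>M\<^esub> ?r (rpure M I m s)"
      using anchor_target[OF h a(1)] a m h
      by (simp add: anchor_phi_target_def M.act_mult rep_right_unitor_rpure)
    finally show "?r (h \<odot>\<^bsub>tens M I\<^esub> rpure M I m s) = h \<odot>\<^bsub>M\<^esub> ?r (rpure M I m s)" .
  qed
  then show ?thesis
    using rep_hom_restrictI[OF MI.left_module_axioms rep_right_unitor_additive]
    by (simp add: rep_right_unitor_def)
qed

lemma rep_left_unitor_iso:
  "rep_left_unitor R \<alpha> \<beta> \<Delta> \<mu> M \<in> category.Iso (rep_hom H) rep_id rep_comp (tens I M) M"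
proof -
  let ?l = "rep_left_unitor R \<alpha> \<beta> \<Delta> \<mu> M"
  \<comment> \<open>The inverse is m \<mapsto> 1 \<otimes> m, because 1 \<otimes> \<alpha>(a)m = 1a
    \<otimes> m = a \<otimes> m by the balancing relation.\<close>
  let ?g = "rpure I M (Scalar \<one>\<^bsub>R\<^esub>)"
  have one: "Scalar \<one>\<^bsub>R\<^esub> \<in> carrier (I :: ('h, ('r, 'u) elt) module)"
    by (simp add: carrier_rep_unit)
  have g: "?g \<in> additive_maps M (tens I M)"
    by (rule rpure_add_right[OF left_module_rep_unit M one])
  show ?thesis
  proof (rule rep_isoI[OF IM.left_module_axioms M rep_left_unitor_hom additive_maps_closed[OF g]])
    show "?g (?l t) = t" if "t \<in> carrier (tens I M)" for t
    proof (rule rep_tensor_ext[OF left_module_rep_unit M IM.abelian_group_axioms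
          additive_maps_comp[OF rep_left_unitor_additive g] additive_maps_id _ that])
      fix s m assume "s \<in> carrier (I :: ('h, ('r, 'u) elt) module)" and m: "m \<in> carrier M"
      then obtain a where a: "a \<in> carrier R" "s = Scalar a" by (auto simp: carrier_rep_unit)
      show "?g (?l (rpure I M s m)) = rpure I M s m"
        using a m rpure_act[OF left_module_rep_unit M one a(1) m, symmetric]
        by (simp add: rep_left_unitor_rpure target_smult_rep_unit)
    qed
    show "?l (?g m) = m" if "m \<in> carrier M" for m
      using that by (simp add: rep_left_unitor_rpure source_one M.act_one)
  qed
qed

lemma rep_right_unitor_iso:
  "rep_right_unitor R \<alpha> \<beta> \<Delta> \<mu> M \<in> category.Iso (rep_hom H) rep_id rep_comp (tens M I) M"
proof -
  let ?r = "rep_right_unitor R \<alpha> \<beta> \<Delta> \<mu> M"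
  \<comment> \<open>Here the inverse is m \<mapsto> m \<otimes> 1: the relation is read the other
    way, \<beta>(a)m \<otimes> 1 = m \<otimes> a1 = m \<otimes> a.\<close>
  let ?g = "\<lambda>m. rpure M I m (Scalar \<one>\<^bsub>R\<^esub>)"
  have one: "Scalar \<one>\<^bsub>R\<^esub> \<in> carrier (I :: ('h, ('r, 'u) elt) module)"
    by (simp add: carrier_rep_unit)
  have g: "?g \<in> additive_maps M (tens M I)"
    by (rule rpure_add_left[OF M left_module_rep_unit one])
  show ?thesis
  proof (rule rep_isoI[OF MI.left_module_axioms M rep_right_unitor_hom additive_maps_closed[OF g]])
    show "?g (?r t) = t" if "t \<in> carrier (tens M I)" for t
    proof (rule rep_tensor_ext[OF M left_module_rep_unit MI.abelian_group_axioms
          additive_maps_comp[OF rep_right_unitor_additive g] additive_maps_id _ that])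
      fix m s assume "s \<in> carrier (I :: ('h, ('r, 'u) elt) module)" and m: "m \<in> carrier M"
      then obtain a where a: "a \<in> carrier R" "s = Scalar a" by (auto simp: carrier_rep_unit)
      show "?g (?r (rpure M I m s)) = rpure M I m s"
        using a m rpure_act[OF M left_module_rep_unit m a(1) one]
        by (simp add: rep_right_unitor_rpure source_smult_rep_unit)
    qed
    show "?r (?g m) = m" if "m \<in> carrier M" for m
      using that by (simp add: rep_right_unitor_rpure target_one M.act_one)
  qed
qed

end

section \<open>Naturality of the unitors and the triangle\<close>

lemma rep_left_unitor_natural:
  assumes "left_module H M" "left_module H N" "f \<in> rep_hom H M N"
  shows "rep_comp (tens I M) (tens I N) N (rep_left_unitor R \<alpha> \<beta> \<Delta> \<mu> N)
      (rep_tensor_map R \<alpha> \<beta> \<Delta> I I M N (rep_id I) f) =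
    rep_comp (tens I M) M N f (rep_left_unitor R \<alpha> \<beta> \<Delta> \<mu> M)"
  using assms
  by (intro rep_tensor_hom_eqI[of I M N] rep_homs rep_left_unitor_hom left_module_rep_tensor
      left_module_rep_unit)
    (auto simp: carrier_rep_unit rep_eval left_module_rep_unit rep_left_unitor_rpure rep_hom_linear)

lemma rep_right_unitor_natural:
  assumes "left_module H M" "left_module H N" "f \<in> rep_hom H M N"
  shows "rep_comp (tens M I) (tens N I) N (rep_right_unitor R \<alpha> \<beta> \<Delta> \<mu> N)
      (rep_tensor_map R \<alpha> \<beta> \<Delta> M N I I f (rep_id I)) =
    rep_comp (tens M I) M N f (rep_right_unitor R \<alpha> \<beta> \<Delta> \<mu> M)"
  using assms
  by (intro rep_tensor_hom_eqI[of M I N] rep_homs rep_right_unitor_hom left_module_rep_tensor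
      left_module_rep_unit)
    (auto simp: carrier_rep_unit rep_eval left_module_rep_unit rep_right_unitor_rpure rep_hom_linear)

lemma rep_triangle:
  fixes M N :: "('h, ('r, 'u) elt) module"
  assumes M: "left_module H M" and N: "left_module H N"
  shows "rep_comp (tens (tens M I) N) (tens M (tens I N)) (tens M N)
      (rep_tensor_map R \<alpha> \<beta> \<Delta> M M (tens I N) N (rep_id M) (rep_left_unitor R \<alpha> \<beta> \<Delta> \<mu> N))
      (rep_assoc R \<alpha> \<beta> \<Delta> M I N) =
    rep_tensor_map R \<alpha> \<beta> \<Delta> (tens M I) M N N (rep_right_unitor R \<alpha> \<beta> \<Delta> \<mu> M) (rep_id N)"
  using assms
proof (intro rep_tensor_hom_eqI_left[of M I N "tens M N"] rep_homs rep_left_unitor_hom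
    rep_right_unitor_hom left_module_rep_tensor left_module_rep_unit)
  fix m s n assume m: "m \<in> carrier M" and "s \<in> carrier (I :: ('h, ('r, 'u) elt) module)"
    and n: "n \<in> carrier N"
  then obtain a where a: "a \<in> carrier R" "s = Scalar a" "s \<in> carrier (I :: ('h, ('r, 'u) elt) module)"
    by (auto simp: carrier_rep_unit)
  then show "rep_comp (tens (tens M I) N) (tens M (tens I N)) (tens M N)
      (rep_tensor_map R \<alpha> \<beta> \<Delta> M M (tens I N) N (rep_id M) (rep_left_unitor R \<alpha> \<beta> \<Delta> \<mu> N))
      (rep_assoc R \<alpha> \<beta> \<Delta> M I N) (rpure (tens M I) N (rpure M I m s) n) =
    rep_tensor_map R \<alpha> \<beta> \<Delta> (tens M I) M N N (rep_right_unitor R \<alpha> \<beta> \<Delta> \<mu> M) (rep_id N)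
      (rpure (tens M I) N (rpure M I m s) n)"
    using M N m n rpure_act[OF M N m a(1) n]
    by (simp add: rep_eval left_module_rep_unit rep_left_unitor_hom rep_right_unitor_hom
        rep_left_unitor_rpure rep_right_unitor_rpure)
qed

lemma monoidal_category_rep:
  "monoidal_category (rep_obj H :: ('h, ('r, 'u) elt) module set) (rep_hom H) rep_id rep_comp
    (rep_tensor R \<alpha> \<beta> \<Delta>) (rep_tensor_map R \<alpha> \<beta> \<Delta>) (rep_unit R \<mu>) (rep_assoc R \<alpha> \<beta> \<Delta>)
    (rep_left_unitor R \<alpha> \<beta> \<Delta> \<mu>) (rep_right_unitor R \<alpha> \<beta> \<Delta> \<mu>)"
  by (rule monoidal_category.intro[OF category_rep], rule monoidal_category_axioms.intro;
      unfold rep_obj_def mem_Collect_eq;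
      fact left_module_rep_tensor rep_tensor_map_hom rep_tensor_map_id rep_tensor_map_comp
        left_module_rep_unit rep_assoc_iso rep_assoc_natural rep_left_unitor_iso
        rep_left_unitor_natural rep_right_unitor_iso rep_right_unitor_natural rep_pentagon rep_triangle)

end

theorem theorem3p6:
  fixes K :: "'k ring" and H :: "('k, 'h) module" and R :: "('k, 'r) module"
    and \<alpha> \<beta> :: "'r \<Rightarrow> 'h" and \<Delta> :: "'h \<Rightarrow> ('h \<times> 'h \<Rightarrow>\<^sub>0 int) set" and \<epsilon> :: "'h \<Rightarrow> 'r"
    and \<mu> :: "'h \<Rightarrow> 'r \<Rightarrow> 'r"
  assumes "field K"
    and "\<And>n::nat. n > 0 \<Longrightarrow> [n] \<cdot>\<^bsub>K\<^esub> \<one>\<^bsub>K\<^esub> \<noteq> \<zero>\<^bsub>K\<^esub>"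
    and "anchored_hopf_algebroid K H R \<alpha> \<beta> \<Delta> \<epsilon> \<mu>"
  shows "monoidal_category (rep_obj H :: ('h, ('r, 'u) elt) module set)
    (rep_hom H) rep_id rep_comp
    (rep_tensor R \<alpha> \<beta> \<Delta>) (rep_tensor_map R \<alpha> \<beta> \<Delta>) (rep_unit R \<mu>)
    (rep_assoc R \<alpha> \<beta> \<Delta>)
    (rep_left_unitor R \<alpha> \<beta> \<Delta> \<mu>) (rep_right_unitor R \<alpha> \<beta> \<Delta> \<mu>)"
  using assms(3) by (rule anchored_hopf_algebroid.monoidal_category_rep)

end
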